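(* Let $(A,H,\blacktriangleright,\rho,\chi,\psi)$ be a cocycle linked pair of bialgebras, where $\chi:H\otimes H\to A$ and $\psi:H\to A\otimes A$ are convolution invertible and $A$ and $H$ are $*$-Hopf algebras. Let $\gamma:H\to A$ be a linear map such that $\gamma(1)=1$ and $\varepsilon\gamma=\varepsilon$. Then the formula $$(a\#x)^*=\sum\gamma(x_1^* )(x_2^*\blacktriangleright a^* )\#x_3^*,\qquad a\in A,\ x\in H,$$ defines a structure of $*$-Hopf algebra on $A^\psi\#_\chi H$ if and only if the following hold for all $a\in A$, $x,y\in H$: (i) $\sum\gamma(x_2^* )\big(x_3^*\blacktriangleright\gamma(x_1)^*\big)=\varepsilon(x^* )1$; (ii) $\sum\gamma(x_2^* )\big(x_3^*\blacktriangleright(x_1\blacktriangleright a)^*\big)=a^*\gamma(x^* )$; (iii) $\sum\gamma(y_1^* )\big(y_2^*\blacktriangleright\gamma(x_1^* )\big)\chi(y_3^*,x_2^* )=\sum\gamma(y_2^*x_2^* )\big((y_3^*x_3^* )\blacktriangleright\chi(x_1,y_1)^*\big)$; (iv) $\sum(x_2^* )_H\otimes\gamma(x_1^* )(x_2^* )_A=\sum\big((x_1)_H\big)^*\otimes\gamma(x_2^* )\big(x_3^*\blacktriangleright((x_1)_A)^*\big)$; (v) $\sum\big(\gamma(x_1^* )\big)_1(x_2^* )_I\otimes\big(\gamma(x_1^* )\big)_2(x_2^* )_{II}=\sum\gamma\big(((x_2)_H)^*\big)\Big(((x_3)_H)^*\blacktriangleright((x_1)_I)^*\Big)\otimes\gamma(x_4^*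 )\Big(x_5^*\blacktriangleright\big((x_1)_{II}(x_2)_A(x_3)_A\big)^*\Big)$. Hence in this situation $A\to A^\psi\#_\chi H\to H$ (with maps $a\mapsto a\#1$ and $a\#x\mapsto\varepsilon(a)x$) is an extension of $*$-Hopf algebras.
   Context: All vector spaces are over $\mathbb C$; Sweedler notation is used. A $*$-Hopf algebra is a Hopf algebra with a conjugate linear involution $*$ that is antimultiplicative and comultiplicative ($\Delta(x^* )=\sum x_1^*\otimes x_2^*$). A cocycle linked pair of bialgebras is a sextuple $(A,H,\blacktriangleright,\rho,\chi,\psi)$ with $A,H$ bialgebras and linear maps $\blacktriangleright:H\otimes A\to A$; $\rho:H\to H\otimes A$, $\rho(x)=\sum x_H\otimes x_A$; $\chi:H\otimes H\to A$; $\psi:H\to A\otimes A$, $\psi(x)=\sum x_I\otimes x_{II}$, such that for all $x,y,z\in H$, $a,b\in A$ (notation: $x_{1H}=(x_1)_H$, $x_{H1}=(x_H)_1$, $x_{HA}=(x_H)_A$, $x_{I1}=(x_I)_1$, etc.): (1) $x\blacktriangleright1=\varepsilon(x)1$; $x\blacktriangleright ab=\sum(x_1\blacktriangleright a)(x_2\blacktriangleright b)$; $1\blacktriangleright a=a$; $\sum\big(x_1\blacktriangleright(y_1\blacktriangleright a)\big)\chi(x_2,y_2)=\sum\chi(x_1,y_1)\big((x_2y_2)\blacktriangleright a\big)$; $\sum\big(x_1\blacktriangleright\chi(y_1,z_1)\big)\chi(x_2,y_2z_2)=\sum\chi(x_1,y_1)\chi(x_2y_2,z)$; $\chi(x,1)=\chi(1,x)=\varepsilon(x)1$.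 (2) $\sum\varepsilon(x_H)x_A=\varepsilon(x)1$; $\sum x_{H1}\otimes x_{H2}\otimes x_A=\sum x_{1H}\otimes x_{2H}\otimes x_{1A}x_{2A}$; $\sum x_H\varepsilon(x_A)=x$; $\sum x_{2HH}\otimes x_{1I}x_{2HA}\otimes x_{1II}x_{2A}=\sum x_{1H}\otimes x_{1A1}x_{2I}\otimes x_{1A2}x_{2II}$; $\sum x_{1I1}x_{2HI}\otimes x_{1I2}x_{2HII}\otimes x_{1II}x_{2A}=\sum x_{1I}\otimes x_{1II1}x_{2I}\otimes x_{1II2}x_{2II}$; $\sum\varepsilon(x_I)x_{II}=\sum x_I\varepsilon(x_{II})=\varepsilon(x)1$. (3) $\varepsilon(x\blacktriangleright a)=\varepsilon(x)\varepsilon(a)$; $\rho(1)=1\otimes1$; $\varepsilon(\chi(x,y))=\varepsilon(x)\varepsilon(y)$; $\psi(1)=1\otimes1$; $\sum(x_1\blacktriangleright a)_1x_{2I}\otimes(x_1\blacktriangleright a)_2x_{2II}=\sum x_{1I}(x_{2H}\blacktriangleright a_1)\otimes x_{1II}x_{2A}(x_3\blacktriangleright a_2)$; $\sum(x_2y_2)_H\otimes\chi(x_1,y_1)(x_2y_2)_A=\sum x_{1H}y_{1H}\otimes x_{1A}(x_2\blacktriangleright y_{1A})\chi(x_3,y_2)$; $\sum x_{2H}\otimes(x_1\blacktriangleright a)x_{2A}=\sum x_{1H}\otimes x_{1A}(x_2\blacktriangleright a)$; $\sum\chi(x_1,y_1)_1(x_2y_2)_I\otimes\chi(x_1,y_1)_2(x_2y_2)_{II}=\sum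 x_{1I}(x_{2H}\blacktriangleright y_{1I})\chi(x_{4H},y_{2H})\otimes x_{1II}x_{2A}(x_3\blacktriangleright y_{1II})x_{4A}(x_5\blacktriangleright y_{2A})\chi(x_6,y_3)$. The cocycle bismash product $A^\psi\#_\chi H$ is the vector space $A\otimes H$ (elements $a\#x$) with product $(a\#x)(b\#y)=\sum a(x_1\blacktriangleright b)\chi(x_2,y_1)\#x_3y_2$, unit $1\#1$, coproduct $\Delta(a\#x)=\sum a_1x_{1I}\#x_{2H}\otimes a_2x_{1II}x_{2A}\#x_3$ and counit $\varepsilon\otimes\varepsilon$; it is a bialgebra, and a Hopf algebra when $A,H$ are Hopf algebras and $\chi,\psi$ are convolution invertible. A sequence of Hopf algebra maps $A\xrightarrow{\iota}M\xrightarrow{\pi}H$ is an extension if $\iota$ is injective, $\pi$ is surjective, $\operatorname{Im}(\iota)=\{m\in M:\sum m_1\otimes\pi(m_2)=m\otimes1\}$ and $\operatorname{Ker}(\pi)=MA^+$ with $A^+=\operatorname{Ker}\varepsilon_A$. It is an extension of $*$-Hopf algebras if $A,M,H$ are $*$-Hopf algebras and $\iota,\pi$ commute with $*$. *)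

theory Defs
  imports Complex_Main "HOL-Library.Multiset"
begin

section \<open>Complex vector spaces\<close>

class complex_vector = ab_group_add +
  fixes scaleC :: "complex \<Rightarrow> 'a \<Rightarrow> 'a"  (infixr "*\<^sub>C" 75)
  assumes scaleC_add_right: "c *\<^sub>C (x + y) = c *\<^sub>C x + c *\<^sub>C y"
    and scaleC_add_left: "(c + d) *\<^sub>C x = c *\<^sub>C x + d *\<^sub>C x"
    and scaleC_scaleC: "c *\<^sub>C d *\<^sub>C x = (c * d) *\<^sub>C x"
    and scaleC_one: "1 *\<^sub>C x = x"

global_interpretation complex_vector: vector_space "scaleC :: complex \<Rightarrow> 'a \<Rightarrow> 'a::complex_vector"
  by unfold_locales (simp_all add: scaleC_add_right scaleC_add_left scaleC_scaleC scaleC_one)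

instantiation complex :: complex_vector
begin
definition scaleC_complex :: "complex \<Rightarrow> complex \<Rightarrow> complex"
  where "scaleC_complex c z = c * z"
instance by standard (simp_all add: scaleC_complex_def algebra_simps)
end

abbreviation clinear :: "('a::complex_vector \<Rightarrow> 'b::complex_vector) \<Rightarrow> bool"
  where "clinear f \<equiv> Vector_Spaces.linear scaleC scaleC f"

definition antilinear :: "('a::complex_vector \<Rightarrow> 'b::complex_vector) \<Rightarrow> bool"
  where "antilinear f \<longleftrightarrow>
    (\<forall>x y. f (x + y) = f x + f y) \<and> (\<forall>c x. f (c *\<^sub>C x) = cnj c *\<^sub>C f x)"

definition cbilinear ::
  "('a::complex_vector \<Rightarrow> 'b::complex_vector \<Rightarrow> 'c::complex_vector) \<Rightarrow> bool"
  where "cbilinear f \<longleftrightarrow> (\<forall>a. clinear (f a)) \<and> (\<forall>b. clinear (\<lambda>a. f a b))"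


section \<open>The tensor product over the complex numbers\<close>

text \<open>The usual presentation: formal finite sums of pairs, i.e. multisets, modulo biadditivity and
  \<open>(c a, b) \<sim> (a, c b)\<close>. Coefficients are absorbed into the pairs, and \<open>(- a, b)\<close> is the additive
  inverse of \<open>(a, b)\<close>.\<close>

inductive tensor_eq ::
  "('a::complex_vector \<times> 'b::complex_vector) multiset \<Rightarrow> ('a \<times> 'b) multiset \<Rightarrow> bool"
where
  tensor_eq_refl: "tensor_eq M M"
| tensor_eq_sym: "tensor_eq M N \<Longrightarrow> tensor_eq N M"
| tensor_eq_trans: "tensor_eq L M \<Longrightarrow> tensor_eq M N \<Longrightarrow> tensor_eq L N"
| tensor_eq_plus: "tensor_eq M M' \<Longrightarrow> tensor_eq N N' \<Longrightarrow> tensor_eq (M + N) (M' + N')"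
| tensor_eq_zero: "tensor_eq {#(0, b)#} {#}"
| tensor_eq_add_left: "tensor_eq {#(a + a', b)#} {#(a, b), (a', b)#}"
| tensor_eq_add_right: "tensor_eq {#(a, b + b')#} {#(a, b), (a, b')#}"
| tensor_eq_balanced: "tensor_eq {#(c *\<^sub>C a, b)#} {#(a, c *\<^sub>C b)#}"

quotient_type (overloaded) ('a, 'b) tensor (infixr "\<otimes>\<^sub>\<complex>" 21) =
  "('a::complex_vector \<times> 'b::complex_vector) multiset" / tensor_eq
  by (intro equivpI reflpI sympI transpI) (blast intro: tensor_eq.intros)+

lift_definition pure_tensor ::
  "'a::complex_vector \<Rightarrow> 'b::complex_vector \<Rightarrow> 'a \<otimes>\<^sub>\<complex> 'b"  (infixr "\<otimes>\<^sub>\<complex>" 65)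
  is "\<lambda>a b. {#(a, b)#}" .

lemma tensor_eq_image_left:
  assumes "tensor_eq M N"
    and "\<And>x y. h (x + y) = h x + h y" "h 0 = 0" "\<And>c x. h (c *\<^sub>C x) = c *\<^sub>C h x"
  shows "tensor_eq (image_mset (\<lambda>(a, b). (h a, b)) M) (image_mset (\<lambda>(a, b). (h a, b)) N)"
  using assms(1)
  by induction (auto simp: assms(2-4) intro: tensor_eq.intros)

lemma tensor_eq_union_mset:
  assumes "\<And>p. p \<in># M \<Longrightarrow> tensor_eq (f p) (g p)"
  shows "tensor_eq (\<Sum>p\<in>#M. f p) (\<Sum>p\<in>#M. g p)"
  using assms by (induction M) (auto intro: tensor_eq.intros)

instantiation tensor :: (complex_vector, complex_vector) complex_vector
begin

lift_definition zero_tensor :: "'a \<otimes>\<^sub>\<complex> 'b" is "{#}" .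

lift_definition plus_tensor :: "'a \<otimes>\<^sub>\<complex> 'b \<Rightarrow> 'a \<otimes>\<^sub>\<complex> 'b \<Rightarrow> 'a \<otimes>\<^sub>\<complex> 'b" is "(+)"
  by (rule tensor_eq_plus)

lift_definition uminus_tensor :: "'a \<otimes>\<^sub>\<complex> 'b \<Rightarrow> 'a \<otimes>\<^sub>\<complex> 'b"
  is "image_mset (\<lambda>(a, b). (- a, b))"
  by (rule tensor_eq_image_left) auto

lift_definition scaleC_tensor :: "complex \<Rightarrow> 'a \<otimes>\<^sub>\<complex> 'b \<Rightarrow> 'a \<otimes>\<^sub>\<complex> 'b"
  is "\<lambda>c. image_mset (\<lambda>(a, b). (c *\<^sub>C a, b))"
  by (rule tensor_eq_image_left) (auto simp: scaleC_add_right mult.commute)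

definition minus_tensor :: "'a \<otimes>\<^sub>\<complex> 'b \<Rightarrow> 'a \<otimes>\<^sub>\<complex> 'b \<Rightarrow> 'a \<otimes>\<^sub>\<complex> 'b"
  where "minus_tensor s t = s + (- t)"

instance
proof
  fix s t u :: "'a \<otimes>\<^sub>\<complex> 'b" and c d :: complex
  show "s + t + u = s + (t + u)"
    by transfer (simp add: add.assoc tensor_eq_refl)
  show "s + t = t + s"
    by transfer (simp add: add.commute tensor_eq_refl)
  show "0 + t = t"
    by transfer (simp add: tensor_eq_refl)
  show "- t + t = 0"
  proof transfer
    fix M :: "('a \<times> 'b) multiset"
    have "tensor_eq {#(- a, b), (a, b)#} {#}" for a :: 'a and b :: 'b
      using tensor_eq_sym[OF tensor_eq_add_left[of "- a" a b]] tensor_eq_zero[of b]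
      by (auto intro: tensor_eq_trans)
    then have "tensor_eq (\<Sum>p\<in>#M. (case p of (a, b) \<Rightarrow> {#(- a, b), (a, b)#})) (\<Sum>p\<in>#M. {#})"
      by (intro tensor_eq_union_mset) auto
    moreover have "(\<Sum>p\<in>#M. (case p of (a, b) \<Rightarrow> {#(- a, b), (a, b)#}))
        = image_mset (\<lambda>(a, b). (- a, b)) M + M"
      by (induction M) auto
    ultimately show "tensor_eq (image_mset (\<lambda>(a, b). (- a, b)) M + M) {#}"
      by simp
  qed
  show "s - t = s + - t"
    by (simp add: minus_tensor_def)
  show "c *\<^sub>C (s + t) = c *\<^sub>C s + c *\<^sub>C t"
    by transfer (simp add: tensor_eq_refl)
  show "(c + d) *\<^sub>C t = c *\<^sub>C t + d *\<^sub>C t"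
  proof transfer
    fix c d :: complex and M :: "('a \<times> 'b) multiset"
    have "tensor_eq (\<Sum>p\<in>#M. (case p of (a, b) \<Rightarrow> {#((c + d) *\<^sub>C a, b)#}))
        (\<Sum>p\<in>#M. (case p of (a, b) \<Rightarrow> {#(c *\<^sub>C a, b), (d *\<^sub>C a, b)#}))"
      by (intro tensor_eq_union_mset) (auto simp: scaleC_add_left intro: tensor_eq_add_left)
    moreover have "(\<Sum>p\<in>#M. (case p of (a, b) \<Rightarrow> {#((c + d) *\<^sub>C a, b)#}))
        = image_mset (\<lambda>(a, b). ((c + d) *\<^sub>C a, b)) M"
      by (induction M) auto
    moreover have "(\<Sum>p\<in>#M. (case p of (a, b) \<Rightarrow> {#(c *\<^sub>C a, b), (d *\<^sub>C a, b)#}))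
        = image_mset (\<lambda>(a, b). (c *\<^sub>C a, b)) M + image_mset (\<lambda>(a, b). (d *\<^sub>C a, b)) M"
      by (induction M) auto
    ultimately show "tensor_eq (image_mset (\<lambda>(a, b). ((c + d) *\<^sub>C a, b)) M)
        (image_mset (\<lambda>(a, b). (c *\<^sub>C a, b)) M + image_mset (\<lambda>(a, b). (d *\<^sub>C a, b)) M)"
      by simp
  qed
  show "c *\<^sub>C d *\<^sub>C t = (c * d) *\<^sub>C t"
    by transfer (simp add: multiset.map_comp comp_def split_def tensor_eq_refl scaleC_scaleC)
  show "1 *\<^sub>C t = t"
    by transfer (simp add: scaleC_one tensor_eq_refl)
qed

end

text \<open>For \<open>t = \<Sum>\<^sub>i a\<^sub>i \<otimes> b\<^sub>i\<close>, \<open>tsum t f\<close> is the Sweedler-type sum \<open>\<Sum>\<^sub>i f a\<^sub>i b\<^sub>i\<close>. It is computed on a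
  chosen representative, which is irrelevant as soon as \<open>f\<close> is biadditive with
  \<open>f (c a) b = f a (c b)\<close>; this covers \<open>f\<close> that are conjugate linear in both arguments.\<close>

definition tsum :: "'a::complex_vector \<otimes>\<^sub>\<complex> 'b::complex_vector \<Rightarrow> ('a \<Rightarrow> 'b \<Rightarrow> 'c) \<Rightarrow> 'c::complex_vector"
  where "tsum t f = (\<Sum>(a, b)\<in>#rep_tensor t. f a b)"

definition balanced ::
  "('a::complex_vector \<Rightarrow> 'b::complex_vector \<Rightarrow> 'c::complex_vector) \<Rightarrow> bool"
  where "balanced f \<longleftrightarrow>
    (\<forall>a a' b. f (a + a') b = f a b + f a' b) \<and> (\<forall>a b b'. f a (b + b') = f a b + f a b') \<and>
    (\<forall>c a b. f (c *\<^sub>C a) b = f a (c *\<^sub>C b))"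

lemma balanced_zero_left:
  assumes "balanced f" shows "f 0 b = 0"
proof -
  have "f (0 + 0) b = f 0 b + f 0 b"
    using assms unfolding balanced_def by blast
  then show ?thesis by simp
qed

lemma sum_mset_tensor_eq:
  assumes "balanced f" "tensor_eq M N"
  shows "(\<Sum>(a, b)\<in>#M. f a b) = (\<Sum>(a, b)\<in>#N. f a b)"
  using assms(2,1)
proof induction
  case (tensor_eq_zero b)
  then show ?case by (simp add: balanced_zero_left)
qed (auto simp: balanced_def)

lemma tsum_abs_tensor:
  assumes "balanced f"
  shows "tsum (abs_tensor M) f = (\<Sum>(a, b)\<in>#M. f a b)"
  unfolding tsum_def
  by (rule sum_mset_tensor_eq[OF assms])
     (meson Quotient_rep_abs Quotient_tensor tensor_eq_refl)

lemma tsum_pure: "balanced f \<Longrightarrow> tsum (a \<otimes>\<^sub>\<complex> b) f = f a b"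
  by (simp add: tsum_abs_tensor pure_tensor.abs_eq)

lemma tsum_add:
  assumes "balanced f" shows "tsum (s + t) f = tsum s f + tsum t f"
proof -
  obtain M N where "s = abs_tensor M" "t = abs_tensor N"
    by (metis Quotient_abs_rep Quotient_tensor)
  then show ?thesis
    by (simp add: plus_tensor.abs_eq tsum_abs_tensor[OF assms])
qed


section \<open>Bialgebras and Hopf algebras\<close>

text \<open>A multiplication \<open>B \<otimes> B \<rightarrow> B\<close> is given as the corresponding bilinear map of two arguments.\<close>

record (overloaded) ('a::complex_vector) bialg =
  mu :: "'a \<Rightarrow> 'a \<Rightarrow> 'a"  (infixl "\<cdot>\<index>" 70)
  unt :: 'a  ("\<^bold>1\<index>")
  Delta :: "'a \<Rightarrow> 'a \<otimes>\<^sub>\<complex> 'a"  ("\<Delta>\<index>")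
  eps :: "'a \<Rightarrow> complex"  ("\<epsilon>\<index>")

text \<open>\<open>sweedlern B x f\<close> is \<open>\<Sum> f x\<^sub>1 \<dots> x\<^sub>n\<close> in Sweedler notation for the iterated coproduct of \<open>B\<close>.\<close>

definition sweedler2 :: "'a::complex_vector bialg \<Rightarrow> 'a \<Rightarrow> ('a \<Rightarrow> 'a \<Rightarrow> 'c) \<Rightarrow> 'c::complex_vector"
  where "sweedler2 B x f = tsum (\<Delta>\<^bsub>B\<^esub> x) f"

definition sweedler3 ::
  "'a::complex_vector bialg \<Rightarrow> 'a \<Rightarrow> ('a \<Rightarrow> 'a \<Rightarrow> 'a \<Rightarrow> 'c) \<Rightarrow> 'c::complex_vector"
  where "sweedler3 B x f = tsum (\<Delta>\<^bsub>B\<^esub> x) (\<lambda>x1 r. sweedler2 B r (f x1))"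

definition sweedler4 ::
  "'a::complex_vector bialg \<Rightarrow> 'a \<Rightarrow> ('a \<Rightarrow> 'a \<Rightarrow> 'a \<Rightarrow> 'a \<Rightarrow> 'c) \<Rightarrow> 'c::complex_vector"
  where "sweedler4 B x f = tsum (\<Delta>\<^bsub>B\<^esub> x) (\<lambda>x1 r. sweedler3 B r (f x1))"

definition sweedler5 ::
  "'a::complex_vector bialg \<Rightarrow> 'a \<Rightarrow> ('a \<Rightarrow> 'a \<Rightarrow> 'a \<Rightarrow> 'a \<Rightarrow> 'a \<Rightarrow> 'c) \<Rightarrow> 'c::complex_vector"
  where "sweedler5 B x f = tsum (\<Delta>\<^bsub>B\<^esub> x) (\<lambda>x1 r. sweedler4 B r (f x1))"

definition sweedler6 ::
  "'a::complex_vector bialg \<Rightarrow> 'a \<Rightarrow>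
    ('a \<Rightarrow> 'a \<Rightarrow> 'a \<Rightarrow> 'a \<Rightarrow> 'a \<Rightarrow> 'a \<Rightarrow> 'c) \<Rightarrow> 'c::complex_vector"
  where "sweedler6 B x f = tsum (\<Delta>\<^bsub>B\<^esub> x) (\<lambda>x1 r. sweedler5 B r (f x1))"

definition tensor_bialg ::
  "'a::complex_vector bialg \<Rightarrow> 'b::complex_vector bialg \<Rightarrow> ('a \<otimes>\<^sub>\<complex> 'b) bialg"
  where "tensor_bialg B C =
    \<lparr>mu = (\<lambda>s t. tsum s (\<lambda>a b. tsum t (\<lambda>a' b'. (a \<cdot>\<^bsub>B\<^esub> a') \<otimes>\<^sub>\<complex> (b \<cdot>\<^bsub>C\<^esub> b')))),
     unt = \<^bold>1\<^bsub>B\<^esub> \<otimes>\<^sub>\<complex> \<^bold>1\<^bsub>C\<^esub>,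
     Delta = (\<lambda>s. tsum s (\<lambda>a b. sweedler2 B a (\<lambda>a1 a2. sweedler2 C b (\<lambda>b1 b2.
       (a1 \<otimes>\<^sub>\<complex> b1) \<otimes>\<^sub>\<complex> (a2 \<otimes>\<^sub>\<complex> b2))))),
     eps = (\<lambda>s. tsum s (\<lambda>a b. \<epsilon>\<^bsub>B\<^esub> a * \<epsilon>\<^bsub>C\<^esub> b))\<rparr>"

locale bialgebra =
  fixes B :: "'a::complex_vector bialg" (structure)
  assumes mu_bilinear: "cbilinear (mu B)"
    and mu_assoc: "(a \<cdot> b) \<cdot> c = a \<cdot> (b \<cdot> c)"
    and mu_unit_left: "\<^bold>1 \<cdot> a = a"
    and mu_unit_right: "a \<cdot> \<^bold>1 = a"
    and Delta_linear: "clinear \<Delta>"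
    and eps_linear: "clinear \<epsilon>"
    and coassoc: "sweedler2 B a (\<lambda>a1 a2. sweedler2 B a1 (\<lambda>u v. u \<otimes>\<^sub>\<complex> v \<otimes>\<^sub>\<complex> a2))
      = sweedler2 B a (\<lambda>a1 a2. sweedler2 B a2 (\<lambda>u v. a1 \<otimes>\<^sub>\<complex> u \<otimes>\<^sub>\<complex> v))"
    and counit_left: "sweedler2 B a (\<lambda>a1 a2. \<epsilon> a1 *\<^sub>C a2) = a"
    and counit_right: "sweedler2 B a (\<lambda>a1 a2. \<epsilon> a2 *\<^sub>C a1) = a"
    and Delta_mult: "\<Delta> (a \<cdot> b) = \<Delta> a \<cdot>\<^bsub>tensor_bialg B B\<^esub> \<Delta> b"
    and Delta_unit: "\<Delta> \<^bold>1 = \<^bold>1 \<otimes>\<^sub>\<complex> \<^bold>1"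
    and eps_mult: "\<epsilon> (a \<cdot> b) = \<epsilon> a * \<epsilon> b"
    and eps_unit: "\<epsilon> \<^bold>1 = 1"

definition antipode :: "'a::complex_vector bialg \<Rightarrow> ('a \<Rightarrow> 'a) \<Rightarrow> bool"
  where "antipode B S \<longleftrightarrow> clinear S \<and>
    (\<forall>a. sweedler2 B a (\<lambda>a1 a2. S a1 \<cdot>\<^bsub>B\<^esub> a2) = \<epsilon>\<^bsub>B\<^esub> a *\<^sub>C \<^bold>1\<^bsub>B\<^esub>) \<and>
    (\<forall>a. sweedler2 B a (\<lambda>a1 a2. a1 \<cdot>\<^bsub>B\<^esub> S a2) = \<epsilon>\<^bsub>B\<^esub> a *\<^sub>C \<^bold>1\<^bsub>B\<^esub>)"

locale hopf_algebra = bialgebra +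
  assumes ex_antipode: "\<exists>S. antipode B S"

locale star_hopf_algebra = hopf_algebra B
  for B :: "'a::complex_vector bialg" (structure) +
  fixes star :: "'a \<Rightarrow> 'a"
  assumes star_antilinear: "antilinear star"
    and star_star: "star (star a) = a"
    and star_mult: "star (a \<cdot> b) = star b \<cdot> star a"
    and star_comult: "\<Delta> (star a) = sweedler2 B a (\<lambda>a1 a2. star a1 \<otimes>\<^sub>\<complex> star a2)"

definition conv_invertible ::
  "'c::complex_vector bialg \<Rightarrow> 'a::complex_vector bialg \<Rightarrow> ('c \<Rightarrow> 'a) \<Rightarrow> bool"
  where "conv_invertible C B f \<longleftrightarrow> (\<exists>g. clinear g \<and>
    (\<forall>c. sweedler2 C c (\<lambda>c1 c2. f c1 \<cdot>\<^bsub>B\<^esub> g c2) = \<epsilon>\<^bsub>C\<^esub> c *\<^sub>C \<^bold>1\<^bsub>B\<^esub>) \<and>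
    (\<forall>c. sweedler2 C c (\<lambda>c1 c2. g c1 \<cdot>\<^bsub>B\<^esub> f c2) = \<epsilon>\<^bsub>C\<^esub> c *\<^sub>C \<^bold>1\<^bsub>B\<^esub>))"

definition hopf_hom ::
  "'a::complex_vector bialg \<Rightarrow> 'b::complex_vector bialg \<Rightarrow> ('a \<Rightarrow> 'b) \<Rightarrow> bool"
  where "hopf_hom B C f \<longleftrightarrow> clinear f \<and>
    (\<forall>a b. f (a \<cdot>\<^bsub>B\<^esub> b) = f a \<cdot>\<^bsub>C\<^esub> f b) \<and> f \<^bold>1\<^bsub>B\<^esub> = \<^bold>1\<^bsub>C\<^esub> \<and>
    (\<forall>a. \<Delta>\<^bsub>C\<^esub> (f a) = sweedler2 B a (\<lambda>a1 a2. f a1 \<otimes>\<^sub>\<complex> f a2)) \<and>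
    (\<forall>a. \<epsilon>\<^bsub>C\<^esub> (f a) = \<epsilon>\<^bsub>B\<^esub> a) \<and>
    (\<forall>S S'. antipode B S \<longrightarrow> antipode C S' \<longrightarrow> (\<forall>a. f (S a) = S' (f a)))"

definition hopf_extension ::
  "'a::complex_vector bialg \<Rightarrow> 'm::complex_vector bialg \<Rightarrow> 'h::complex_vector bialg \<Rightarrow>
    ('a \<Rightarrow> 'm) \<Rightarrow> ('m \<Rightarrow> 'h) \<Rightarrow> bool"
  where "hopf_extension A M H \<iota> \<pi> \<longleftrightarrow>
    hopf_algebra A \<and> hopf_algebra M \<and> hopf_algebra H \<and>
    hopf_hom A M \<iota> \<and> hopf_hom M H \<pi> \<and> inj \<iota> \<and> surj \<pi> \<and>
    range \<iota> = {m. sweedler2 M m (\<lambda>m1 m2. m1 \<otimes>\<^sub>\<complex> \<pi> m2) = m \<otimes>\<^sub>\<complex> \<^bold>1\<^bsub>H\<^esub>} \<and>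
    {m. \<pi> m = 0} = complex_vector.span {m \<cdot>\<^bsub>M\<^esub> \<iota> a |m a. \<epsilon>\<^bsub>A\<^esub> a = 0}"

definition star_hopf_extension ::
  "'a::complex_vector bialg \<Rightarrow> ('a \<Rightarrow> 'a) \<Rightarrow> 'm::complex_vector bialg \<Rightarrow> ('m \<Rightarrow> 'm) \<Rightarrow>
    'h::complex_vector bialg \<Rightarrow> ('h \<Rightarrow> 'h) \<Rightarrow> ('a \<Rightarrow> 'm) \<Rightarrow> ('m \<Rightarrow> 'h) \<Rightarrow> bool"
  where "star_hopf_extension A starA M starM H starH \<iota> \<pi> \<longleftrightarrow>
    hopf_extension A M H \<iota> \<pi> \<and>
    star_hopf_algebra A starA \<and> star_hopf_algebra M starM \<and> star_hopf_algebra H starH \<and>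
    (\<forall>a. \<iota> (starA a) = starM (\<iota> a)) \<and> (\<forall>m. \<pi> (starM m) = starH (\<pi> m))"


section \<open>Cocycle linked pairs and cocycle bismash products\<close>

text \<open>\<open>act x a\<close> is the (weak) action of \<open>x\<close> on \<open>a\<close>. As for multiplications, \<open>act\<close> and \<open>\<chi>\<close> are given as
  bilinear maps. A bound variable such as \<open>x2HA\<close> stands for \<open>(x\<^sub>2\<^sub>H)\<^sub>A\<close>.\<close>

locale cocycle_linked_pair =
  A: bialgebra A + H: bialgebra H
  for A :: "'a::complex_vector bialg" and H :: "'h::complex_vector bialg" +
  fixes act :: "'h \<Rightarrow> 'a \<Rightarrow> 'a"
    and \<rho> :: "'h \<Rightarrow> 'h \<otimes>\<^sub>\<complex> 'a"
    and \<chi> :: "'h \<Rightarrow> 'h \<Rightarrow> 'a"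
    and \<psi> :: "'h \<Rightarrow> 'a \<otimes>\<^sub>\<complex> 'a"
  assumes act_bilinear: "cbilinear act"
    and \<rho>_linear: "clinear \<rho>"
    and \<chi>_bilinear: "cbilinear \<chi>"
    and \<psi>_linear: "clinear \<psi>"
    and act_unit: "act x \<^bold>1\<^bsub>A\<^esub> = \<epsilon>\<^bsub>H\<^esub> x *\<^sub>C \<^bold>1\<^bsub>A\<^esub>"
    and act_mult: "act x (a \<cdot>\<^bsub>A\<^esub> b) = sweedler2 H x (\<lambda>x1 x2. act x1 a \<cdot>\<^bsub>A\<^esub> act x2 b)"
    and unit_act: "act \<^bold>1\<^bsub>H\<^esub> a = a"
    and act_act:
      "sweedler2 H x (\<lambda>x1 x2. sweedler2 H y (\<lambda>y1 y2. act x1 (act y1 a) \<cdot>\<^bsub>A\<^esub> \<chi> x2 y2))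
       = sweedler2 H x (\<lambda>x1 x2. sweedler2 H y (\<lambda>y1 y2. \<chi> x1 y1 \<cdot>\<^bsub>A\<^esub> act (x2 \<cdot>\<^bsub>H\<^esub> y2) a))"
    and \<chi>_cocycle:
      "sweedler2 H x (\<lambda>x1 x2. sweedler2 H y (\<lambda>y1 y2. sweedler2 H z (\<lambda>z1 z2.
         act x1 (\<chi> y1 z1) \<cdot>\<^bsub>A\<^esub> \<chi> x2 (y2 \<cdot>\<^bsub>H\<^esub> z2))))
       = sweedler2 H x (\<lambda>x1 x2. sweedler2 H y (\<lambda>y1 y2. \<chi> x1 y1 \<cdot>\<^bsub>A\<^esub> \<chi> (x2 \<cdot>\<^bsub>H\<^esub> y2) z))"
    and \<chi>_unit_right: "\<chi> x \<^bold>1\<^bsub>H\<^esub> = \<epsilon>\<^bsub>H\<^esub> x *\<^sub>C \<^bold>1\<^bsub>A\<^esub>"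
    and \<chi>_unit_left: "\<chi> \<^bold>1\<^bsub>H\<^esub> x = \<epsilon>\<^bsub>H\<^esub> x *\<^sub>C \<^bold>1\<^bsub>A\<^esub>"
    and \<rho>_counit_left: "tsum (\<rho> x) (\<lambda>xH xA. \<epsilon>\<^bsub>H\<^esub> xH *\<^sub>C xA) = \<epsilon>\<^bsub>H\<^esub> x *\<^sub>C \<^bold>1\<^bsub>A\<^esub>"
    and \<rho>_comult:
      "tsum (\<rho> x) (\<lambda>xH xA. sweedler2 H xH (\<lambda>xH1 xH2. xH1 \<otimes>\<^sub>\<complex> xH2 \<otimes>\<^sub>\<complex> xA))
       = sweedler2 H x (\<lambda>x1 x2. tsum (\<rho> x1) (\<lambda>x1H x1A. tsum (\<rho> x2) (\<lambda>x2H x2A.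
           x1H \<otimes>\<^sub>\<complex> x2H \<otimes>\<^sub>\<complex> (x1A \<cdot>\<^bsub>A\<^esub> x2A))))"
    and \<rho>_counit_right: "tsum (\<rho> x) (\<lambda>xH xA. \<epsilon>\<^bsub>A\<^esub> xA *\<^sub>C xH) = x"
    and \<rho>_\<rho>:
      "sweedler2 H x (\<lambda>x1 x2. tsum (\<psi> x1) (\<lambda>x1I x1II. tsum (\<rho> x2) (\<lambda>x2H x2A.
         tsum (\<rho> x2H) (\<lambda>x2HH x2HA. x2HH \<otimes>\<^sub>\<complex> (x1I \<cdot>\<^bsub>A\<^esub> x2HA) \<otimes>\<^sub>\<complex> (x1II \<cdot>\<^bsub>A\<^esub> x2A)))))
       = sweedler2 H x (\<lambda>x1 x2. tsum (\<rho> x1) (\<lambda>x1H x1A. sweedler2 A x1A (\<lambda>x1A1 x1A2.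
         tsum (\<psi> x2) (\<lambda>x2I x2II. x1H \<otimes>\<^sub>\<complex> (x1A1 \<cdot>\<^bsub>A\<^esub> x2I) \<otimes>\<^sub>\<complex> (x1A2 \<cdot>\<^bsub>A\<^esub> x2II)))))"
    and \<psi>_cocycle:
      "sweedler2 H x (\<lambda>x1 x2. tsum (\<psi> x1) (\<lambda>x1I x1II. sweedler2 A x1I (\<lambda>x1I1 x1I2.
         tsum (\<rho> x2) (\<lambda>x2H x2A. tsum (\<psi> x2H) (\<lambda>x2HI x2HII.
           (x1I1 \<cdot>\<^bsub>A\<^esub> x2HI) \<otimes>\<^sub>\<complex> (x1I2 \<cdot>\<^bsub>A\<^esub> x2HII) \<otimes>\<^sub>\<complex> (x1II \<cdot>\<^bsub>A\<^esub> x2A))))))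
       = sweedler2 H x (\<lambda>x1 x2. tsum (\<psi> x1) (\<lambda>x1I x1II. sweedler2 A x1II (\<lambda>x1II1 x1II2.
         tsum (\<psi> x2) (\<lambda>x2I x2II. x1I \<otimes>\<^sub>\<complex> (x1II1 \<cdot>\<^bsub>A\<^esub> x2I) \<otimes>\<^sub>\<complex> (x1II2 \<cdot>\<^bsub>A\<^esub> x2II)))))"
    and \<psi>_counit_left: "tsum (\<psi> x) (\<lambda>xI xII. \<epsilon>\<^bsub>A\<^esub> xI *\<^sub>C xII) = \<epsilon>\<^bsub>H\<^esub> x *\<^sub>C \<^bold>1\<^bsub>A\<^esub>"
    and \<psi>_counit_right: "tsum (\<psi> x) (\<lambda>xI xII. \<epsilon>\<^bsub>A\<^esub> xII *\<^sub>C xI) = \<epsilon>\<^bsub>H\<^esub> x *\<^sub>C \<^bold>1\<^bsub>A\<^esub>"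
    and eps_act: "\<epsilon>\<^bsub>A\<^esub> (act x a) = \<epsilon>\<^bsub>H\<^esub> x * \<epsilon>\<^bsub>A\<^esub> a"
    and \<rho>_unit: "\<rho> \<^bold>1\<^bsub>H\<^esub> = \<^bold>1\<^bsub>H\<^esub> \<otimes>\<^sub>\<complex> \<^bold>1\<^bsub>A\<^esub>"
    and eps_\<chi>: "\<epsilon>\<^bsub>A\<^esub> (\<chi> x y) = \<epsilon>\<^bsub>H\<^esub> x * \<epsilon>\<^bsub>H\<^esub> y"
    and \<psi>_unit: "\<psi> \<^bold>1\<^bsub>H\<^esub> = \<^bold>1\<^bsub>A\<^esub> \<otimes>\<^sub>\<complex> \<^bold>1\<^bsub>A\<^esub>"
    and act_\<psi>:
      "sweedler2 H x (\<lambda>x1 x2. sweedler2 A (act x1 a) (\<lambda>b1 b2. tsum (\<psi> x2) (\<lambda>x2I x2II.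
         (b1 \<cdot>\<^bsub>A\<^esub> x2I) \<otimes>\<^sub>\<complex> (b2 \<cdot>\<^bsub>A\<^esub> x2II))))
       = sweedler3 H x (\<lambda>x1 x2 x3. sweedler2 A a (\<lambda>a1 a2. tsum (\<psi> x1) (\<lambda>x1I x1II.
         tsum (\<rho> x2) (\<lambda>x2H x2A.
           (x1I \<cdot>\<^bsub>A\<^esub> act x2H a1) \<otimes>\<^sub>\<complex> (x1II \<cdot>\<^bsub>A\<^esub> x2A \<cdot>\<^bsub>A\<^esub> act x3 a2)))))"
    and \<rho>_\<chi>:
      "sweedler2 H x (\<lambda>x1 x2. sweedler2 H y (\<lambda>y1 y2. tsum (\<rho> (x2 \<cdot>\<^bsub>H\<^esub> y2)) (\<lambda>zH zA.
         zH \<otimes>\<^sub>\<complex> (\<chi> x1 y1 \<cdot>\<^bsub>A\<^esub> zA))))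
       = sweedler3 H x (\<lambda>x1 x2 x3. sweedler2 H y (\<lambda>y1 y2. tsum (\<rho> x1) (\<lambda>x1H x1A.
         tsum (\<rho> y1) (\<lambda>y1H y1A.
           (x1H \<cdot>\<^bsub>H\<^esub> y1H) \<otimes>\<^sub>\<complex> (x1A \<cdot>\<^bsub>A\<^esub> act x2 y1A \<cdot>\<^bsub>A\<^esub> \<chi> x3 y2)))))"
    and act_\<rho>:
      "sweedler2 H x (\<lambda>x1 x2. tsum (\<rho> x2) (\<lambda>x2H x2A. x2H \<otimes>\<^sub>\<complex> (act x1 a \<cdot>\<^bsub>A\<^esub> x2A)))
       = sweedler2 H x (\<lambda>x1 x2. tsum (\<rho> x1) (\<lambda>x1H x1A. x1H \<otimes>\<^sub>\<complex> (x1A \<cdot>\<^bsub>A\<^esub> act x2 a)))"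
    and \<chi>_\<psi>:
      "sweedler2 H x (\<lambda>x1 x2. sweedler2 H y (\<lambda>y1 y2.
         sweedler2 A (\<chi> x1 y1) (\<lambda>c1 c2. tsum (\<psi> (x2 \<cdot>\<^bsub>H\<^esub> y2)) (\<lambda>zI zII.
           (c1 \<cdot>\<^bsub>A\<^esub> zI) \<otimes>\<^sub>\<complex> (c2 \<cdot>\<^bsub>A\<^esub> zII)))))
       = sweedler6 H x (\<lambda>x1 x2 x3 x4 x5 x6. sweedler3 H y (\<lambda>y1 y2 y3.
         tsum (\<psi> x1) (\<lambda>x1I x1II. tsum (\<rho> x2) (\<lambda>x2H x2A. tsum (\<rho> x4) (\<lambda>x4H x4A.
         tsum (\<psi> y1) (\<lambda>y1I y1II. tsum (\<rho> y2) (\<lambda>y2H y2A.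
           (x1I \<cdot>\<^bsub>A\<^esub> act x2H y1I \<cdot>\<^bsub>A\<^esub> \<chi> x4H y2H) \<otimes>\<^sub>\<complex>
           (x1II \<cdot>\<^bsub>A\<^esub> x2A \<cdot>\<^bsub>A\<^esub> act x3 y1II \<cdot>\<^bsub>A\<^esub> x4A \<cdot>\<^bsub>A\<^esub> act x5 y2A \<cdot>\<^bsub>A\<^esub> \<chi> x6 y3))))))))"

text \<open>The element \<open>a # x\<close> of the cocycle bismash product is the tensor \<open>a \<otimes> x\<close>.\<close>

definition cocycle_bismash ::
  "'a::complex_vector bialg \<Rightarrow> 'h::complex_vector bialg \<Rightarrow> ('h \<Rightarrow> 'a \<Rightarrow> 'a) \<Rightarrow> ('h \<Rightarrow> 'h \<otimes>\<^sub>\<complex> 'a) \<Rightarrow>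
    ('h \<Rightarrow> 'h \<Rightarrow> 'a) \<Rightarrow> ('h \<Rightarrow> 'a \<otimes>\<^sub>\<complex> 'a) \<Rightarrow> ('a \<otimes>\<^sub>\<complex> 'h) bialg"
  where "cocycle_bismash A H act \<rho> \<chi> \<psi> =
    \<lparr>mu = (\<lambda>s t. tsum s (\<lambda>a x. tsum t (\<lambda>b y. sweedler3 H x (\<lambda>x1 x2 x3. sweedler2 H y (\<lambda>y1 y2.
       (a \<cdot>\<^bsub>A\<^esub> act x1 b \<cdot>\<^bsub>A\<^esub> \<chi> x2 y1) \<otimes>\<^sub>\<complex> (x3 \<cdot>\<^bsub>H\<^esub> y2)))))),
     unt = \<^bold>1\<^bsub>A\<^esub> \<otimes>\<^sub>\<complex> \<^bold>1\<^bsub>H\<^esub>,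
     Delta = (\<lambda>s. tsum s (\<lambda>a x. sweedler2 A a (\<lambda>a1 a2. sweedler3 H x (\<lambda>x1 x2 x3.
       tsum (\<psi> x1) (\<lambda>x1I x1II. tsum (\<rho> x2) (\<lambda>x2H x2A.
         ((a1 \<cdot>\<^bsub>A\<^esub> x1I) \<otimes>\<^sub>\<complex> x2H) \<otimes>\<^sub>\<complex> ((a2 \<cdot>\<^bsub>A\<^esub> x1II \<cdot>\<^bsub>A\<^esub> x2A) \<otimes>\<^sub>\<complex> x3))))))),
     eps = (\<lambda>s. tsum s (\<lambda>a x. \<epsilon>\<^bsub>A\<^esub> a * \<epsilon>\<^bsub>H\<^esub> x))\<rparr>"

definition bismash_star ::
  "'a::complex_vector bialg \<Rightarrow> 'h::complex_vector bialg \<Rightarrow> ('h \<Rightarrow> 'a \<Rightarrow> 'a) \<Rightarrow>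
    ('a \<Rightarrow> 'a) \<Rightarrow> ('h \<Rightarrow> 'h) \<Rightarrow> ('h \<Rightarrow> 'a) \<Rightarrow> 'a \<otimes>\<^sub>\<complex> 'h \<Rightarrow> 'a \<otimes>\<^sub>\<complex> 'h"
  where "bismash_star A H act starA starH \<gamma> t = tsum t (\<lambda>a x. sweedler3 H x (\<lambda>x1 x2 x3.
    (\<gamma> (starH x1) \<cdot>\<^bsub>A\<^esub> act (starH x2) (starA a)) \<otimes>\<^sub>\<complex> starH x3))"

end

theory Submission
  imports Defs
begin

text \<open>Write \<open>M\<close> for the cocycle bismash product, \<open>i a = a # 1\<close> and \<open>j x = 1 # x\<close>, so that \<open>a # x = i a \<cdot> j x\<close>.
  A map out of \<open>M\<close> that is given on the \<open>i a\<close> and \<open>j x\<close> is multiplicative as soon as it respects the products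
  \<open>i a \<cdot> i b\<close>, \<open>j x \<cdot> i a\<close> and \<open>j x \<cdot> j y\<close>. For the coproduct these three conditions become identities in
  convolution algebras with values in \<open>M \<otimes> M\<close>, since \<open>\<Delta> \<circ> j\<close> is the convolution product of
  \<open>(i \<otimes> i) \<circ> \<psi>\<close>, \<open>(j \<otimes> i) \<circ> \<rho>\<close> and \<open>1 \<otimes> j\<close>; each factor is moved past the others by one of the axioms
  of a cocycle linked pair.

  The antipode exists because the identity of \<open>M\<close> is the convolution product of \<open>i \<circ> p\<close> and \<open>j \<circ> \<pi>\<close>, where
  \<open>p (a # x) = \<epsilon>(x) a\<close> and \<open>\<pi> (a # x) = \<epsilon>(a) x\<close>. A left inverse \<open>l\<close> of \<open>j\<close> is built from \<open>\<chi>\<^sup>-\<^sup>1\<close>; the map \<open>j * l\<close>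
  takes values in \<open>i A\<close> and satisfies \<open>(j * l) * j = j\<close>, and comparing coefficients gives \<open>j * l = \<epsilon>\<close>. Dually, a
  right inverse of \<open>p\<close> is built from \<open>\<psi>\<^sup>-\<^sup>1\<close> and turns out to be two-sided.

  For the involution, substitute \<open>x = y\<^sup>*\<close> throughout; all maps become linear and \<open>(1 # y\<^sup>*)\<^sup>* = \<Sum> \<gamma>(y\<^sub>1) # y\<^sub>2\<close>.
  Then (i), (ii), (iii) are the coefficients in \<open>A\<close> of the identities \<open>(j y)\<^sup>*\<^sup>* = j y\<close>,
  \<open>(j x \<cdot> i a)\<^sup>* = (i a)\<^sup>* \<cdot> (j x)\<^sup>*\<close> and \<open>(j x \<cdot> j y)\<^sup>* = (j y)\<^sup>* \<cdot> (j x)\<^sup>*\<close>. Condition (iv) results from applying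
  \<open>\<pi> \<otimes> p\<close> to the identity \<open>\<Delta> ((j y)\<^sup>*) = \<Sum> (j y)\<^sub>1\<^sup>* \<otimes> (j y)\<^sub>2\<^sup>*\<close>; once it holds, the right side of that identity can be
  rearranged so that its coefficient in \<open>A \<otimes> A\<close> is the right side of (v).

  Finally, the kernel of \<open>\<pi>\<close> is \<open>A\<^sup>+ M\<close>, and it is stable under the involution, so it equals \<open>M A\<^sup>+\<close>.\<close>

section \<open>Semilinear maps and tensors\<close>

text \<open>Only \<open>\<sigma> = id\<close> and \<open>\<sigma> = cnj\<close> are of interest.\<close>

definition semilin :: "(complex \<Rightarrow> complex) \<Rightarrow> ('a::complex_vector \<Rightarrow> 'b::complex_vector) \<Rightarrow> bool"
  where "semilin \<sigma> f \<longleftrightarrow> (\<forall>x y. f (x + y) = f x + f y) \<and> (\<forall>c x. f (c *\<^sub>C x) = \<sigma> c *\<^sub>C f x)"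

lemma clinear_iff_semilin: "clinear f \<longleftrightarrow> semilin id f"
  by (auto simp: semilin_def Vector_Spaces.linear_iff complex_vector.vector_space_axioms)

lemma antilinear_iff_semilin: "antilinear f \<longleftrightarrow> semilin cnj f"
  by (auto simp: semilin_def antilinear_def)

lemma cbilinear_iff_semilin:
  "cbilinear f \<longleftrightarrow> (\<forall>a. semilin id (f a)) \<and> (\<forall>b. semilin id (\<lambda>a. f a b))"
  by (simp add: cbilinear_def clinear_iff_semilin)

lemma semilinI:
  "(\<And>x y. f (x + y) = f x + f y) \<Longrightarrow> (\<And>c x. f (c *\<^sub>C x) = \<sigma> c *\<^sub>C f x) \<Longrightarrow> semilin \<sigma> f"
  by (simp add: semilin_def)

lemma semilin_add: "semilin \<sigma> f \<Longrightarrow> f (x + y) = f x + f y"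
  and semilin_scale: "semilin \<sigma> f \<Longrightarrow> f (c *\<^sub>C x) = \<sigma> c *\<^sub>C f x"
  by (simp_all add: semilin_def)

lemma semilin_zero: "semilin \<sigma> f \<Longrightarrow> f 0 = 0"
  using semilin_add[of \<sigma> f 0 0] by simp

lemma semilin_minus: "semilin \<sigma> f \<Longrightarrow> f (x - y) = f x - f y"
  using semilin_add[of \<sigma> f "x - y" y] by (simp add: algebra_simps)

lemma semilin_lin_compose: "semilin id g \<Longrightarrow> semilin \<sigma> f \<Longrightarrow> semilin \<sigma> (\<lambda>x. g (f x))"
  and semilin_anti_compose: "semilin cnj g \<Longrightarrow> semilin id f \<Longrightarrow> semilin cnj (\<lambda>x. g (f x))"
  and semilin_anti_anti: "semilin cnj g \<Longrightarrow> semilin cnj f \<Longrightarrow> semilin id (\<lambda>x. g (f x))"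
  by (simp_all add: semilin_def)

lemma semilin_ident [simp]: "semilin id (\<lambda>x. x)"
  by (simp add: semilin_def)

lemma semilin_scaleC [simp]: "semilin \<sigma> f \<Longrightarrow> semilin \<sigma> (\<lambda>x. c *\<^sub>C f x)"
  by (simp add: semilin_def scaleC_add_right scaleC_scaleC mult.commute)

lemma semilin_scaleC_left [simp]: "semilin \<sigma> f \<Longrightarrow> semilin \<sigma> (\<lambda>x. f x *\<^sub>C c)"
  by (simp add: semilin_def scaleC_add_left scaleC_scaleC scaleC_complex_def)

lemma semilin_diff [simp]: "semilin \<sigma> f \<Longrightarrow> semilin \<sigma> g \<Longrightarrow> semilin \<sigma> (\<lambda>x. f x - g x)"
  by (simp add: semilin_def complex_vector.scale_right_diff_distrib)

lemma semilin_mult_left [simp]: "semilin \<sigma> f \<Longrightarrow> semilin \<sigma> (\<lambda>x. f x * (c :: complex))"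
  and semilin_mult_right [simp]: "semilin \<sigma> f \<Longrightarrow> semilin \<sigma> (\<lambda>x. (c :: complex) * f x)"
  by (simp_all add: semilin_def scaleC_complex_def algebra_simps)

text \<open>Either argument contributes the same factor \<open>\<sigma> c\<close>, so maps that are
  conjugate linear in both arguments may be summed over a tensor just as bilinear ones.\<close>

lemma balanced_semilin:
  "(\<And>b. semilin \<sigma> (\<lambda>a. f a b)) \<Longrightarrow> (\<And>a. semilin \<sigma> (f a)) \<Longrightarrow> balanced f"
  by (simp add: balanced_def semilin_def)

section \<open>Bilinearity of pure tensors and induction over their sums\<close>

lemma scaleC_pure: "c *\<^sub>C (a \<otimes>\<^sub>\<complex> b) = (c *\<^sub>C a) \<otimes>\<^sub>\<complex> b"
  by transfer (simp add: tensor_eq_refl)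

lemma scaleC_pure_right: "a \<otimes>\<^sub>\<complex> (c *\<^sub>C b) = c *\<^sub>C (a \<otimes>\<^sub>\<complex> b)"
  by transfer (simp, rule tensor_eq_sym[OF tensor_eq_balanced])

lemma pure_add: "(a + a') \<otimes>\<^sub>\<complex> b = (a \<otimes>\<^sub>\<complex> b) + (a' \<otimes>\<^sub>\<complex> b)"
  by transfer (simp, metis tensor_eq_add_left add_mset_commute)

lemma pure_add_right: "a \<otimes>\<^sub>\<complex> (b + b') = (a \<otimes>\<^sub>\<complex> b) + (a \<otimes>\<^sub>\<complex> b')"
  by transfer (simp, metis tensor_eq_add_right add_mset_commute)

lemma semilin_pure [simp]:
  "semilin \<sigma> f \<Longrightarrow> semilin \<sigma> (\<lambda>x. f x \<otimes>\<^sub>\<complex> b)" "semilin \<sigma> f \<Longrightarrow> semilin \<sigma> (\<lambda>x. b \<otimes>\<^sub>\<complex> f x)"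
  by (simp_all add: semilin_def pure_add pure_add_right scaleC_pure scaleC_pure_right)

lemma semilin_pure_eta [simp]: "semilin id (pure_tensor a)"
  using semilin_pure(2)[OF semilin_ident] by simp

lemma tensor_induct [case_names pure add]:
  assumes "\<And>a b. P (a \<otimes>\<^sub>\<complex> b)" "\<And>s t. P s \<Longrightarrow> P t \<Longrightarrow> P (s + t)"
  shows "P t"
proof -
  obtain M where t: "t = abs_tensor M"
    by (metis Quotient_abs_rep Quotient_tensor)
  have "P (abs_tensor M)"
  proof (induction M)
    case empty
    \<comment> \<open>The empty multiset is covered by the pure case, because zero is itself a pure
      tensor.\<close>
    have "(0 :: 'a \<otimes>\<^sub>\<complex> 'b) = 0 \<otimes>\<^sub>\<complex> 0"
      using semilin_zero[of id "\<lambda>x. x \<otimes>\<^sub>\<complex> (0::'b)"] by simp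
    then show ?case
      using assms(1)[of 0 0] by (simp add: zero_tensor.abs_eq)
  next
    case (add p M)
    have "abs_tensor (add_mset p M) = (fst p \<otimes>\<^sub>\<complex> snd p) + abs_tensor M"
      by (simp add: pure_tensor.abs_eq plus_tensor.abs_eq)
    then show ?case
      using assms add by metis
  qed
  then show ?thesis by (simp add: t)
qed

section \<open>Evaluation of semilinear maps on tensors\<close>

lemma tsum_pure_semilin:
  "(\<And>b. semilin \<sigma> (\<lambda>a. f a b)) \<Longrightarrow> (\<And>a. semilin \<sigma> (f a)) \<Longrightarrow> tsum (a \<otimes>\<^sub>\<complex> b) f = f a b"
  by (rule tsum_pure[OF balanced_semilin])

lemmas tsum_pure_lin [simp] = tsum_pure_semilin[of id]

text \<open>The chosen representative of \<open>t\<close> does not vary with \<open>x\<close>, so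
  linearity holds summand by summand.\<close>

lemma semilin_tsum [simp]:
  assumes "\<And>a b. semilin \<sigma> (\<lambda>x. f x a b)"
  shows "semilin \<sigma> (\<lambda>x. tsum t (\<lambda>a b. f x a b))"
proof -
  have 1: "(\<Sum>(a, b)\<in>#M. f (x + y) a b) = (\<Sum>(a, b)\<in>#M. f x a b) + (\<Sum>(a, b)\<in>#M. f y a b)"
    for x y M
    by (induction M) (auto simp: semilin_add[OF assms])
  have 2: "(\<Sum>(a, b)\<in>#M. f (c *\<^sub>C x) a b) = \<sigma> c *\<^sub>C (\<Sum>(a, b)\<in>#M. f x a b)" for c x M
    by (induction M) (auto simp: semilin_scale[OF assms] scaleC_add_right)
  show ?thesis
    by (rule semilinI) (simp_all add: tsum_def 1 2)
qed

lemma semilin_image_tsum: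
  assumes "semilin \<sigma> h"
  shows "h (tsum t f) = tsum t (\<lambda>a b. h (f a b))"
proof -
  have "h (\<Sum>(a, b)\<in>#M. f a b) = (\<Sum>(a, b)\<in>#M. h (f a b))" for M
    by (induction M) (auto simp: semilin_zero[OF assms] semilin_add[OF assms])
  then show ?thesis by (simp add: tsum_def)
qed

text \<open>Both representatives are fixed finite multisets, so this is the interchange of two
  finite sums. In simplification it is instantiated with specific tensors, which prescribes the sum
  that goes outside.\<close>

lemma tsum_commute:
  "tsum s (\<lambda>a b. tsum t (\<lambda>c d. f a b c d)) = tsum t (\<lambda>c d. tsum s (\<lambda>a b. f a b c d))"
proof -
  have "(\<Sum>p\<in>#M. \<Sum>q\<in>#N. g p q) = (\<Sum>q\<in>#N. \<Sum>p\<in>#M. g p q)"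
    for M N and g :: "'b \<times> 'c \<Rightarrow> 'd \<times> 'e \<Rightarrow> 'a"
    by (induction M) (simp_all add: sum_mset.distrib)
  from this[where g = "\<lambda>p q. f (fst p) (snd p) (fst q) (snd q)"] show ?thesis
    by (simp add: tsum_def split_def)
qed

lemma tsum_scale:
  assumes "\<And>b. semilin \<sigma> (\<lambda>a. f a b)" "\<And>a. semilin \<sigma> (f a)"
  shows "tsum (c *\<^sub>C t) f = \<sigma> c *\<^sub>C tsum t f"
  by (induction t rule: tensor_induct)
     (simp_all add: tsum_add[OF balanced_semilin[OF assms]] scaleC_add_right scaleC_pure
       tsum_pure_semilin[OF assms] semilin_scale[OF assms(1)])

text \<open>Scalars pass first through \<open>g\<close> and then through \<open>f\<close>; the three
  rules that follow compute the composite of \<open>\<sigma>\<close> and \<open>\<tau>\<close> in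
  the cases that occur.\<close>

lemma semilin_tsum_left:
  assumes "semilin \<tau> g" "\<And>b. semilin \<sigma> (\<lambda>a. f a b)" "\<And>a. semilin \<sigma> (f a)"
  shows "semilin (\<lambda>c. \<sigma> (\<tau> c)) (\<lambda>x. tsum (g x) f)"
  by (rule semilinI)
     (simp_all add: semilin_add[OF assms(1)] semilin_scale[OF assms(1)]
       tsum_add[OF balanced_semilin[OF assms(2,3)]] tsum_scale[OF assms(2,3)])

lemma semilin_tsum_lin [simp]:
  assumes "semilin \<sigma> g" "\<And>b. semilin id (\<lambda>a. f a b)" "\<And>a. semilin id (f a)"
  shows "semilin \<sigma> (\<lambda>x. tsum (g x) (\<lambda>a b. f a b))"
  using semilin_tsum_left[OF assms] by simp

lemma semilin_tsum_anti [simp]: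
  assumes "semilin id g" "\<And>b. semilin cnj (\<lambda>a. f a b)" "\<And>a. semilin cnj (f a)"
  shows "semilin cnj (\<lambda>x. tsum (g x) (\<lambda>a b. f a b))"
  using semilin_tsum_left[OF assms] by simp

lemma semilin_tsum_anti_anti [simp]:
  assumes "semilin cnj g" "\<And>b. semilin cnj (\<lambda>a. f a b)" "\<And>a. semilin cnj (f a)"
  shows "semilin id (\<lambda>x. tsum (g x) (\<lambda>a b. f a b))"
  using semilin_tsum_left[OF assms] by (simp add: semilin_def)

text \<open>Evaluation under a fixed \<open>f\<close> is semilinear in the tensor and hence commutes
  with the inner sum. This flattens nested Sweedler sums.\<close>

lemma tsum_tsum:
  assumes "\<And>b. semilin \<sigma> (\<lambda>a. f a b)" "\<And>a. semilin \<sigma> (f a)"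
  shows "tsum (tsum t g) f = tsum t (\<lambda>a b. tsum (g a b) f)"
  using semilin_tsum_left[OF semilin_ident assms] by (rule semilin_image_tsum)

lemmas tsum_tsum_lin = tsum_tsum[of id]

lemma tsum_eta: "tsum t (\<lambda>a b. a \<otimes>\<^sub>\<complex> b) = t"
  by (induction t rule: tensor_induct) (simp_all add: tsum_add[OF balanced_semilin[of id]])

lemma pure_tsum:
  "tsum t f \<otimes>\<^sub>\<complex> b = tsum t (\<lambda>a c. f a c \<otimes>\<^sub>\<complex> b)" "b \<otimes>\<^sub>\<complex> tsum t f = tsum t (\<lambda>a c. b \<otimes>\<^sub>\<complex> f a c)"
  by (rule semilin_image_tsum[of id "\<lambda>x. x \<otimes>\<^sub>\<complex> b"], simp)
     (rule semilin_image_tsum[of id "\<lambda>x. b \<otimes>\<^sub>\<complex> x"], simp)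

lemma scaleC_tsum: "c *\<^sub>C tsum t f = tsum t (\<lambda>a b. c *\<^sub>C f a b)"
  by (rule semilin_image_tsum[of id "\<lambda>x. c *\<^sub>C x"]) simp

lemma tsum_scaleC: "tsum t f *\<^sub>C z = tsum t (\<lambda>a b. f a b *\<^sub>C z)"
  by (rule semilin_image_tsum[of id "\<lambda>x. x *\<^sub>C z"]) simp

lemma tensor_ext:
  assumes "semilin \<sigma> f" "semilin \<sigma> g" "\<And>a b. f (a \<otimes>\<^sub>\<complex> b) = g (a \<otimes>\<^sub>\<complex> b)"
  shows "f t = g t"
  by (induction t rule: tensor_induct) (simp_all add: assms(3) semilin_add[OF assms(1)] semilin_add[OF assms(2)])

lemmas sweedler_defs = sweedler2_def sweedler3_def sweedler4_def sweedler5_def sweedler6_def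


section \<open>Algebras, coalgebras and convolution\<close>

text \<open>Separated from \<open>bialgebra\<close> because the product \<open>M\<close> and its
  tensor square must be known as associative algebras before the coproduct of \<open>M\<close> can
  be shown to be multiplicative.\<close>

locale calgebra =
  fixes B :: "'a::complex_vector bialg" (structure)
  assumes mu_lin: "semilin id (\<lambda>b. b \<cdot> a)" "semilin id (\<lambda>b. a \<cdot> b)"
    and mult_assoc: "(a \<cdot> b) \<cdot> c = a \<cdot> (b \<cdot> c)"
    and one_mult [simp]: "\<^bold>1 \<cdot> a = a"
    and mult_one [simp]: "a \<cdot> \<^bold>1 = a"
begin

lemma semilin_mu [simp]:
  "semilin \<sigma> f \<Longrightarrow> semilin \<sigma> (\<lambda>x. f x \<cdot> a)" "semilin \<sigma> f \<Longrightarrow> semilin \<sigma> (\<lambda>x. a \<cdot> f x)"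
  by (rule semilin_lin_compose[OF mu_lin(1)], assumption) (rule semilin_lin_compose[OF mu_lin(2)])

lemma mu_tsum: "tsum t f \<cdot> a = tsum t (\<lambda>b c. f b c \<cdot> a)" "a \<cdot> tsum t f = tsum t (\<lambda>b c. a \<cdot> f b c)"
  by (rule semilin_image_tsum[OF mu_lin(1)]) (rule semilin_image_tsum[OF mu_lin(2)])

lemma mu_scaleC [simp]: "(c *\<^sub>C a) \<cdot> b = c *\<^sub>C (a \<cdot> b)" "a \<cdot> (c *\<^sub>C b) = c *\<^sub>C (a \<cdot> b)"
  by (simp_all add: semilin_scale[OF mu_lin(1)] semilin_scale[OF mu_lin(2)])

end

locale ccoalgebra =
  fixes C :: "'a::complex_vector bialg" (structure)
  assumes Delta_lin: "semilin id \<Delta>"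
    and eps_lin: "semilin id \<epsilon>"
    and coassoc': "tsum (\<Delta> a) (\<lambda>a1 a2. tsum (\<Delta> a1) (\<lambda>u v. u \<otimes>\<^sub>\<complex> v \<otimes>\<^sub>\<complex> a2))
      = tsum (\<Delta> a) (\<lambda>a1 a2. tsum (\<Delta> a2) (\<lambda>u v. a1 \<otimes>\<^sub>\<complex> u \<otimes>\<^sub>\<complex> v))"
    and counit_left': "tsum (\<Delta> a) (\<lambda>a1 a2. \<epsilon> a1 *\<^sub>C a2) = a"
    and counit_right': "tsum (\<Delta> a) (\<lambda>a1 a2. \<epsilon> a2 *\<^sub>C a1) = a"
begin

lemma semilin_Delta [simp]: "semilin \<sigma> f \<Longrightarrow> semilin \<sigma> (\<lambda>x. \<Delta> (f x))"
  by (rule semilin_lin_compose[OF Delta_lin])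

lemma semilin_eps [simp]: "semilin \<sigma> f \<Longrightarrow> semilin \<sigma> (\<lambda>x. \<epsilon> (f x))"
  by (rule semilin_lin_compose[OF eps_lin])

lemma eps_tsum: "\<epsilon> (tsum t f) = tsum t (\<lambda>a b. \<epsilon> (f a b))"
  by (rule semilin_image_tsum[OF eps_lin])

text \<open>Applying to both sides of coassociativity the map on the triple tensor product induced
  by \<open>f\<close> turns an equation of tensors into a rewrite rule for Sweedler sums.\<close>

lemma coassoc_gen:
  assumes "\<And>b c. semilin \<sigma> (\<lambda>a. f a b c)" "\<And>a c. semilin \<sigma> (\<lambda>b. f a b c)" "\<And>a b. semilin \<sigma> (\<lambda>c. f a b c)"
  shows "tsum (\<Delta> a) (\<lambda>a1 a2. tsum (\<Delta> a1) (\<lambda>u v. f u v a2))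
    = tsum (\<Delta> a) (\<lambda>a1 a2. tsum (\<Delta> a2) (\<lambda>u v. f a1 u v))"
proof -
  have 1: "semilin \<sigma> (\<lambda>r. tsum r (f a))" for a
    using semilin_tsum_left[OF semilin_ident assms(2,3)] by simp
  have 2: "semilin \<sigma> (\<lambda>a. tsum r (f a))" for r
    using assms(1) by (rule semilin_tsum)
  have "tsum (tsum (\<Delta> a) (\<lambda>a1 a2. tsum (\<Delta> a1) (\<lambda>u v. u \<otimes>\<^sub>\<complex> v \<otimes>\<^sub>\<complex> a2))) (\<lambda>a r. tsum r (f a))
     = tsum (tsum (\<Delta> a) (\<lambda>a1 a2. tsum (\<Delta> a2) (\<lambda>u v. a1 \<otimes>\<^sub>\<complex> u \<otimes>\<^sub>\<complex> v))) (\<lambda>a r. tsum r (f a))"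
    by (simp add: coassoc')
  then show ?thesis
    by (simp add: tsum_tsum[OF 2 1] tsum_pure_semilin[OF 2 1] tsum_pure_semilin[OF assms(2,3)])
qed

lemma counit_left_gen:
  assumes "semilin \<sigma> f"
  shows "tsum (\<Delta> a) (\<lambda>a1 a2. \<sigma> (\<epsilon> a1) *\<^sub>C f a2) = f a"
  using arg_cong[OF counit_left', of f a]
  by (simp add: semilin_image_tsum[OF assms] semilin_scale[OF assms])

lemma counit_right_gen:
  assumes "semilin \<sigma> f"
  shows "tsum (\<Delta> a) (\<lambda>a1 a2. \<sigma> (\<epsilon> a2) *\<^sub>C f a1) = f a"
  using arg_cong[OF counit_right', of f a]
  by (simp add: semilin_image_tsum[OF assms] semilin_scale[OF assms])

lemmas coassoc_lin = coassoc_gen[of id]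
lemmas counit_lin = counit_left_gen[of id, simplified] counit_right_gen[of id, simplified]

lemma counit_mult:
  "semilin id f \<Longrightarrow> tsum (\<Delta> a) (\<lambda>a1 a2. \<epsilon> a1 * f a2) = (f a :: complex)"
  using counit_lin(1)[of f a] by (simp add: scaleC_complex_def)

text \<open>Commuting sums may separate a double coproduct from the sum it belongs to. Together with
  \<open>coassoc_lin\<close> the next two rules restore the right-nested normal form.\<close>

lemma coassoc2:
  assumes "\<And>b c d. semilin id (\<lambda>a. f a b c d)" "\<And>a c d. semilin id (\<lambda>b. f a b c d)"
    "\<And>a b d. semilin id (\<lambda>c. f a b c d)" "\<And>a b c. semilin id (\<lambda>d. f a b c d)"
  shows "tsum (\<Delta> x) (\<lambda>x1 r. tsum (\<Delta> r) (\<lambda>x2 x3. tsum (\<Delta> x1) (\<lambda>u v. f u v x2 x3)))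
    = tsum (\<Delta> x) (\<lambda>u r. tsum (\<Delta> r) (\<lambda>v r'. tsum (\<Delta> r') (\<lambda>x2 x3. f u v x2 x3)))"
proof -
  have "tsum (\<Delta> x) (\<lambda>x1 r. tsum (\<Delta> r) (\<lambda>x2 x3. tsum (\<Delta> x1) (\<lambda>u v. f u v x2 x3)))
    = tsum (\<Delta> x) (\<lambda>x1 r. tsum (\<Delta> x1) (\<lambda>u v. tsum (\<Delta> r) (\<lambda>x2 x3. f u v x2 x3)))"
    by (subst (2) tsum_commute) (rule refl)
  also have "\<dots> = tsum (\<Delta> x) (\<lambda>u r. tsum (\<Delta> r) (\<lambda>v r'. tsum (\<Delta> r') (\<lambda>x2 x3. f u v x2 x3)))"
    by (rule coassoc_lin) (simp_all add: assms)
  finally show ?thesis .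
qed

lemma coassoc3:
  assumes "\<And>b c d e. semilin id (\<lambda>a. f a b c d e)" "\<And>a c d e. semilin id (\<lambda>b. f a b c d e)"
    "\<And>a b d e. semilin id (\<lambda>c. f a b c d e)" "\<And>a b c e. semilin id (\<lambda>d. f a b c d e)"
    "\<And>a b c d. semilin id (\<lambda>e. f a b c d e)"
  shows "tsum (\<Delta> x) (\<lambda>x1 r. tsum (\<Delta> r) (\<lambda>x2 s. tsum (\<Delta> s) (\<lambda>x3 x4. tsum (\<Delta> x1) (\<lambda>u v. f u v x2 x3 x4))))
    = tsum (\<Delta> x) (\<lambda>u r. tsum (\<Delta> r) (\<lambda>v r'. tsum (\<Delta> r') (\<lambda>x2 s. tsum (\<Delta> s) (\<lambda>x3 x4. f u v x2 x3 x4))))"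
proof -
  have "tsum (\<Delta> x) (\<lambda>x1 r. tsum (\<Delta> r) (\<lambda>x2 s. tsum (\<Delta> s) (\<lambda>x3 x4. tsum (\<Delta> x1) (\<lambda>u v. f u v x2 x3 x4))))
    = tsum (\<Delta> x) (\<lambda>x1 r. tsum (\<Delta> r) (\<lambda>x2 s. tsum (\<Delta> x1) (\<lambda>u v. tsum (\<Delta> s) (\<lambda>x3 x4. f u v x2 x3 x4))))"
    by (subst (3) tsum_commute) (rule refl)
  also have "\<dots> = tsum (\<Delta> x) (\<lambda>u r. tsum (\<Delta> r) (\<lambda>v r'. tsum (\<Delta> r') (\<lambda>x2 s. tsum (\<Delta> s) (\<lambda>x3 x4. f u v x2 x3 x4))))"
    by (rule coassoc2) (simp_all add: assms)
  finally show ?thesis .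
qed

end

lemma (in bialgebra) calgebra: "calgebra B"
  using mu_bilinear mu_assoc mu_unit_left mu_unit_right
  by unfold_locales (simp_all add: cbilinear_iff_semilin)

sublocale bialgebra \<subseteq> calgebra
  by (rule calgebra)

lemma (in bialgebra) ccoalgebra: "ccoalgebra B"
  using Delta_linear eps_linear coassoc counit_left counit_right
  by unfold_locales (simp_all add: clinear_iff_semilin sweedler2_def)

sublocale bialgebra \<subseteq> ccoalgebra B
  by (rule ccoalgebra)

section \<open>Tensor products and opposites of algebras\<close>

lemma tensor_bialg_simps:
  "\<^bold>1\<^bsub>tensor_bialg B C\<^esub> = \<^bold>1\<^bsub>B\<^esub> \<otimes>\<^sub>\<complex> \<^bold>1\<^bsub>C\<^esub>"
  "mu (tensor_bialg B C) s t = tsum s (\<lambda>a b. tsum t (\<lambda>a' b'. (a \<cdot>\<^bsub>B\<^esub> a') \<otimes>\<^sub>\<complex> (b \<cdot>\<^bsub>C\<^esub> b')))"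
  "Delta (tensor_bialg B C) s = tsum s (\<lambda>a b. tsum (\<Delta>\<^bsub>B\<^esub> a) (\<lambda>a1 a2. tsum (\<Delta>\<^bsub>C\<^esub> b) (\<lambda>b1 b2.
       (a1 \<otimes>\<^sub>\<complex> b1) \<otimes>\<^sub>\<complex> (a2 \<otimes>\<^sub>\<complex> b2))))"
  "eps (tensor_bialg B C) s = tsum s (\<lambda>a b. \<epsilon>\<^bsub>B\<^esub> a * \<epsilon>\<^bsub>C\<^esub> b)"
  by (simp_all add: tensor_bialg_def sweedler2_def)

lemma calgebra_tensor:
  assumes "calgebra B" "calgebra C"
  shows "calgebra (tensor_bialg B C)"
proof -
  interpret B: calgebra B by fact
  interpret C: calgebra C by fact
  show ?thesis
  proof
    show "semilin id (\<lambda>t. t \<cdot>\<^bsub>tensor_bialg B C\<^esub> s)" "semilin id (\<lambda>t. s \<cdot>\<^bsub>tensor_bialg B C\<^esub> t)" for s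
      by (simp_all add: tensor_bialg_simps)
    show "\<^bold>1\<^bsub>tensor_bialg B C\<^esub> \<cdot>\<^bsub>tensor_bialg B C\<^esub> s = s" "s \<cdot>\<^bsub>tensor_bialg B C\<^esub> \<^bold>1\<^bsub>tensor_bialg B C\<^esub> = s" for s
      by (simp_all add: tensor_bialg_simps tsum_eta)
    show "(r \<cdot>\<^bsub>tensor_bialg B C\<^esub> s) \<cdot>\<^bsub>tensor_bialg B C\<^esub> t = r \<cdot>\<^bsub>tensor_bialg B C\<^esub> (s \<cdot>\<^bsub>tensor_bialg B C\<^esub> t)" for r s t
      by (simp add: tensor_bialg_simps tsum_tsum_lin B.mult_assoc C.mult_assoc)
  qed
qed

lemma mu_tensor_pure:
  assumes "calgebra B" "calgebra C"
  shows "(a \<otimes>\<^sub>\<complex> b) \<cdot>\<^bsub>tensor_bialg B C\<^esub> (a' \<otimes>\<^sub>\<complex> b') = (a \<cdot>\<^bsub>B\<^esub> a') \<otimes>\<^sub>\<complex> (b \<cdot>\<^bsub>C\<^esub> b')"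
proof -
  interpret B: calgebra B by fact
  interpret C: calgebra C by fact
  show ?thesis by (simp add: tensor_bialg_simps)
qed

text \<open>Multiplicativity on pure tensors extends to sums; with \<open>\<sigma> = cnj\<close>
  this also covers the involution of a tensor square.\<close>

lemma tensor_hom_mult:
  assumes "calgebra B" "calgebra C" "calgebra N"
    and \<phi>: "\<And>b. semilin \<sigma> (\<lambda>a. \<phi> a b)" "\<And>a. semilin \<sigma> (\<phi> a)"
    and mult: "\<And>a a' b b'. \<phi> (a \<cdot>\<^bsub>B\<^esub> a') (b \<cdot>\<^bsub>C\<^esub> b') = \<phi> a b \<cdot>\<^bsub>N\<^esub> \<phi> a' b'"
  shows "tsum (s \<cdot>\<^bsub>tensor_bialg B C\<^esub> t) \<phi> = tsum s \<phi> \<cdot>\<^bsub>N\<^esub> tsum t \<phi>"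
  by (simp add: tensor_bialg_simps tsum_tsum[OF \<phi>] tsum_pure_semilin[OF \<phi>] mult
      calgebra.mu_tsum(1)[OF assms(3)]) (simp add: calgebra.mu_tsum(2)[OF assms(3)])

text \<open>Antimultiplicative maps, such as the involution, are handled as multiplicative maps into
  the opposite algebra.\<close>

definition op_bialg :: "'a::complex_vector bialg \<Rightarrow> 'a bialg"
  where "op_bialg B = B\<lparr>mu := \<lambda>a b. b \<cdot>\<^bsub>B\<^esub> a\<rparr>"

lemma op_bialg_simps [simp]:
  "a \<cdot>\<^bsub>op_bialg B\<^esub> b = b \<cdot>\<^bsub>B\<^esub> a" "\<^bold>1\<^bsub>op_bialg B\<^esub> = \<^bold>1\<^bsub>B\<^esub>"
  by (simp_all add: op_bialg_def)

lemma calgebra_op: "calgebra B \<Longrightarrow> calgebra (op_bialg B)"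
  by (simp add: calgebra_def)

section \<open>Convolution products in one and two variables\<close>

definition conv :: "'c::complex_vector bialg \<Rightarrow> 'a::complex_vector bialg \<Rightarrow>
    ('c \<Rightarrow> 'a) \<Rightarrow> ('c \<Rightarrow> 'a) \<Rightarrow> 'c \<Rightarrow> 'a"
  where "conv C B f g x = tsum (\<Delta>\<^bsub>C\<^esub> x) (\<lambda>u v. f u \<cdot>\<^bsub>B\<^esub> g v)"

definition conv_unit :: "'c::complex_vector bialg \<Rightarrow> 'a::complex_vector bialg \<Rightarrow> 'c \<Rightarrow> 'a"
  where "conv_unit C B x = \<epsilon>\<^bsub>C\<^esub> x *\<^sub>C \<^bold>1\<^bsub>B\<^esub>"

text \<open>Convolution on the tensor product coalgebra of \<open>C\<close> and \<open>D\<close>,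
  written for bilinear maps in curried form.\<close>

definition conv2 :: "'c::complex_vector bialg \<Rightarrow> 'd::complex_vector bialg \<Rightarrow> 'a::complex_vector bialg \<Rightarrow>
    ('c \<Rightarrow> 'd \<Rightarrow> 'a) \<Rightarrow> ('c \<Rightarrow> 'd \<Rightarrow> 'a) \<Rightarrow> 'c \<Rightarrow> 'd \<Rightarrow> 'a"
  where "conv2 C D B F G x y = tsum (\<Delta>\<^bsub>C\<^esub> x) (\<lambda>x1 x2. tsum (\<Delta>\<^bsub>D\<^esub> y) (\<lambda>y1 y2. F x1 y1 \<cdot>\<^bsub>B\<^esub> G x2 y2))"

locale convolution = C: ccoalgebra C + B: calgebra B
  for C :: "'c::complex_vector bialg" and B :: "'a::complex_vector bialg"
begin

lemma conv_assoc:
  assumes "semilin \<sigma> f" "semilin \<sigma> g" "semilin \<sigma> h"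
  shows "conv C B (conv C B f g) h = conv C B f (conv C B g h)"
proof
  fix x
  note lin = assms[THEN semilin_lin_compose[rotated], rotated]
  have "tsum (\<Delta>\<^bsub>C\<^esub> x) (\<lambda>a1 a2. tsum (\<Delta>\<^bsub>C\<^esub> a1) (\<lambda>u v. f u \<cdot>\<^bsub>B\<^esub> g v \<cdot>\<^bsub>B\<^esub> h a2))
     = tsum (\<Delta>\<^bsub>C\<^esub> x) (\<lambda>a1 a2. tsum (\<Delta>\<^bsub>C\<^esub> a2) (\<lambda>u v. f a1 \<cdot>\<^bsub>B\<^esub> g u \<cdot>\<^bsub>B\<^esub> h v))"
    by (rule C.coassoc_gen[of \<sigma>]) (simp_all add: assms)
  then show "conv C B (conv C B f g) h x = conv C B f (conv C B g h) x"
    by (simp add: conv_def B.mu_tsum B.mult_assoc)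
qed

lemma semilin_conv [simp]:
  "semilin id f \<Longrightarrow> semilin id g \<Longrightarrow> semilin id (conv C B f g)"
  unfolding conv_def [abs_def] by simp

lemma conv_unit_left [simp]: "semilin id f \<Longrightarrow> conv C B (conv_unit C B) f = f"
  by (rule ext) (simp add: conv_def conv_unit_def C.counit_lin)

lemma conv_unit_right [simp]: "semilin id f \<Longrightarrow> conv C B f (conv_unit C B) = f"
  by (rule ext) (simp add: conv_def conv_unit_def C.counit_lin)

lemma conv_inverse_unique:
  assumes "semilin id f" "semilin id g" "semilin id h"
    and "conv C B g f = conv_unit C B" "conv C B f h = conv_unit C B"
  shows "g = h"
  by (metis assms conv_assoc conv_unit_left conv_unit_right)

end

text \<open>\<open>ext1\<close> and \<open>ext2\<close> pad a map of one variable with the counit in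
  the other. They are homomorphisms from the one-variable convolution algebras to the two-variable
  one (\<open>ext1_conv\<close>, \<open>ext2_conv\<close>).\<close>

definition ext1 :: "'d::complex_vector bialg \<Rightarrow> ('c \<Rightarrow> 'a::complex_vector) \<Rightarrow> 'c \<Rightarrow> 'd \<Rightarrow> 'a"
  where "ext1 D F x y = \<epsilon>\<^bsub>D\<^esub> y *\<^sub>C F x"

definition ext2 :: "'c::complex_vector bialg \<Rightarrow> ('d \<Rightarrow> 'a::complex_vector) \<Rightarrow> 'c \<Rightarrow> 'd \<Rightarrow> 'a"
  where "ext2 C F x y = \<epsilon>\<^bsub>C\<^esub> x *\<^sub>C F y"

locale convolution2 = C: ccoalgebra C + D: ccoalgebra D + B: calgebra B
  for C :: "'c::complex_vector bialg" and D :: "'d::complex_vector bialg" and B :: "'a::complex_vector bialg"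
begin

lemma conv2_assoc:
  assumes F: "\<And>y. semilin id (\<lambda>x. F x y)" "\<And>x. semilin id (F x)"
    and G: "\<And>y. semilin id (\<lambda>x. G x y)" "\<And>x. semilin id (G x)"
    and K: "\<And>y. semilin id (\<lambda>x. K x y)" "\<And>x. semilin id (K x)"
  shows "conv2 C D B (conv2 C D B F G) K = conv2 C D B F (conv2 C D B G K)"
proof (intro ext)
  fix x y
  have "conv2 C D B (conv2 C D B F G) K x y =
    tsum (\<Delta>\<^bsub>C\<^esub> x) (\<lambda>x1 x2. tsum (\<Delta>\<^bsub>C\<^esub> x1) (\<lambda>u v. tsum (\<Delta>\<^bsub>D\<^esub> y) (\<lambda>y1 y2. tsum (\<Delta>\<^bsub>D\<^esub> y1) (\<lambda>p q.
      F u p \<cdot>\<^bsub>B\<^esub> (G v q \<cdot>\<^bsub>B\<^esub> K x2 y2)))))"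
    by (simp add: conv2_def B.mu_tsum B.mult_assoc tsum_commute[of "\<Delta>\<^bsub>D\<^esub> y"])
  also have "\<dots> = tsum (\<Delta>\<^bsub>C\<^esub> x) (\<lambda>x1 x2. tsum (\<Delta>\<^bsub>C\<^esub> x2) (\<lambda>u v. tsum (\<Delta>\<^bsub>D\<^esub> y) (\<lambda>y1 y2. tsum (\<Delta>\<^bsub>D\<^esub> y2) (\<lambda>p q.
      F x1 y1 \<cdot>\<^bsub>B\<^esub> (G u p \<cdot>\<^bsub>B\<^esub> K v q)))))"
    by (simp add: C.coassoc_lin D.coassoc_lin F G K)
  also have "\<dots> = conv2 C D B F (conv2 C D B G K) x y"
    by (simp add: conv2_def B.mu_tsum B.mult_assoc tsum_commute[of "\<Delta>\<^bsub>D\<^esub> y"])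
  finally show "conv2 C D B (conv2 C D B F G) K x y = conv2 C D B F (conv2 C D B G K) x y" .
qed

lemma semilin_conv2 [simp]:
  assumes "\<And>y. semilin id (\<lambda>x. F x y)" "\<And>x. semilin id (F x)"
    and "\<And>y. semilin id (\<lambda>x. G x y)" "\<And>x. semilin id (G x)"
  shows "semilin id (\<lambda>x. conv2 C D B F G x y)" "semilin id (conv2 C D B F G x)"
  unfolding conv2_def [abs_def] using assms by simp_all

lemma conv2_unit [simp]:
  assumes "\<And>y. semilin id (\<lambda>x. F x y)" "\<And>x. semilin id (F x)"
  shows "conv2 C D B (\<lambda>x y. (\<epsilon>\<^bsub>C\<^esub> x * \<epsilon>\<^bsub>D\<^esub> y) *\<^sub>C \<^bold>1\<^bsub>B\<^esub>) F = F"
    and "conv2 C D B F (\<lambda>x y. (\<epsilon>\<^bsub>C\<^esub> x * \<epsilon>\<^bsub>D\<^esub> y) *\<^sub>C \<^bold>1\<^bsub>B\<^esub>) = F"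
proof -
  have "conv2 C D B (\<lambda>x y. (\<epsilon>\<^bsub>C\<^esub> x * \<epsilon>\<^bsub>D\<^esub> y) *\<^sub>C \<^bold>1\<^bsub>B\<^esub>) F x y
    = tsum (\<Delta>\<^bsub>C\<^esub> x) (\<lambda>x1 x2. \<epsilon>\<^bsub>C\<^esub> x1 *\<^sub>C tsum (\<Delta>\<^bsub>D\<^esub> y) (\<lambda>y1 y2. \<epsilon>\<^bsub>D\<^esub> y1 *\<^sub>C F x2 y2))" for x y
    by (simp add: conv2_def scaleC_scaleC scaleC_tsum)
  then show "conv2 C D B (\<lambda>x y. (\<epsilon>\<^bsub>C\<^esub> x * \<epsilon>\<^bsub>D\<^esub> y) *\<^sub>C \<^bold>1\<^bsub>B\<^esub>) F = F"
    by (intro ext) (simp add: C.counit_lin D.counit_lin assms)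
  have "conv2 C D B F (\<lambda>x y. (\<epsilon>\<^bsub>C\<^esub> x * \<epsilon>\<^bsub>D\<^esub> y) *\<^sub>C \<^bold>1\<^bsub>B\<^esub>) x y
    = tsum (\<Delta>\<^bsub>C\<^esub> x) (\<lambda>x1 x2. \<epsilon>\<^bsub>C\<^esub> x2 *\<^sub>C tsum (\<Delta>\<^bsub>D\<^esub> y) (\<lambda>y1 y2. \<epsilon>\<^bsub>D\<^esub> y2 *\<^sub>C F x1 y1))" for x y
    by (simp add: conv2_def scaleC_scaleC scaleC_tsum)
  then show "conv2 C D B F (\<lambda>x y. (\<epsilon>\<^bsub>C\<^esub> x * \<epsilon>\<^bsub>D\<^esub> y) *\<^sub>C \<^bold>1\<^bsub>B\<^esub>) = F"
    by (intro ext) (simp add: C.counit_lin D.counit_lin assms)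
qed

lemma conv2_inverse_unique:
  assumes F: "\<And>y. semilin id (\<lambda>x. F x y)" "\<And>x. semilin id (F x)"
    and G: "\<And>y. semilin id (\<lambda>x. G x y)" "\<And>x. semilin id (G x)"
    and K: "\<And>y. semilin id (\<lambda>x. K x y)" "\<And>x. semilin id (K x)"
    and inv: "conv2 C D B G F = (\<lambda>x y. (\<epsilon>\<^bsub>C\<^esub> x * \<epsilon>\<^bsub>D\<^esub> y) *\<^sub>C \<^bold>1\<^bsub>B\<^esub>)"
     "conv2 C D B F K = (\<lambda>x y. (\<epsilon>\<^bsub>C\<^esub> x * \<epsilon>\<^bsub>D\<^esub> y) *\<^sub>C \<^bold>1\<^bsub>B\<^esub>)"
  shows "G = K"
proof -
  have "G = conv2 C D B G (conv2 C D B F K)"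
    by (simp only: inv conv2_unit(2)[OF G])
  also have "\<dots> = K"
    unfolding conv2_assoc[OF G F K, symmetric] inv(1) by (rule conv2_unit(1)[OF K])
  finally show ?thesis .
qed

lemma semilin_ext [simp]:
  "semilin id F \<Longrightarrow> semilin id (\<lambda>x. ext1 D F x y)" "semilin id (ext1 D F x)"
  "semilin id (\<lambda>x. ext2 C G x y)" "semilin id G \<Longrightarrow> semilin id (ext2 C G x)"
  using D.eps_lin C.eps_lin unfolding ext1_def [abs_def] ext2_def [abs_def] by simp_all

lemma conv2_ext1_left: "(\<And>x. semilin id (G x)) \<Longrightarrow>
    conv2 C D B (ext1 D F) G x y = tsum (\<Delta>\<^bsub>C\<^esub> x) (\<lambda>x1 x2. F x1 \<cdot>\<^bsub>B\<^esub> G x2 y)"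
  by (simp add: conv2_def ext1_def D.counit_lin)

lemma conv2_ext1_right: "(\<And>x. semilin id (G x)) \<Longrightarrow>
    conv2 C D B G (ext1 D F) x y = tsum (\<Delta>\<^bsub>C\<^esub> x) (\<lambda>x1 x2. G x1 y \<cdot>\<^bsub>B\<^esub> F x2)"
  by (simp add: conv2_def ext1_def D.counit_lin)

text \<open>Products of values at independent arguments become convolution products, so that factors
  depending on \<open>x\<close> and on \<open>y\<close> can be exchanged inside one associative
  algebra.\<close>

lemma conv2_ext1_ext2: "semilin id F \<Longrightarrow> semilin id G \<Longrightarrow>
    conv2 C D B (ext1 D F) (ext2 C G) x y = F x \<cdot>\<^bsub>B\<^esub> G y"
  by (simp add: conv2_ext1_left) (simp add: ext2_def C.counit_lin)

lemma ext1_conv: "semilin id f \<Longrightarrow> semilin id g \<Longrightarrow>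
    ext1 D (conv C B f g) = conv2 C D B (ext1 D f) (ext1 D g)"
  by (intro ext) (simp add: conv2_ext1_left, simp add: ext1_def conv_def scaleC_tsum)

lemma ext2_conv: "semilin id f \<Longrightarrow> semilin id g \<Longrightarrow>
    ext2 C (conv D B f g) = conv2 C D B (ext2 C f) (ext2 C g)"
  by (intro ext)
    (simp add: conv2_def ext2_def conv_def scaleC_tsum[symmetric] C.counit_lin del: complex_vector.scale_scale)

end


section \<open>Antipodes\<close>

context bialgebra
begin

lemma eps_mu [simp]: "\<epsilon> (a \<cdot> b) = \<epsilon> a * \<epsilon> b"
  by (rule eps_mult)

lemma eps_one [simp]: "\<epsilon> \<^bold>1 = 1"
  by (rule eps_unit)

lemma Delta_one [simp]: "\<Delta> \<^bold>1 = \<^bold>1 \<otimes>\<^sub>\<complex> \<^bold>1"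
  by (rule Delta_unit)

lemma tsum_Delta_mult:
  assumes "\<And>b. semilin \<sigma> (\<lambda>a. f a b)" "\<And>a. semilin \<sigma> (f a)"
  shows "tsum (\<Delta> (a \<cdot> b)) f = tsum (\<Delta> a) (\<lambda>a1 a2. tsum (\<Delta> b) (\<lambda>b1 b2. f (a1 \<cdot> b1) (a2 \<cdot> b2)))"
  by (simp add: Delta_mult tensor_bialg_simps tsum_tsum[OF assms] tsum_pure_semilin[OF assms])

text \<open>\<open>f \<circ> S\<close> is a left and \<open>S' \<circ> f\<close> a right convolution
  inverse of \<open>f\<close>, hence they agree.\<close>

lemma antipode_unique_hom:
  assumes "bialgebra C" and f: "semilin id f" "\<And>a b. f (a \<cdot> b) = f a \<cdot>\<^bsub>C\<^esub> f b" "f \<^bold>1 = \<^bold>1\<^bsub>C\<^esub>"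
    "\<And>a. \<Delta>\<^bsub>C\<^esub> (f a) = tsum (\<Delta> a) (\<lambda>a1 a2. f a1 \<otimes>\<^sub>\<complex> f a2)" "\<And>a. \<epsilon>\<^bsub>C\<^esub> (f a) = \<epsilon> a"
    and "antipode B S" "antipode C S'"
  shows "f (S a) = S' (f a)"
proof -
  interpret C: bialgebra C by fact
  interpret convolution B C ..
  have S: "semilin id S" "semilin id S'"
    "\<And>a. tsum (\<Delta> a) (\<lambda>a1 a2. S a1 \<cdot> a2) = \<epsilon> a *\<^sub>C \<^bold>1"
    "\<And>a. tsum (\<Delta>\<^bsub>C\<^esub> a) (\<lambda>a1 a2. a1 \<cdot>\<^bsub>C\<^esub> S' a2) = \<epsilon>\<^bsub>C\<^esub> a *\<^sub>C \<^bold>1\<^bsub>C\<^esub>"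
    using assms(7,8) by (simp_all add: antipode_def clinear_iff_semilin sweedler2_def)
  note [simp] = f(1)[THEN semilin_lin_compose] S(1,2)[THEN semilin_lin_compose] f(1) S(1,2)
  have 1: "conv B C (\<lambda>a. f (S a)) f = conv_unit B C"
    using arg_cong[OF S(3), of f]
    by (intro ext) (simp add: conv_def conv_unit_def semilin_image_tsum[OF f(1)] semilin_scale[OF f(1)] f(2,3))
  have 2: "conv B C f (\<lambda>a. S' (f a)) = conv_unit B C"
  proof
    fix x
    have "tsum (\<Delta>\<^bsub>C\<^esub> (f x)) (\<lambda>a1 a2. a1 \<cdot>\<^bsub>C\<^esub> S' a2) = \<epsilon> x *\<^sub>C \<^bold>1\<^bsub>C\<^esub>"
      by (simp add: S f(5))
    then show "conv B C f (\<lambda>a. S' (f a)) x = conv_unit B C x"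
      by (simp add: f(4) tsum_tsum_lin conv_def conv_unit_def)
  qed
  show ?thesis
    by (rule fun_cong[OF conv_inverse_unique[OF _ _ _ 1 2]]) simp_all
qed

context
  fixes S :: "'a \<Rightarrow> 'a"
  assumes S: "antipode B S"
begin

lemma antipode_lin [simp]: "semilin \<sigma> f \<Longrightarrow> semilin \<sigma> (\<lambda>x. S (f x))"
  using S by (simp add: antipode_def clinear_iff_semilin semilin_lin_compose[of S])

lemma antipode_left: "tsum (\<Delta> a) (\<lambda>a1 a2. S a1 \<cdot> a2) = \<epsilon> a *\<^sub>C \<^bold>1"
  and antipode_right: "tsum (\<Delta> a) (\<lambda>a1 a2. a1 \<cdot> S a2) = \<epsilon> a *\<^sub>C \<^bold>1"
  using S by (simp_all add: antipode_def sweedler2_def)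

lemma antipode_lin0 [simp]: "semilin id S"
  using antipode_lin[OF semilin_ident] by simp

lemma eps_antipode: "\<epsilon> (S a) = \<epsilon> a"
proof -
  have "tsum (\<Delta> a) (\<lambda>a1 a2. \<epsilon> (S a1) * \<epsilon> a2) = \<epsilon> a"
    using arg_cong[OF antipode_left, of \<epsilon> a]
    by (simp add: eps_tsum semilin_scale[OF eps_lin] scaleC_complex_def)
  then show ?thesis
    using counit_lin(2)[of "\<lambda>x. \<epsilon> (S x)" a] by (simp add: scaleC_complex_def mult.commute)
qed

text \<open>Both sides invert the multiplication in the convolution algebra of bilinear maps from
  two copies of \<open>B\<close> to \<open>B\<close>.\<close>

lemma antipode_mult: "S (a \<cdot> b) = S b \<cdot> S a"
proof -
  interpret convolution2 B B B ..
  have "(\<lambda>a b. S (a \<cdot> b)) = (\<lambda>a b. S b \<cdot> S a)"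
  proof (rule conv2_inverse_unique[of "mu B"])
    show "conv2 B B B (\<lambda>a b. S (a \<cdot> b)) (mu B) = (\<lambda>x y. (\<epsilon> x * \<epsilon> y) *\<^sub>C \<^bold>1)"
    proof (intro ext)
      show "conv2 B B B (\<lambda>a b. S (a \<cdot> b)) (mu B) x y = (\<epsilon> x * \<epsilon> y) *\<^sub>C \<^bold>1" for x y
        using tsum_Delta_mult[of id "\<lambda>u v. S u \<cdot> v" x y] by (simp add: conv2_def antipode_left)
    qed
    have "tsum (\<Delta> x) (\<lambda>x1 x2. tsum (\<Delta> y) (\<lambda>y1 y2. x1 \<cdot> (y1 \<cdot> S y2) \<cdot> S x2)) = (\<epsilon> x * \<epsilon> y) *\<^sub>C \<^bold>1" for x y
      by (simp add: mu_tsum[symmetric] antipode_right scaleC_tsum[symmetric] scaleC_scaleC mult.commute)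
    then show "conv2 B B B (mu B) (\<lambda>a b. S b \<cdot> S a) = (\<lambda>x y. (\<epsilon> x * \<epsilon> y) *\<^sub>C \<^bold>1)"
      by (intro ext) (simp add: conv2_def mult_assoc)
  qed simp_all
  then show ?thesis by meson
qed

text \<open>Both sides invert \<open>\<Delta>\<close> in the convolution algebra with values in
  \<open>B \<otimes> B\<close>.\<close>

lemma antipode_comult: "\<Delta> (S a) = tsum (\<Delta> a) (\<lambda>a1 a2. S a2 \<otimes>\<^sub>\<complex> S a1)"
proof -
  interpret N: calgebra "tensor_bialg B B"
    by (rule calgebra_tensor) unfold_locales
  interpret convolution B "tensor_bialg B B" ..
  have "(\<lambda>a. \<Delta> (S a)) = (\<lambda>a. tsum (\<Delta> a) (\<lambda>a1 a2. S a2 \<otimes>\<^sub>\<complex> S a1))"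
  proof (rule conv_inverse_unique[of \<Delta>])
    show "conv B (tensor_bialg B B) (\<lambda>a. \<Delta> (S a)) \<Delta> = conv_unit B (tensor_bialg B B)"
      by (intro ext) (simp add: conv_def conv_unit_def Delta_mult[symmetric] antipode_left
        semilin_image_tsum[OF Delta_lin, symmetric] semilin_scale[OF Delta_lin] tensor_bialg_simps(1))
    show "conv B (tensor_bialg B B) \<Delta> (\<lambda>a. tsum (\<Delta> a) (\<lambda>a1 a2. S a2 \<otimes>\<^sub>\<complex> S a1)) = conv_unit B (tensor_bialg B B)"
    proof
      fix x
      \<comment> \<open>Reassociation brings neighbouring factors \<open>u\<close> and
        \<open>S v\<close> together in the second leg, where the antipode axiom contracts
        them.\<close>
      have *: "tsum (\<Delta> r) (\<lambda>a1 a2. tsum (\<Delta> a2) (\<lambda>u v. (y \<cdot> S v) \<otimes>\<^sub>\<complex> (a1 \<cdot> S u))) = (y \<cdot> S r) \<otimes>\<^sub>\<complex> \<^bold>1" for y r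
      proof -
        have "tsum (\<Delta> r) (\<lambda>a1 a2. tsum (\<Delta> a2) (\<lambda>u v. (y \<cdot> S v) \<otimes>\<^sub>\<complex> (a1 \<cdot> S u)))
          = tsum (\<Delta> r) (\<lambda>a1 a2. tsum (\<Delta> a1) (\<lambda>u v. (y \<cdot> S a2) \<otimes>\<^sub>\<complex> (u \<cdot> S v)))"
          by (rule coassoc_lin[symmetric]) simp_all
        then show ?thesis
          by (simp add: pure_tsum(2)[symmetric] antipode_right scaleC_pure_right counit_lin)
      qed
      have "tsum (\<Delta> x) (\<lambda>a1 a2. tsum (\<Delta> a1) (\<lambda>u v. tsum (\<Delta> a2) (\<lambda>p q. (u \<cdot> S q) \<otimes>\<^sub>\<complex> (v \<cdot> S p))))
        = tsum (\<Delta> x) (\<lambda>a1 a2. tsum (\<Delta> a2) (\<lambda>u v. tsum (\<Delta> v) (\<lambda>p q. (a1 \<cdot> S q) \<otimes>\<^sub>\<complex> (u \<cdot> S p))))"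
        by (rule coassoc_lin) simp_all
      also have "\<dots> = \<epsilon> x *\<^sub>C (\<^bold>1 \<otimes>\<^sub>\<complex> \<^bold>1)"
        by (simp add: * pure_tsum(1)[symmetric] antipode_right scaleC_pure)
      finally show "conv B (tensor_bialg B B) \<Delta> (\<lambda>a. tsum (\<Delta> a) (\<lambda>a1 a2. S a2 \<otimes>\<^sub>\<complex> S a1)) x
          = conv_unit B (tensor_bialg B B) x"
        by (simp add: conv_def conv_unit_def tensor_bialg_simps tsum_tsum_lin)
    qed
  qed simp_all
  then show ?thesis by meson
qed

lemma tsum_Delta_antipode:
  assumes "\<And>b. semilin \<sigma> (\<lambda>a. f a b)" "\<And>a. semilin \<sigma> (f a)"
  shows "tsum (\<Delta> (S a)) f = tsum (\<Delta> a) (\<lambda>a1 a2. f (S a2) (S a1))"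
  by (simp add: antipode_comult tsum_tsum[OF assms] tsum_pure_semilin[OF assms])

end

end

text \<open>Scalars now move out of pure tensors, and nested scalars are kept apart so that each
  counit can be contracted separately.\<close>

declare scaleC_pure [symmetric, simp] scaleC_pure_right [simp] complex_vector.scale_scale [simp del]

section \<open>The algebra structure of the cocycle bismash product\<close>

lemma cocycle_bismash_simps:
  "s \<cdot>\<^bsub>cocycle_bismash A H act \<rho> \<chi> \<psi>\<^esub> t = tsum s (\<lambda>a x. tsum t (\<lambda>b y. tsum (\<Delta>\<^bsub>H\<^esub> x) (\<lambda>x1 r.
     tsum (\<Delta>\<^bsub>H\<^esub> r) (\<lambda>x2 x3. tsum (\<Delta>\<^bsub>H\<^esub> y) (\<lambda>y1 y2.
       (a \<cdot>\<^bsub>A\<^esub> act x1 b \<cdot>\<^bsub>A\<^esub> \<chi> x2 y1) \<otimes>\<^sub>\<complex> (x3 \<cdot>\<^bsub>H\<^esub> y2))))))"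
  "\<^bold>1\<^bsub>cocycle_bismash A H act \<rho> \<chi> \<psi>\<^esub> = \<^bold>1\<^bsub>A\<^esub> \<otimes>\<^sub>\<complex> \<^bold>1\<^bsub>H\<^esub>"
  "\<Delta>\<^bsub>cocycle_bismash A H act \<rho> \<chi> \<psi>\<^esub> s = tsum s (\<lambda>a x. tsum (\<Delta>\<^bsub>A\<^esub> a) (\<lambda>a1 a2. tsum (\<Delta>\<^bsub>H\<^esub> x) (\<lambda>x1 r.
     tsum (\<Delta>\<^bsub>H\<^esub> r) (\<lambda>x2 x3. tsum (\<psi> x1) (\<lambda>u v. tsum (\<rho> x2) (\<lambda>h k.
         ((a1 \<cdot>\<^bsub>A\<^esub> u) \<otimes>\<^sub>\<complex> h) \<otimes>\<^sub>\<complex> ((a2 \<cdot>\<^bsub>A\<^esub> v \<cdot>\<^bsub>A\<^esub> k) \<otimes>\<^sub>\<complex> x3)))))))"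
  "\<epsilon>\<^bsub>cocycle_bismash A H act \<rho> \<chi> \<psi>\<^esub> s = tsum s (\<lambda>a x. \<epsilon>\<^bsub>A\<^esub> a * \<epsilon>\<^bsub>H\<^esub> x)"
  by (simp_all add: cocycle_bismash_def sweedler_defs)

context cocycle_linked_pair
begin

abbreviation "M \<equiv> cocycle_bismash A H act \<rho> \<chi> \<psi>"

lemma semilin_act [simp]:
  "semilin \<sigma> f \<Longrightarrow> semilin \<sigma> (\<lambda>x. act (f x) a)" "semilin \<sigma> g \<Longrightarrow> semilin \<sigma> (\<lambda>x. act y (g x))"
  using semilin_lin_compose[of "\<lambda>x. act x a" \<sigma> f] semilin_lin_compose[of "act y" \<sigma> g] act_bilinear
  by (simp_all add: cbilinear_iff_semilin)

lemma semilin_\<chi> [simp]: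
  "semilin \<sigma> f \<Longrightarrow> semilin \<sigma> (\<lambda>x. \<chi> (f x) y)" "semilin \<sigma> g \<Longrightarrow> semilin \<sigma> (\<lambda>x. \<chi> y (g x))"
  using semilin_lin_compose[of "\<lambda>x. \<chi> x y" \<sigma> f] semilin_lin_compose[of "\<chi> y" \<sigma> g] \<chi>_bilinear
  by (simp_all add: cbilinear_iff_semilin)

lemma semilin_\<rho> [simp]: "semilin \<sigma> f \<Longrightarrow> semilin \<sigma> (\<lambda>x. \<rho> (f x))"
  using semilin_lin_compose[of \<rho> \<sigma> f] \<rho>_linear by (simp add: clinear_iff_semilin)

lemma semilin_\<psi> [simp]: "semilin \<sigma> f \<Longrightarrow> semilin \<sigma> (\<lambda>x. \<psi> (f x))"
  using semilin_lin_compose[of \<psi> \<sigma> f] \<psi>_linear by (simp add: clinear_iff_semilin)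

lemma act_tsum: "act (tsum t f) a = tsum t (\<lambda>u v. act (f u v) a)" "act x (tsum t g) = tsum t (\<lambda>u v. act x (g u v))"
  by (rule semilin_image_tsum[of id "\<lambda>x. act x a"], simp) (rule semilin_image_tsum[of id "act x"], simp)

lemma \<chi>_tsum: "\<chi> (tsum t f) a = tsum t (\<lambda>u v. \<chi> (f u v) a)" "\<chi> x (tsum t g) = tsum t (\<lambda>u v. \<chi> x (g u v))"
  by (rule semilin_image_tsum[of id "\<lambda>x. \<chi> x a"], simp) (rule semilin_image_tsum[of id "\<chi> x"], simp)

lemma act_scaleC [simp]: "act x (c *\<^sub>C a) = c *\<^sub>C act x a"
  using semilin_scale[of id "act x"] by simp

lemma \<chi>_scaleC [simp]: "\<chi> x (c *\<^sub>C y) = c *\<^sub>C \<chi> x y"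
  using semilin_scale[of id "\<chi> x"] by simp

declare act_unit [simp] unit_act [simp] \<chi>_unit_left [simp] \<chi>_unit_right [simp]
  \<rho>_unit [simp] \<psi>_unit [simp] eps_act [simp] eps_\<chi> [simp]

lemmas pushes = A.mu_tsum H.mu_tsum pure_tsum scaleC_tsum act_tsum \<chi>_tsum

text \<open>\<open>L a\<close> and \<open>T x\<close> are the left multiplications by \<open>a # 1\<close> and \<open>1 # x\<close>.\<close>

definition "L a t = tsum t (\<lambda>b y. (a \<cdot>\<^bsub>A\<^esub> b) \<otimes>\<^sub>\<complex> y)"

definition "T x t = tsum t (\<lambda>b y. tsum (\<Delta>\<^bsub>H\<^esub> x) (\<lambda>x1 r. tsum (\<Delta>\<^bsub>H\<^esub> r) (\<lambda>x2 x3.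
  tsum (\<Delta>\<^bsub>H\<^esub> y) (\<lambda>y1 y2. (act x1 b \<cdot>\<^bsub>A\<^esub> \<chi> x2 y1) \<otimes>\<^sub>\<complex> (x3 \<cdot>\<^bsub>H\<^esub> y2)))))"

lemma semilin_L [simp]:
  "semilin \<sigma> f \<Longrightarrow> semilin \<sigma> (\<lambda>x. L (f x) t)" "semilin \<sigma> g \<Longrightarrow> semilin \<sigma> (\<lambda>x. L a (g x))"
  by (simp_all add: L_def)

lemma semilin_T [simp]:
  "semilin \<sigma> f \<Longrightarrow> semilin \<sigma> (\<lambda>x. T (f x) t)" "semilin \<sigma> g \<Longrightarrow> semilin \<sigma> (\<lambda>x. T y (g x))"
  by (simp_all add: T_def)

lemma L_tsum: "L (tsum t f) s = tsum t (\<lambda>u v. L (f u v) s)" "L a (tsum t g) = tsum t (\<lambda>u v. L a (g u v))"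
  by (rule semilin_image_tsum[of id "\<lambda>x. L x s"], simp) (rule semilin_image_tsum[of id "L a"], simp)

lemma T_tsum: "T (tsum t f) s = tsum t (\<lambda>u v. T (f u v) s)" "T x (tsum t g) = tsum t (\<lambda>u v. T x (g u v))"
  by (rule semilin_image_tsum[of id "\<lambda>x. T x s"], simp) (rule semilin_image_tsum[of id "T x"], simp)

lemma L_pure [simp]: "L a (b \<otimes>\<^sub>\<complex> y) = (a \<cdot>\<^bsub>A\<^esub> b) \<otimes>\<^sub>\<complex> y"
  by (simp add: L_def)

lemma T_pure: "T x (b \<otimes>\<^sub>\<complex> y) = tsum (\<Delta>\<^bsub>H\<^esub> x) (\<lambda>x1 r. tsum (\<Delta>\<^bsub>H\<^esub> r) (\<lambda>x2 x3.
  tsum (\<Delta>\<^bsub>H\<^esub> y) (\<lambda>y1 y2. (act x1 b \<cdot>\<^bsub>A\<^esub> \<chi> x2 y1) \<otimes>\<^sub>\<complex> (x3 \<cdot>\<^bsub>H\<^esub> y2))))"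
  by (simp add: T_def)

lemma L_L: "L a (L b t) = L (a \<cdot>\<^bsub>A\<^esub> b) t"
  by (rule tensor_ext[of id]) (simp_all add: A.mult_assoc)

lemma L_one [simp]: "L \<^bold>1\<^bsub>A\<^esub> t = t"
  by (simp add: L_def tsum_eta)

lemma T_one [simp]: "T \<^bold>1\<^bsub>H\<^esub> t = t"
proof (rule tensor_ext[of id _ "\<lambda>t. t"])
  show "T \<^bold>1\<^bsub>H\<^esub> (b \<otimes>\<^sub>\<complex> y) = b \<otimes>\<^sub>\<complex> y" for b y
    by (simp add: T_pure pure_tsum[symmetric] scaleC_tsum[symmetric] H.counit_lin)
qed simp_all

text \<open>Every product is expressed through the operators \<open>L\<close> and \<open>T\<close>,
  so associativity reduces to the rules for moving \<open>T\<close> past \<open>L\<close> and past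
  another \<open>T\<close>.\<close>

lemma mu_M: "s \<cdot>\<^bsub>M\<^esub> t = tsum s (\<lambda>a x. L a (T x t))"
  by (simp add: cocycle_bismash_simps T_def L_tsum A.mult_assoc)

lemma T_L: "T x (L b t) = tsum (\<Delta>\<^bsub>H\<^esub> x) (\<lambda>x1 x2. L (act x1 b) (T x2 t))"
proof (rule tensor_ext[of id "\<lambda>t. T x (L b t)" "\<lambda>t. tsum (\<Delta>\<^bsub>H\<^esub> x) (\<lambda>x1 x2. L (act x1 b) (T x2 t))"])
  fix c z
  have "T x (L b (c \<otimes>\<^sub>\<complex> z)) = tsum (\<Delta>\<^bsub>H\<^esub> x) (\<lambda>w r. tsum (\<Delta>\<^bsub>H\<^esub> r) (\<lambda>x2 x3. tsum (\<Delta>\<^bsub>H\<^esub> w) (\<lambda>u v.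
      tsum (\<Delta>\<^bsub>H\<^esub> z) (\<lambda>z1 z2. (act u b \<cdot>\<^bsub>A\<^esub> (act v c \<cdot>\<^bsub>A\<^esub> \<chi> x2 z1)) \<otimes>\<^sub>\<complex> (x3 \<cdot>\<^bsub>H\<^esub> z2)))))"
    by (simp add: T_pure act_mult sweedler2_def pushes A.mult_assoc tsum_commute[of "\<Delta>\<^bsub>H\<^esub> z"])
  also have "\<dots> = tsum (\<Delta>\<^bsub>H\<^esub> x) (\<lambda>u r. tsum (\<Delta>\<^bsub>H\<^esub> r) (\<lambda>v r'. tsum (\<Delta>\<^bsub>H\<^esub> r') (\<lambda>x2 x3.
      tsum (\<Delta>\<^bsub>H\<^esub> z) (\<lambda>z1 z2. (act u b \<cdot>\<^bsub>A\<^esub> (act v c \<cdot>\<^bsub>A\<^esub> \<chi> x2 z1)) \<otimes>\<^sub>\<complex> (x3 \<cdot>\<^bsub>H\<^esub> z2)))))"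
    by (rule H.coassoc2) simp_all
  finally show "T x (L b (c \<otimes>\<^sub>\<complex> z)) = tsum (\<Delta>\<^bsub>H\<^esub> x) (\<lambda>x1 x2. L (act x1 b) (T x2 (c \<otimes>\<^sub>\<complex> z)))"
    by (simp add: T_pure L_tsum)
qed simp_all

text \<open>Two axioms are used in turn: the cocycle identity regroups the factors
  \<open>\<chi>\<close>, and the twisted module identity \<open>act_act\<close> then replaces the
  iterated action by the action of a product.\<close>

lemma T_T: "T x (T y t) = tsum (\<Delta>\<^bsub>H\<^esub> x) (\<lambda>x1 x2. tsum (\<Delta>\<^bsub>H\<^esub> y) (\<lambda>y1 y2. L (\<chi> x1 y1) (T (x2 \<cdot>\<^bsub>H\<^esub> y2) t)))"
proof (rule tensor_ext[of id "\<lambda>t. T x (T y t)" "\<lambda>t. tsum (\<Delta>\<^bsub>H\<^esub> x) (\<lambda>x1 x2. tsum (\<Delta>\<^bsub>H\<^esub> y) (\<lambda>y1 y2. L (\<chi> x1 y1) (T (x2 \<cdot>\<^bsub>H\<^esub> y2) t)))"])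
  fix c z
  \<comment> \<open>As distinct constants, the copies of \<open>H\<close> let the simplifier order the sums over \<open>x\<close>, \<open>y\<close> and \<open>z\<close>.\<close>
  define X Y Z where XYZ: "X = H" "Y = H" "Z = H"
  interpret X: ccoalgebra X by (simp add: XYZ H.ccoalgebra)
  interpret Y: ccoalgebra Y by (simp add: XYZ H.ccoalgebra)
  interpret Z: ccoalgebra Z by (simp add: XYZ H.ccoalgebra)
  note com = tsum_commute[of "\<Delta>\<^bsub>Y\<^esub> u" "\<Delta>\<^bsub>X\<^esub> v" for u v] tsum_commute[of "\<Delta>\<^bsub>Z\<^esub> u" "\<Delta>\<^bsub>X\<^esub> v" for u v]
    tsum_commute[of "\<Delta>\<^bsub>Z\<^esub> u" "\<Delta>\<^bsub>Y\<^esub> v" for u v]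
  note norm = X.coassoc_lin X.coassoc2 X.coassoc3 Y.coassoc_lin Y.coassoc2 Y.coassoc3
    Z.coassoc_lin Z.coassoc2 Z.coassoc3 com pushes A.mult_assoc H.mult_assoc
  have T1: "T y (c \<otimes>\<^sub>\<complex> z) = tsum (\<Delta>\<^bsub>Y\<^esub> y) (\<lambda>y1 r. tsum (\<Delta>\<^bsub>Y\<^esub> r) (\<lambda>y2 y3.
    tsum (\<Delta>\<^bsub>Z\<^esub> z) (\<lambda>z1 z2. (act y1 c \<cdot>\<^bsub>A\<^esub> \<chi> y2 z1) \<otimes>\<^sub>\<complex> (y3 \<cdot>\<^bsub>H\<^esub> z2))))"
    by (simp add: T_pure XYZ)
  have T2: "T x (b \<otimes>\<^sub>\<complex> (y \<cdot>\<^bsub>H\<^esub> z)) = tsum (\<Delta>\<^bsub>X\<^esub> x) (\<lambda>x1 r. tsum (\<Delta>\<^bsub>X\<^esub> r) (\<lambda>x2 x3.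
    tsum (\<Delta>\<^bsub>Y\<^esub> y) (\<lambda>y1 y2. tsum (\<Delta>\<^bsub>Z\<^esub> z) (\<lambda>z1 z2.
      (act x1 b \<cdot>\<^bsub>A\<^esub> \<chi> x2 (y1 \<cdot>\<^bsub>H\<^esub> z1)) \<otimes>\<^sub>\<complex> (x3 \<cdot>\<^bsub>H\<^esub> (y2 \<cdot>\<^bsub>H\<^esub> z2))))))" for x b y z
    by (simp add: T_pure XYZ H.tsum_Delta_mult[of id])
  have T3: "T (x \<cdot>\<^bsub>H\<^esub> y) (c \<otimes>\<^sub>\<complex> z) = tsum (\<Delta>\<^bsub>X\<^esub> x) (\<lambda>x1 r. tsum (\<Delta>\<^bsub>Y\<^esub> y) (\<lambda>y1 s.
     tsum (\<Delta>\<^bsub>X\<^esub> r) (\<lambda>x2 x3. tsum (\<Delta>\<^bsub>Y\<^esub> s) (\<lambda>y2 y3.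
      tsum (\<Delta>\<^bsub>Z\<^esub> z) (\<lambda>z1 z2. (act (x1 \<cdot>\<^bsub>H\<^esub> y1) c \<cdot>\<^bsub>A\<^esub> \<chi> (x2 \<cdot>\<^bsub>H\<^esub> y2) z1) \<otimes>\<^sub>\<complex> (x3 \<cdot>\<^bsub>H\<^esub> y3 \<cdot>\<^bsub>H\<^esub> z2))))))" for x y c z
    by (simp add: T_pure XYZ H.tsum_Delta_mult[of id])
  have act_mult': "act x (a \<cdot>\<^bsub>A\<^esub> b) = tsum (\<Delta>\<^bsub>X\<^esub> x) (\<lambda>x1 x2. act x1 a \<cdot>\<^bsub>A\<^esub> act x2 b)" for x a b
    by (simp add: act_mult sweedler2_def XYZ)
  \<comment> \<open>The bracketed inner sum is the left side of \<open>\<chi>_cocycle\<close> for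
    the split arguments \<open>w\<close>, \<open>t\<close> and \<open>p\<close>.\<close>
  have "T x (T y (c \<otimes>\<^sub>\<complex> z)) = tsum (\<Delta>\<^bsub>X\<^esub> x) (\<lambda>x1 r. tsum (\<Delta>\<^bsub>X\<^esub> r) (\<lambda>w x4. tsum (\<Delta>\<^bsub>Y\<^esub> y) (\<lambda>y1 s. tsum (\<Delta>\<^bsub>Y\<^esub> s) (\<lambda>t y4.
     tsum (\<Delta>\<^bsub>Z\<^esub> z) (\<lambda>p z3. (act x1 (act y1 c) \<cdot>\<^bsub>A\<^esub> tsum (\<Delta>\<^bsub>X\<^esub> w) (\<lambda>x2 x3. tsum (\<Delta>\<^bsub>Y\<^esub> t) (\<lambda>y2 y3. tsum (\<Delta>\<^bsub>Z\<^esub> p) (\<lambda>z1 z2.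
       act x2 (\<chi> y2 z1) \<cdot>\<^bsub>A\<^esub> \<chi> x3 (y3 \<cdot>\<^bsub>H\<^esub> z2))))) \<otimes>\<^sub>\<complex> (x4 \<cdot>\<^bsub>H\<^esub> (y4 \<cdot>\<^bsub>H\<^esub> z3)))))))"
    by (simp add: T1 T2 act_mult' T_tsum norm)
  also have "\<dots> = tsum (\<Delta>\<^bsub>X\<^esub> x) (\<lambda>x1 r. tsum (\<Delta>\<^bsub>X\<^esub> r) (\<lambda>w x4. tsum (\<Delta>\<^bsub>Y\<^esub> y) (\<lambda>y1 s. tsum (\<Delta>\<^bsub>Y\<^esub> s) (\<lambda>t y4.
     tsum (\<Delta>\<^bsub>Z\<^esub> z) (\<lambda>p z3. (act x1 (act y1 c) \<cdot>\<^bsub>A\<^esub> tsum (\<Delta>\<^bsub>X\<^esub> w) (\<lambda>x2 x3. tsum (\<Delta>\<^bsub>Y\<^esub> t) (\<lambda>y2 y3.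
       \<chi> x2 y2 \<cdot>\<^bsub>A\<^esub> \<chi> (x3 \<cdot>\<^bsub>H\<^esub> y3) p))) \<otimes>\<^sub>\<complex> (x4 \<cdot>\<^bsub>H\<^esub> (y4 \<cdot>\<^bsub>H\<^esub> z3)))))))"
    by (simp only: XYZ \<chi>_cocycle[unfolded sweedler2_def])
  \<comment> \<open>Regrouping by coassociativity isolates the left side of
    \<open>act_act\<close>.\<close>
  also have "\<dots> = tsum (\<Delta>\<^bsub>X\<^esub> x) (\<lambda>w r. tsum (\<Delta>\<^bsub>X\<^esub> r) (\<lambda>x3 x4. tsum (\<Delta>\<^bsub>Y\<^esub> y) (\<lambda>t s. tsum (\<Delta>\<^bsub>Y\<^esub> s) (\<lambda>y3 y4.
     tsum (\<Delta>\<^bsub>Z\<^esub> z) (\<lambda>p z3. (tsum (\<Delta>\<^bsub>X\<^esub> w) (\<lambda>x1 x2. tsum (\<Delta>\<^bsub>Y\<^esub> t) (\<lambda>y1 y2. act x1 (act y1 c) \<cdot>\<^bsub>A\<^esub> \<chi> x2 y2)) \<cdot>\<^bsub>A\<^esub>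
        \<chi> (x3 \<cdot>\<^bsub>H\<^esub> y3) p) \<otimes>\<^sub>\<complex> (x4 \<cdot>\<^bsub>H\<^esub> (y4 \<cdot>\<^bsub>H\<^esub> z3)))))))"
    by (simp add: norm)
  also have "\<dots> = tsum (\<Delta>\<^bsub>X\<^esub> x) (\<lambda>w r. tsum (\<Delta>\<^bsub>X\<^esub> r) (\<lambda>x3 x4. tsum (\<Delta>\<^bsub>Y\<^esub> y) (\<lambda>t s. tsum (\<Delta>\<^bsub>Y\<^esub> s) (\<lambda>y3 y4.
     tsum (\<Delta>\<^bsub>Z\<^esub> z) (\<lambda>p z3. (tsum (\<Delta>\<^bsub>X\<^esub> w) (\<lambda>x1 x2. tsum (\<Delta>\<^bsub>Y\<^esub> t) (\<lambda>y1 y2. \<chi> x1 y1 \<cdot>\<^bsub>A\<^esub> act (x2 \<cdot>\<^bsub>H\<^esub> y2) c)) \<cdot>\<^bsub>A\<^esub>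
        \<chi> (x3 \<cdot>\<^bsub>H\<^esub> y3) p) \<otimes>\<^sub>\<complex> (x4 \<cdot>\<^bsub>H\<^esub> (y4 \<cdot>\<^bsub>H\<^esub> z3)))))))"
    by (simp only: XYZ act_act[unfolded sweedler2_def])
  also have "\<dots> = tsum (\<Delta>\<^bsub>X\<^esub> x) (\<lambda>x1 x2. tsum (\<Delta>\<^bsub>Y\<^esub> y) (\<lambda>y1 y2. L (\<chi> x1 y1) (T (x2 \<cdot>\<^bsub>H\<^esub> y2) (c \<otimes>\<^sub>\<complex> z))))"
    by (simp add: T3 L_tsum norm)
  finally show "T x (T y (c \<otimes>\<^sub>\<complex> z)) = tsum (\<Delta>\<^bsub>H\<^esub> x) (\<lambda>x1 x2. tsum (\<Delta>\<^bsub>H\<^esub> y) (\<lambda>y1 y2. L (\<chi> x1 y1) (T (x2 \<cdot>\<^bsub>H\<^esub> y2) (c \<otimes>\<^sub>\<complex> z))))"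
    by (simp add: XYZ)
qed simp_all


section \<open>The axioms of a linked pair evaluated under multilinear maps\<close>

lemma \<rho>_comult_lift:
  assumes "\<And>b c. semilin \<sigma> (\<lambda>a. f a b c)" "\<And>a c. semilin \<sigma> (\<lambda>b. f a b c)" "\<And>a b. semilin \<sigma> (\<lambda>c. f a b c)"
  shows "tsum (\<rho> x) (\<lambda>h k. tsum (\<Delta>\<^bsub>H\<^esub> h) (\<lambda>h1 h2. f h1 h2 k))
    = tsum (\<Delta>\<^bsub>H\<^esub> x) (\<lambda>x1 x2. tsum (\<rho> x1) (\<lambda>h k. tsum (\<rho> x2) (\<lambda>h' k'. f h h' (k \<cdot>\<^bsub>A\<^esub> k'))))"
proof -
  \<comment> \<open>Both sides of the axiom are evaluated under the map that \<open>f\<close>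
    induces on triple tensors. The case \<open>\<sigma> = cnj\<close> serves the conjugated coaction
    later on.\<close>
  have 1: "semilin \<sigma> (\<lambda>r. tsum r (f a))" "semilin \<sigma> (\<lambda>a. tsum r (f a))" for a r
    using semilin_tsum_left[OF semilin_ident assms(2,3)] semilin_tsum[of \<sigma> f r] assms(1) by simp_all
  show ?thesis
    using arg_cong[OF \<rho>_comult[of x], of "\<lambda>t. tsum t (\<lambda>a r. tsum r (f a))"]
    by (simp add: sweedler2_def tsum_tsum[OF 1(2,1)] tsum_pure_semilin[OF 1(2,1)] tsum_pure_semilin[OF assms(2,3)])
qed

lemma \<rho>_\<rho>_lift:
  assumes "\<And>b c. semilin id (\<lambda>a. f a b c)" "\<And>a c. semilin id (\<lambda>b. f a b c)" "\<And>a b. semilin id (\<lambda>c. f a b c)"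
  shows "tsum (\<Delta>\<^bsub>H\<^esub> x) (\<lambda>x1 x2. tsum (\<psi> x1) (\<lambda>u v. tsum (\<rho> x2) (\<lambda>h k.
      tsum (\<rho> h) (\<lambda>p q. f p (u \<cdot>\<^bsub>A\<^esub> q) (v \<cdot>\<^bsub>A\<^esub> k)))))
    = tsum (\<Delta>\<^bsub>H\<^esub> x) (\<lambda>x1 x2. tsum (\<rho> x1) (\<lambda>h k. tsum (\<Delta>\<^bsub>A\<^esub> k) (\<lambda>k1 k2.
         tsum (\<psi> x2) (\<lambda>u v. f h (k1 \<cdot>\<^bsub>A\<^esub> u) (k2 \<cdot>\<^bsub>A\<^esub> v)))))"
  using arg_cong[OF \<rho>_\<rho>[of x], of "\<lambda>t. tsum t (\<lambda>a r. tsum r (f a))"] assms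
  by (simp add: sweedler2_def tsum_tsum_lin)

lemma \<psi>_cocycle_lift:
  assumes "\<And>b c. semilin id (\<lambda>a. f a b c)" "\<And>a c. semilin id (\<lambda>b. f a b c)" "\<And>a b. semilin id (\<lambda>c. f a b c)"
  shows "tsum (\<Delta>\<^bsub>H\<^esub> x) (\<lambda>x1 x2. tsum (\<psi> x1) (\<lambda>u v. tsum (\<Delta>\<^bsub>A\<^esub> u) (\<lambda>u1 u2.
         tsum (\<rho> x2) (\<lambda>h k. tsum (\<psi> h) (\<lambda>p q. f (u1 \<cdot>\<^bsub>A\<^esub> p) (u2 \<cdot>\<^bsub>A\<^esub> q) (v \<cdot>\<^bsub>A\<^esub> k))))))
    = tsum (\<Delta>\<^bsub>H\<^esub> x) (\<lambda>x1 x2. tsum (\<psi> x1) (\<lambda>u v. tsum (\<Delta>\<^bsub>A\<^esub> v) (\<lambda>v1 v2.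
         tsum (\<psi> x2) (\<lambda>p q. f u (v1 \<cdot>\<^bsub>A\<^esub> p) (v2 \<cdot>\<^bsub>A\<^esub> q)))))"
  using arg_cong[OF \<psi>_cocycle[of x], of "\<lambda>t. tsum t (\<lambda>a r. tsum r (f a))"] assms
  by (simp add: sweedler2_def tsum_tsum_lin)

lemma act_\<psi>_lift:
  assumes "\<And>b. semilin id (\<lambda>a. f a b)" "\<And>a. semilin id (f a)"
  shows "tsum (\<Delta>\<^bsub>H\<^esub> x) (\<lambda>x1 x2. tsum (\<Delta>\<^bsub>A\<^esub> (act x1 a)) (\<lambda>b1 b2. tsum (\<psi> x2) (\<lambda>u v.
         f (b1 \<cdot>\<^bsub>A\<^esub> u) (b2 \<cdot>\<^bsub>A\<^esub> v))))
    = tsum (\<Delta>\<^bsub>H\<^esub> x) (\<lambda>x1 r. tsum (\<Delta>\<^bsub>H\<^esub> r) (\<lambda>x2 x3. tsum (\<Delta>\<^bsub>A\<^esub> a) (\<lambda>a1 a2. tsum (\<psi> x1) (\<lambda>u v.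
         tsum (\<rho> x2) (\<lambda>h k. f (u \<cdot>\<^bsub>A\<^esub> act h a1) (v \<cdot>\<^bsub>A\<^esub> k \<cdot>\<^bsub>A\<^esub> act x3 a2))))))"
  using arg_cong[OF act_\<psi>[of x a], of "\<lambda>t. tsum t f"] assms
  by (simp add: sweedler_defs tsum_tsum_lin)

lemma \<rho>_\<chi>_lift:
  assumes "\<And>b. semilin id (\<lambda>a. f a b)" "\<And>a. semilin id (f a)"
  shows "tsum (\<Delta>\<^bsub>H\<^esub> x) (\<lambda>x1 x2. tsum (\<Delta>\<^bsub>H\<^esub> y) (\<lambda>y1 y2. tsum (\<rho> (x2 \<cdot>\<^bsub>H\<^esub> y2)) (\<lambda>h k. f h (\<chi> x1 y1 \<cdot>\<^bsub>A\<^esub> k))))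
    = tsum (\<Delta>\<^bsub>H\<^esub> x) (\<lambda>x1 r. tsum (\<Delta>\<^bsub>H\<^esub> r) (\<lambda>x2 x3. tsum (\<Delta>\<^bsub>H\<^esub> y) (\<lambda>y1 y2. tsum (\<rho> x1) (\<lambda>h k.
         tsum (\<rho> y1) (\<lambda>p q. f (h \<cdot>\<^bsub>H\<^esub> p) (k \<cdot>\<^bsub>A\<^esub> act x2 q \<cdot>\<^bsub>A\<^esub> \<chi> x3 y2))))))"
  using arg_cong[OF \<rho>_\<chi>[of x y], of "\<lambda>t. tsum t f"] assms
  by (simp add: sweedler_defs tsum_tsum_lin)

lemma act_\<rho>_lift:
  assumes "\<And>b. semilin id (\<lambda>a. f a b)" "\<And>a. semilin id (f a)"
  shows "tsum (\<Delta>\<^bsub>H\<^esub> x) (\<lambda>x1 x2. tsum (\<rho> x2) (\<lambda>h k. f h (act x1 a \<cdot>\<^bsub>A\<^esub> k)))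
       = tsum (\<Delta>\<^bsub>H\<^esub> x) (\<lambda>x1 x2. tsum (\<rho> x1) (\<lambda>h k. f h (k \<cdot>\<^bsub>A\<^esub> act x2 a)))"
  using arg_cong[OF act_\<rho>[of x a], of "\<lambda>t. tsum t f"] assms
  by (simp add: sweedler_defs tsum_tsum_lin)

lemma \<chi>_\<psi>_lift:
  assumes "\<And>b. semilin id (\<lambda>a. f a b)" "\<And>a. semilin id (f a)"
  shows "tsum (\<Delta>\<^bsub>H\<^esub> x) (\<lambda>x1 x2. tsum (\<Delta>\<^bsub>H\<^esub> y) (\<lambda>y1 y2.
         tsum (\<Delta>\<^bsub>A\<^esub> (\<chi> x1 y1)) (\<lambda>c1 c2. tsum (\<psi> (x2 \<cdot>\<^bsub>H\<^esub> y2)) (\<lambda>u v. f (c1 \<cdot>\<^bsub>A\<^esub> u) (c2 \<cdot>\<^bsub>A\<^esub> v)))))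
    = tsum (\<Delta>\<^bsub>H\<^esub> x) (\<lambda>x1 r1. tsum (\<Delta>\<^bsub>H\<^esub> r1) (\<lambda>x2 r2. tsum (\<Delta>\<^bsub>H\<^esub> r2) (\<lambda>x3 r3.
         tsum (\<Delta>\<^bsub>H\<^esub> r3) (\<lambda>x4 r4. tsum (\<Delta>\<^bsub>H\<^esub> r4) (\<lambda>x5 x6.
         tsum (\<Delta>\<^bsub>H\<^esub> y) (\<lambda>y1 s. tsum (\<Delta>\<^bsub>H\<^esub> s) (\<lambda>y2 y3.
         tsum (\<psi> x1) (\<lambda>u v. tsum (\<rho> x2) (\<lambda>h k. tsum (\<rho> x4) (\<lambda>h' k'.
         tsum (\<psi> y1) (\<lambda>u' v'. tsum (\<rho> y2) (\<lambda>p q.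
           f (u \<cdot>\<^bsub>A\<^esub> act h u' \<cdot>\<^bsub>A\<^esub> \<chi> h' p)
           (v \<cdot>\<^bsub>A\<^esub> k \<cdot>\<^bsub>A\<^esub> act x3 v' \<cdot>\<^bsub>A\<^esub> k' \<cdot>\<^bsub>A\<^esub> act x5 q \<cdot>\<^bsub>A\<^esub> \<chi> x6 y3)))))))))))))"
  using arg_cong[OF \<chi>_\<psi>[of x y], of "\<lambda>t. tsum t f"] assms
  by (simp add: sweedler_defs tsum_tsum_lin)

lemma calgebra_M: "calgebra M"
proof
  have lin: "semilin id (\<lambda>t. t \<cdot>\<^bsub>M\<^esub> s)" "semilin id (\<lambda>t. s \<cdot>\<^bsub>M\<^esub> t)" for s
    by (simp_all add: mu_M)
  then show "semilin id (\<lambda>t. t \<cdot>\<^bsub>M\<^esub> s)" "semilin id (\<lambda>t. s \<cdot>\<^bsub>M\<^esub> t)" for s .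
  show "\<^bold>1\<^bsub>M\<^esub> \<cdot>\<^bsub>M\<^esub> t = t" for t
    by (simp add: mu_M cocycle_bismash_simps(2))
  show "t \<cdot>\<^bsub>M\<^esub> \<^bold>1\<^bsub>M\<^esub> = t" for t
    by (simp add: mu_M cocycle_bismash_simps(2) T_pure L_tsum scaleC_tsum[symmetric] H.counit_lin tsum_eta)
  \<comment> \<open>Left multiplication by a generator commutes with every right multiplication.
    With the next fact this is associativity, since all left multiplications are sums of composites
    of \<open>L\<close> and \<open>T\<close>.\<close>
  have L: "L a s \<cdot>\<^bsub>M\<^esub> u = L a (s \<cdot>\<^bsub>M\<^esub> u)" for a s u
    by (simp add: mu_M L_def[of a s] tsum_tsum_lin L_tsum L_L)
  have T: "T x s \<cdot>\<^bsub>M\<^esub> u = T x (s \<cdot>\<^bsub>M\<^esub> u)" for x s u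
  proof (rule tensor_ext[of id "\<lambda>s. T x s \<cdot>\<^bsub>M\<^esub> u" "\<lambda>s. T x (s \<cdot>\<^bsub>M\<^esub> u)"])
    show "T x (b \<otimes>\<^sub>\<complex> y) \<cdot>\<^bsub>M\<^esub> u = T x ((b \<otimes>\<^sub>\<complex> y) \<cdot>\<^bsub>M\<^esub> u)" for b y
      by (simp add: mu_M T_pure[of x b y] tsum_tsum_lin T_L T_T L_tsum L_L)
  qed (simp_all add: mu_M)
  show "s \<cdot>\<^bsub>M\<^esub> t \<cdot>\<^bsub>M\<^esub> u = s \<cdot>\<^bsub>M\<^esub> (t \<cdot>\<^bsub>M\<^esub> u)" for s t u
    by (simp add: mu_M[of s] semilin_image_tsum[OF lin(1)] L T)
qed

sublocale M: calgebra M
  by (rule calgebra_M)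

text \<open>The hypotheses allow \<open>F0 b\<close> to pass \<open>F1 x\<close> and two factors
  \<open>F1\<close> to merge, exactly as in the product of \<open>M\<close>. The rule serves the
  coproduct, the counit, the projection to \<open>H\<close> and, through the opposite algebra, the
  involution.\<close>

lemma cross_hom_mult:
  assumes "calgebra B" and lin: "semilin \<sigma> F0" "semilin \<sigma> F1"
    and 0: "\<And>a b. F0 (a \<cdot>\<^bsub>A\<^esub> b) = F0 a \<cdot>\<^bsub>B\<^esub> F0 b"
    and 1: "\<And>x a. F1 x \<cdot>\<^bsub>B\<^esub> F0 a = tsum (\<Delta>\<^bsub>H\<^esub> x) (\<lambda>x1 x2. F0 (act x1 a) \<cdot>\<^bsub>B\<^esub> F1 x2)"
    and 2: "\<And>x y. F1 x \<cdot>\<^bsub>B\<^esub> F1 y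
      = tsum (\<Delta>\<^bsub>H\<^esub> x) (\<lambda>x1 x2. tsum (\<Delta>\<^bsub>H\<^esub> y) (\<lambda>y1 y2. F0 (\<chi> x1 y1) \<cdot>\<^bsub>B\<^esub> F1 (x2 \<cdot>\<^bsub>H\<^esub> y2)))"
  shows "tsum (s \<cdot>\<^bsub>M\<^esub> t) (\<lambda>a x. F0 a \<cdot>\<^bsub>B\<^esub> F1 x)
    = tsum s (\<lambda>a x. F0 a \<cdot>\<^bsub>B\<^esub> F1 x) \<cdot>\<^bsub>B\<^esub> tsum t (\<lambda>a x. F0 a \<cdot>\<^bsub>B\<^esub> F1 x)"
proof -
  interpret B: calgebra B by fact
  let ?F = "\<lambda>a x. F0 a \<cdot>\<^bsub>B\<^esub> F1 x"
  have F: "semilin \<sigma> (\<lambda>a. ?F a x)" "semilin \<sigma> (?F a)" for a x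
    by (simp_all add: lin)
  have *: "?F a x \<cdot>\<^bsub>B\<^esub> ?F b y = tsum (\<Delta>\<^bsub>H\<^esub> x) (\<lambda>x1 r. tsum (\<Delta>\<^bsub>H\<^esub> r) (\<lambda>x2 x3. tsum (\<Delta>\<^bsub>H\<^esub> y) (\<lambda>y1 y2.
      ?F (a \<cdot>\<^bsub>A\<^esub> act x1 b \<cdot>\<^bsub>A\<^esub> \<chi> x2 y1) (x3 \<cdot>\<^bsub>H\<^esub> y2))))" for a x b y
  proof -
    have "?F a x \<cdot>\<^bsub>B\<^esub> ?F b y = F0 a \<cdot>\<^bsub>B\<^esub> ((F1 x \<cdot>\<^bsub>B\<^esub> F0 b) \<cdot>\<^bsub>B\<^esub> F1 y)"
      by (simp add: B.mult_assoc)
    also have "\<dots> = tsum (\<Delta>\<^bsub>H\<^esub> x) (\<lambda>x1 x2. F0 a \<cdot>\<^bsub>B\<^esub> (F0 (act x1 b) \<cdot>\<^bsub>B\<^esub> (F1 x2 \<cdot>\<^bsub>B\<^esub> F1 y)))"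
      by (simp only: 1 B.mu_tsum B.mult_assoc)
    finally show ?thesis by (simp add: 2 B.mu_tsum 0 B.mult_assoc)
  qed
  show ?thesis
    by (simp add: cocycle_bismash_simps tsum_tsum[OF F] tsum_pure_semilin[OF F] * [symmetric]
      B.mu_tsum(1)) (simp add: B.mu_tsum(2))
qed

section \<open>The copies of \<open>A\<close> and \<open>H\<close> inside the product\<close>

definition inA :: "'a::complex_vector \<Rightarrow> 'a \<otimes>\<^sub>\<complex> 'h::complex_vector" where "inA a = a \<otimes>\<^sub>\<complex> \<^bold>1\<^bsub>H\<^esub>"
definition inH :: "'h::complex_vector \<Rightarrow> 'a::complex_vector \<otimes>\<^sub>\<complex> 'h" where "inH x = \<^bold>1\<^bsub>A\<^esub> \<otimes>\<^sub>\<complex> x"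

lemma semilin_inA [simp]: "semilin \<sigma> f \<Longrightarrow> semilin \<sigma> (\<lambda>x. inA (f x))"
  and semilin_inH [simp]: "semilin \<sigma> g \<Longrightarrow> semilin \<sigma> (\<lambda>x. inH (g x))"
  by (simp_all add: inA_def inH_def)

lemma inA_tsum: "inA (tsum t f) = tsum t (\<lambda>u v. inA (f u v))"
  and inH_tsum: "inH (tsum t g) = tsum t (\<lambda>u v. inH (g u v))"
  by (rule semilin_image_tsum[of id inA], simp) (rule semilin_image_tsum[of id inH], simp)

lemma inA_scaleC [simp]: "inA (c *\<^sub>C a) = c *\<^sub>C inA a"
  and inH_scaleC [simp]: "inH (c *\<^sub>C x) = c *\<^sub>C inH x"
  by (simp_all add: inA_def inH_def)

lemma inA_one [simp]: "inA \<^bold>1\<^bsub>A\<^esub> = \<^bold>1\<^bsub>M\<^esub>" and inH_one [simp]: "inH \<^bold>1\<^bsub>H\<^esub> = \<^bold>1\<^bsub>M\<^esub>"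
  by (simp_all add: inA_def inH_def cocycle_bismash_simps)

lemma inA_M: "inA a \<cdot>\<^bsub>M\<^esub> t = L a t" and inH_M: "inH x \<cdot>\<^bsub>M\<^esub> t = T x t"
  by (simp_all add: mu_M inA_def inH_def)

lemma inA_inA: "inA a \<cdot>\<^bsub>M\<^esub> inA b = inA (a \<cdot>\<^bsub>A\<^esub> b)"
  by (simp add: inA_M) (simp add: inA_def)

lemma inA_inH: "inA a \<cdot>\<^bsub>M\<^esub> inH x = a \<otimes>\<^sub>\<complex> x"
  by (simp add: inA_M inH_def)

lemma inH_inA: "inH x \<cdot>\<^bsub>M\<^esub> inA a = tsum (\<Delta>\<^bsub>H\<^esub> x) (\<lambda>x1 x2. inA (act x1 a) \<cdot>\<^bsub>M\<^esub> inH x2)"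
  by (simp add: inH_M inA_inH) (simp add: inA_def T_pure H.counit_lin)

lemma inH_inH: "inH x \<cdot>\<^bsub>M\<^esub> inH y
    = tsum (\<Delta>\<^bsub>H\<^esub> x) (\<lambda>x1 x2. tsum (\<Delta>\<^bsub>H\<^esub> y) (\<lambda>y1 y2. inA (\<chi> x1 y1) \<cdot>\<^bsub>M\<^esub> inH (x2 \<cdot>\<^bsub>H\<^esub> y2)))"
  by (simp add: inH_M inA_inH) (simp add: inH_def T_pure scaleC_tsum[symmetric] H.counit_lin)

abbreviation "N \<equiv> tensor_bialg M M"

lemma calgebra_N: "calgebra N"
  by (rule calgebra_tensor) (rule calgebra_M)+

sublocale N: calgebra N
  by (rule calgebra_N)

lemma N_pure: "(a \<otimes>\<^sub>\<complex> b) \<cdot>\<^bsub>N\<^esub> (a' \<otimes>\<^sub>\<complex> b') = (a \<cdot>\<^bsub>M\<^esub> a') \<otimes>\<^sub>\<complex> (b \<cdot>\<^bsub>M\<^esub> b')"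
  by (rule mu_tensor_pure) (rule calgebra_M)+

end

section \<open>The coproduct of the cocycle bismash product is multiplicative\<close>

context cocycle_linked_pair
begin

sublocale HN: convolution H N ..
sublocale HHN: convolution2 H H N ..

text \<open>\<open>Dl a\<close> and \<open>Dj x\<close> are the coproducts of \<open>a # 1\<close> and \<open>1 # x\<close>. The maps \<open>Rp a\<close> and \<open>Ka a\<close> appear when
  \<open>(a # 1) \<otimes> 1\<close> and \<open>1 \<otimes> (a # 1)\<close> are moved to the left past \<open>Rh\<close> and \<open>Jh\<close>.\<close>

definition "Dl a = tsum (\<Delta>\<^bsub>A\<^esub> a) (\<lambda>a1 a2. inA a1 \<otimes>\<^sub>\<complex> inA a2)"
definition "Ps x = tsum (\<psi> x) (\<lambda>u v. inA u \<otimes>\<^sub>\<complex> inA v)"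
definition "Rh x = tsum (\<rho> x) (\<lambda>h k. inH h \<otimes>\<^sub>\<complex> inA k)"
definition "Jh x = \<^bold>1\<^bsub>M\<^esub> \<otimes>\<^sub>\<complex> inH x"
definition "Rp a x = tsum (\<rho> x) (\<lambda>h k. inA (act h a) \<otimes>\<^sub>\<complex> inA k)"
definition "Ka a x = \<^bold>1\<^bsub>M\<^esub> \<otimes>\<^sub>\<complex> inA (act x a)"
definition "Dj = conv H N Ps (conv H N Rh Jh)"

lemma semilin_defs [simp]:
  "semilin \<sigma> f \<Longrightarrow> semilin \<sigma> (\<lambda>x. Dl (f x))"
  "semilin \<sigma> g \<Longrightarrow> semilin \<sigma> (\<lambda>x. Ps (g x))" "semilin \<sigma> g \<Longrightarrow> semilin \<sigma> (\<lambda>x. Rh (g x))"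
  "semilin \<sigma> g \<Longrightarrow> semilin \<sigma> (\<lambda>x. Jh (g x))" "semilin \<sigma> g \<Longrightarrow> semilin \<sigma> (\<lambda>x. Rp a (g x))"
  "semilin \<sigma> f \<Longrightarrow> semilin \<sigma> (\<lambda>x. Rp (f x) y)" "semilin \<sigma> g \<Longrightarrow> semilin \<sigma> (\<lambda>x. Ka a (g x))"
  "semilin \<sigma> f \<Longrightarrow> semilin \<sigma> (\<lambda>x. Ka (f x) y)" "semilin \<sigma> g \<Longrightarrow> semilin \<sigma> (\<lambda>x. Dj (g x))"
  by (simp_all add: Dl_def Ps_def Rh_def Jh_def Rp_def Ka_def Dj_def conv_def)

text \<open>Restricted to a pure left factor, so that the sums of the left factor are pulled out
  first and the order of sums is predictable.\<close>

lemma N_pure_tsum: "(a \<otimes>\<^sub>\<complex> b) \<cdot>\<^bsub>N\<^esub> tsum t f = tsum t (\<lambda>u v. (a \<otimes>\<^sub>\<complex> b) \<cdot>\<^bsub>N\<^esub> f u v)"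
  by (rule N.mu_tsum)

lemmas N_pushes = N.mu_tsum(1) N_pure_tsum N_pure
text \<open>The resulting order has coproducts outermost, then \<open>\<psi>\<close>, then
  \<open>\<rho>\<close>.\<close>

lemmas com_H = tsum_commute[of "\<psi> u" "\<Delta>\<^bsub>H\<^esub> v" for u v] tsum_commute[of "\<rho> u" "\<Delta>\<^bsub>H\<^esub> v" for u v]
  tsum_commute[of "\<rho> u" "\<psi> v" for u v]

section \<open>Moving the coproduct of \<open>a # 1\<close> past that of
  \<open>1 # x\<close>\<close>

lemma Dl_mult: "Dl (a \<cdot>\<^bsub>A\<^esub> b) = Dl a \<cdot>\<^bsub>N\<^esub> Dl b"
  by (simp add: Dl_def A.tsum_Delta_mult[of id] N_pushes inA_inA)

lemma Jh_inA: "Jh x \<cdot>\<^bsub>N\<^esub> (inA a \<otimes>\<^sub>\<complex> inA b) = conv H N (\<lambda>x. inA a \<otimes>\<^sub>\<complex> inA (act x b)) Jh x"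
  by (simp add: Jh_def N_pure inH_inA pure_tsum conv_def)

text \<open>Moving \<open>inA a\<close> to the left of \<open>inH h\<close> requires the coproduct
  of \<open>h\<close>, which comultiplicativity of \<open>\<rho>\<close> converts into a coproduct
  of \<open>x\<close>.\<close>

lemma Rh_inA: "Rh x \<cdot>\<^bsub>N\<^esub> (inA a \<otimes>\<^sub>\<complex> \<^bold>1\<^bsub>M\<^esub>) = conv H N (Rp a) Rh x"
proof -
  have "Rh x \<cdot>\<^bsub>N\<^esub> (inA a \<otimes>\<^sub>\<complex> \<^bold>1\<^bsub>M\<^esub>) = tsum (\<rho> x) (\<lambda>h k. tsum (\<Delta>\<^bsub>H\<^esub> h) (\<lambda>h1 h2.
      (inA (act h1 a) \<cdot>\<^bsub>M\<^esub> inH h2) \<otimes>\<^sub>\<complex> inA k))"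
    by (simp add: Rh_def N_pushes inH_inA pure_tsum)
  also have "\<dots> = conv H N (Rp a) Rh x"
    by (subst \<rho>_comult_lift[of id]) (simp_all add: conv_def Rp_def Rh_def N_pushes inA_inA)
  finally show ?thesis .
qed

text \<open>The axiom \<open>act_\<rho>\<close> in convolution form.\<close>

lemma Ka_Rh: "conv H N (Ka a) Rh = conv H N Rh (Ka a)"
proof
  fix x
  have "tsum (\<Delta>\<^bsub>H\<^esub> x) (\<lambda>x1 x2. tsum (\<rho> x2) (\<lambda>h k. inH h \<otimes>\<^sub>\<complex> inA (act x1 a \<cdot>\<^bsub>A\<^esub> k)))
       = tsum (\<Delta>\<^bsub>H\<^esub> x) (\<lambda>x1 x2. tsum (\<rho> x1) (\<lambda>h k. inH h \<otimes>\<^sub>\<complex> inA (k \<cdot>\<^bsub>A\<^esub> act x2 a)))"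
    by (rule act_\<rho>_lift) simp_all
  then show "conv H N (Ka a) Rh x = conv H N Rh (Ka a) x"
    by (simp add: conv_def Ka_def Rh_def N_pushes inA_inA)
qed

lemma Rh_inA_Ka: "conv H N Rh (\<lambda>x. inA a \<otimes>\<^sub>\<complex> inA (act x b)) = conv H N (Rp a) (conv H N (Ka b) Rh)"
proof -
  have "conv H N Rh (\<lambda>x. inA a \<otimes>\<^sub>\<complex> inA (act x b)) = conv H N (conv H N (Rp a) Rh) (Ka b)"
    by (rule ext) (simp add: conv_def[of _ _ Rh] conv_def[of _ _ "conv _ _ _ _"] Rh_inA[symmetric]
      N.mult_assoc Ka_def N_pure)
  then show ?thesis
    by (simp add: HN.conv_assoc[of id] Ka_Rh)
qed

text \<open>The axiom \<open>act_\<psi>\<close> in convolution form.\<close>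

lemma Dl_act_Ps: "conv H N (\<lambda>x. Dl (act x a)) Ps x
  = tsum (\<Delta>\<^bsub>A\<^esub> a) (\<lambda>a1 a2. conv H N Ps (conv H N (Rp a1) (Ka a2)) x)"
proof -
  have "tsum (\<Delta>\<^bsub>H\<^esub> x) (\<lambda>x1 x2. tsum (\<Delta>\<^bsub>A\<^esub> (act x1 a)) (\<lambda>b1 b2. tsum (\<psi> x2) (\<lambda>u v.
         inA (b1 \<cdot>\<^bsub>A\<^esub> u) \<otimes>\<^sub>\<complex> inA (b2 \<cdot>\<^bsub>A\<^esub> v))))
    = tsum (\<Delta>\<^bsub>H\<^esub> x) (\<lambda>x1 r. tsum (\<Delta>\<^bsub>H\<^esub> r) (\<lambda>x2 x3. tsum (\<Delta>\<^bsub>A\<^esub> a) (\<lambda>a1 a2. tsum (\<psi> x1) (\<lambda>u v.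
         tsum (\<rho> x2) (\<lambda>h k. inA (u \<cdot>\<^bsub>A\<^esub> act h a1) \<otimes>\<^sub>\<complex> inA (v \<cdot>\<^bsub>A\<^esub> k \<cdot>\<^bsub>A\<^esub> act x3 a2))))))"
    by (rule act_\<psi>_lift) simp_all
  then show ?thesis
    by (simp add: conv_def Dl_def Ps_def Rp_def Ka_def N_pushes inA_inA com_H A.mult_assoc
        tsum_commute[of _ "\<Delta>\<^bsub>A\<^esub> a"])
qed

lemma Rh_Jh_inA: "conv H N Rh Jh x \<cdot>\<^bsub>N\<^esub> (inA a \<otimes>\<^sub>\<complex> inA b)
  = conv H N (Rp a) (conv H N (Ka b) (conv H N Rh Jh)) x"
proof -
  have "conv H N Rh Jh x \<cdot>\<^bsub>N\<^esub> (inA a \<otimes>\<^sub>\<complex> inA b)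
    = conv H N Rh (conv H N (\<lambda>x. inA a \<otimes>\<^sub>\<complex> inA (act x b)) Jh) x"
    by (simp add: conv_def[of _ _ Rh] N.mu_tsum N.mult_assoc Jh_inA)
  also have "conv H N Rh (conv H N (\<lambda>x. inA a \<otimes>\<^sub>\<complex> inA (act x b)) Jh)
    = conv H N (conv H N (Rp a) (conv H N (Ka b) Rh)) Jh"
    by (simp add: HN.conv_assoc[of id, symmetric] Rh_inA_Ka)
  finally show ?thesis
    by (simp add: HN.conv_assoc[of id])
qed

text \<open>Both legs of \<open>Dl a\<close> move left past \<open>Jh\<close> and \<open>Rh\<close>,
  producing \<open>Rp\<close> and \<open>Ka\<close>; \<open>Dl_act_Ps\<close> then reassembles these
  with \<open>Ps\<close> into the coproduct of \<open>act x1 a\<close>.\<close>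

lemma Dj_Dl: "Dj x \<cdot>\<^bsub>N\<^esub> Dl a = tsum (\<Delta>\<^bsub>H\<^esub> x) (\<lambda>x1 x2. Dl (act x1 a) \<cdot>\<^bsub>N\<^esub> Dj x2)"
proof -
  have 1: "Dj x \<cdot>\<^bsub>N\<^esub> (inA b \<otimes>\<^sub>\<complex> inA c)
    = conv H N (conv H N Ps (conv H N (Rp b) (Ka c))) (conv H N Rh Jh) x" for b c
  proof -
    have "Dj x \<cdot>\<^bsub>N\<^esub> (inA b \<otimes>\<^sub>\<complex> inA c) = conv H N Ps (conv H N (Rp b) (conv H N (Ka c) (conv H N Rh Jh))) x"
      by (simp add: Dj_def conv_def[of _ _ Ps] N.mu_tsum N.mult_assoc Rh_Jh_inA)
    then show ?thesis
      by (simp add: HN.conv_assoc[of id])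
  qed
  have "Dj x \<cdot>\<^bsub>N\<^esub> Dl a = tsum (\<Delta>\<^bsub>A\<^esub> a) (\<lambda>b c.
    conv H N (conv H N Ps (conv H N (Rp b) (Ka c))) (conv H N Rh Jh) x)"
    by (simp add: Dl_def N.mu_tsum 1)
  also have "\<dots> = conv H N (conv H N (\<lambda>x. Dl (act x a)) Ps) (conv H N Rh Jh) x"
    by (simp add: conv_def[of _ _ "conv H N (\<lambda>x. Dl (act x a)) Ps"] Dl_act_Ps)
      (simp add: conv_def[of _ _ "conv H N Ps _"] N.mu_tsum tsum_commute[of _ "\<Delta>\<^bsub>A\<^esub> a"])
  also have "\<dots> = conv H N (\<lambda>x. Dl (act x a)) Dj x"
    by (simp add: Dj_def HN.conv_assoc[of id])
  finally show ?thesis by (simp add: conv_def)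
qed

text \<open>In \<open>Dj x \<cdot> Dj y\<close>, the factors of \<open>Dj y\<close> are moved to the left one by one: \<open>Ps y\<close> becomes \<open>Pa\<close> on passing
  \<open>Jh x\<close> and \<open>Qa\<close> on passing \<open>Rh x\<close>, and \<open>Rh y\<close> becomes \<open>Ua\<close> on passing \<open>Jh x\<close>; then \<open>Rh x\<close> and \<open>Ua\<close> are
  rewritten as \<open>Va\<close> and \<open>Wa\<close>.\<close>

definition "Pa x y = tsum (\<psi> y) (\<lambda>u v. inA u \<otimes>\<^sub>\<complex> inA (act x v))"
definition "Qa x y = tsum (\<psi> y) (\<lambda>u v. conv H N (Rp u) (Ka v) x)"
definition "Ua x y = tsum (\<rho> y) (\<lambda>p q. inH p \<otimes>\<^sub>\<complex> inA (act x q))"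
definition "Va x y = tsum (\<Delta>\<^bsub>H\<^esub> x) (\<lambda>x1 x2. tsum (\<rho> x1) (\<lambda>h k. tsum (\<rho> y) (\<lambda>p q.
  inA (\<chi> h p) \<otimes>\<^sub>\<complex> inA (k \<cdot>\<^bsub>A\<^esub> act x2 q))))"
definition "Wa x y = tsum (\<Delta>\<^bsub>H\<^esub> x) (\<lambda>x1 x2. tsum (\<rho> x1) (\<lambda>h k. tsum (\<rho> y) (\<lambda>p q.
  inH (h \<cdot>\<^bsub>H\<^esub> p) \<otimes>\<^sub>\<complex> inA (k \<cdot>\<^bsub>A\<^esub> act x2 q))))"
definition "Ca x y = \<^bold>1\<^bsub>M\<^esub> \<otimes>\<^sub>\<complex> inA (\<chi> x y)"

lemma semilin_defs2 [simp]:
  "semilin \<sigma> f \<Longrightarrow> semilin \<sigma> (\<lambda>x. Pa (f x) y)" "semilin \<sigma> f \<Longrightarrow> semilin \<sigma> (\<lambda>x. Pa y (f x))"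
  "semilin \<sigma> f \<Longrightarrow> semilin \<sigma> (\<lambda>x. Qa (f x) y)" "semilin \<sigma> f \<Longrightarrow> semilin \<sigma> (\<lambda>x. Qa y (f x))"
  "semilin \<sigma> f \<Longrightarrow> semilin \<sigma> (\<lambda>x. Ua (f x) y)" "semilin \<sigma> f \<Longrightarrow> semilin \<sigma> (\<lambda>x. Ua y (f x))"
  "semilin \<sigma> f \<Longrightarrow> semilin \<sigma> (\<lambda>x. Va (f x) y)" "semilin \<sigma> f \<Longrightarrow> semilin \<sigma> (\<lambda>x. Va y (f x))"
  "semilin \<sigma> f \<Longrightarrow> semilin \<sigma> (\<lambda>x. Wa (f x) y)" "semilin \<sigma> f \<Longrightarrow> semilin \<sigma> (\<lambda>x. Wa y (f x))"
  "semilin \<sigma> f \<Longrightarrow> semilin \<sigma> (\<lambda>x. Ca (f x) y)" "semilin \<sigma> f \<Longrightarrow> semilin \<sigma> (\<lambda>x. Ca y (f x))"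
  by (simp_all add: Pa_def Qa_def Ua_def Va_def Wa_def Ca_def conv_def)

lemma semilin_defs_eta [simp]:
  "semilin id Ps" "semilin id Rh" "semilin id Jh" "semilin id Dj" "semilin id (Rp a)" "semilin id (Ka a)"
  using semilin_defs(2-5,7,9)[OF semilin_ident] by simp_all

lemma semilin_defs2_eta [simp]:
  "semilin id (Pa x)" "semilin id (Qa x)" "semilin id (Ua x)" "semilin id (Va x)" "semilin id (Wa x)" "semilin id (Ca x)"
  using semilin_defs2(2,4,6,8,10,12)[OF semilin_ident] by simp_all

section \<open>Exchange relations in two variables\<close>

lemma Jh_Ps: "conv2 H H N (ext1 H Jh) (ext2 H Ps) = conv2 H H N Pa (ext1 H Jh)"
proof (intro ext)
  fix x y
  have "Jh x \<cdot>\<^bsub>N\<^esub> Ps y = tsum (\<Delta>\<^bsub>H\<^esub> x) (\<lambda>x1 x2. Pa x1 y \<cdot>\<^bsub>N\<^esub> Jh x2)"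
    by (simp add: Ps_def Pa_def N.mu_tsum Jh_inA conv_def com_H)
  then show "conv2 H H N (ext1 H Jh) (ext2 H Ps) x y = conv2 H H N Pa (ext1 H Jh) x y"
    by (simp add: HHN.conv2_ext1_ext2 HHN.conv2_ext1_right)
qed

lemma Rh_Pa: "conv2 H H N (ext1 H Rh) Pa = conv2 H H N Qa (ext1 H Rh)"
proof (intro ext)
  fix x y
  have "tsum (\<Delta>\<^bsub>H\<^esub> x) (\<lambda>x1 x2. Rh x1 \<cdot>\<^bsub>N\<^esub> Pa x2 y)
    = tsum (\<psi> y) (\<lambda>u v. conv H N Rh (\<lambda>x. inA u \<otimes>\<^sub>\<complex> inA (act x v)) x)"
    by (simp add: Pa_def N.mu_tsum conv_def com_H)
  also have "\<dots> = tsum (\<psi> y) (\<lambda>u v. conv H N (conv H N (Rp u) (Ka v)) Rh x)"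
    by (simp add: Rh_inA_Ka HN.conv_assoc[of id])
  also have "\<dots> = tsum (\<Delta>\<^bsub>H\<^esub> x) (\<lambda>x1 x2. Qa x1 y \<cdot>\<^bsub>N\<^esub> Rh x2)"
    by (simp add: Qa_def N.mu_tsum(1) conv_def[of _ _ "conv _ _ _ _"] com_H)
  finally show "conv2 H H N (ext1 H Rh) Pa x y = conv2 H H N Qa (ext1 H Rh) x y"
    by (simp add: HHN.conv2_ext1_left HHN.conv2_ext1_right)
qed

lemma Jh_Rh: "conv2 H H N (ext1 H Jh) (ext2 H Rh) = conv2 H H N Ua (ext1 H Jh)"
proof (intro ext)
  fix x y
  have "Jh x \<cdot>\<^bsub>N\<^esub> Rh y = tsum (\<Delta>\<^bsub>H\<^esub> x) (\<lambda>x1 x2. Ua x1 y \<cdot>\<^bsub>N\<^esub> Jh x2)"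
    by (simp add: Jh_def Rh_def Ua_def N_pushes inH_inA pure_tsum com_H)
  then show "conv2 H H N (ext1 H Jh) (ext2 H Rh) x y = conv2 H H N Ua (ext1 H Jh) x y"
    by (simp add: HHN.conv2_ext1_ext2 HHN.conv2_ext1_right)
qed

text \<open>The axiom \<open>\<rho>_\<chi>\<close> in convolution form.\<close>

lemma Wa_Ca: "conv2 H H N Wa Ca = conv2 H H N Ca (\<lambda>x y. Rh (x \<cdot>\<^bsub>H\<^esub> y))"
proof (intro ext)
  fix x y
  have "tsum (\<Delta>\<^bsub>H\<^esub> x) (\<lambda>x1 x2. tsum (\<Delta>\<^bsub>H\<^esub> y) (\<lambda>y1 y2. tsum (\<rho> (x2 \<cdot>\<^bsub>H\<^esub> y2)) (\<lambda>h k.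
      inH h \<otimes>\<^sub>\<complex> inA (\<chi> x1 y1 \<cdot>\<^bsub>A\<^esub> k))))
    = tsum (\<Delta>\<^bsub>H\<^esub> x) (\<lambda>x1 r. tsum (\<Delta>\<^bsub>H\<^esub> r) (\<lambda>x2 x3. tsum (\<Delta>\<^bsub>H\<^esub> y) (\<lambda>y1 y2. tsum (\<rho> x1) (\<lambda>h k.
         tsum (\<rho> y1) (\<lambda>p q. inH (h \<cdot>\<^bsub>H\<^esub> p) \<otimes>\<^sub>\<complex> inA (k \<cdot>\<^bsub>A\<^esub> act x2 q \<cdot>\<^bsub>A\<^esub> \<chi> x3 y2))))))"
    by (rule \<rho>_\<chi>_lift) simp_all
  moreover define X where "X = H"
  interpret X: ccoalgebra X by (simp add: X_def H.ccoalgebra)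
  have "conv2 H H N Wa Ca x y = tsum (\<Delta>\<^bsub>X\<^esub> x) (\<lambda>x1 r. tsum (\<Delta>\<^bsub>X\<^esub> r) (\<lambda>x2 x3. tsum (\<Delta>\<^bsub>H\<^esub> y) (\<lambda>y1 y2.
      tsum (\<rho> x1) (\<lambda>h k. tsum (\<rho> y1) (\<lambda>p q.
        inH (h \<cdot>\<^bsub>H\<^esub> p) \<otimes>\<^sub>\<complex> inA (k \<cdot>\<^bsub>A\<^esub> act x2 q \<cdot>\<^bsub>A\<^esub> \<chi> x3 y2))))))"
  proof -
    have "conv2 H H N F G x y = tsum (\<Delta>\<^bsub>X\<^esub> x) (\<lambda>x1 x2. tsum (\<Delta>\<^bsub>H\<^esub> y) (\<lambda>y1 y2. F x1 y1 \<cdot>\<^bsub>N\<^esub> G x2 y2))"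
      "Wa x y = tsum (\<Delta>\<^bsub>X\<^esub> x) (\<lambda>x1 x2. tsum (\<rho> x1) (\<lambda>h k. tsum (\<rho> y) (\<lambda>p q.
        inH (h \<cdot>\<^bsub>H\<^esub> p) \<otimes>\<^sub>\<complex> inA (k \<cdot>\<^bsub>A\<^esub> act x2 q))))" for F G x y
      by (simp_all add: conv2_def Wa_def X_def)
    then show ?thesis
      by (simp add: Ca_def N_pushes inA_inA A.mult_assoc X.coassoc_lin
        tsum_commute[of "\<Delta>\<^bsub>H\<^esub> u" "\<Delta>\<^bsub>X\<^esub> v" for u v])
  qed
  ultimately show "conv2 H H N Wa Ca x y = conv2 H H N Ca (\<lambda>x y. Rh (x \<cdot>\<^bsub>H\<^esub> y)) x y"
    by (simp add: conv2_def[of _ _ _ Ca] Ca_def Rh_def N_pushes inA_inA X_def)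
qed

lemma Jh_Jh: "conv2 H H N (ext1 H Jh) (ext2 H Jh) = conv2 H H N Ca (\<lambda>x y. Jh (x \<cdot>\<^bsub>H\<^esub> y))"
  by (intro ext) (simp add: HHN.conv2_ext1_ext2, simp add: conv2_def Jh_def Ca_def N_pure inH_inH pure_tsum)

text \<open>Comultiplicativity of \<open>\<rho>\<close> splits the coproducts of both coaction
  components, and \<open>act_mult\<close> splits the action on a product; \<open>act_\<rho>\<close>
  then interchanges the two middle factors, so that the sum separates into \<open>Va\<close> and
  \<open>Wa\<close>.\<close>

lemma Rh_Ua: "conv2 H H N (ext1 H Rh) Ua = conv2 H H N Va Wa"
proof (intro ext)
  fix x y
  \<comment> \<open>Distinct names for the data attached to \<open>x\<close> and to \<open>y\<close>
    let ordered rewriting bring the two groups of sums into a fixed order.\<close>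
  define X Y \<rho>' where XY: "X = H" "Y = H" "\<rho>' = \<rho>"
  interpret X: ccoalgebra X by (simp add: XY H.ccoalgebra)
  interpret Y: ccoalgebra Y by (simp add: XY H.ccoalgebra)
  have lin [simp]: "semilin \<sigma> f \<Longrightarrow> semilin \<sigma> (\<lambda>x. \<rho>' (f x))" for \<sigma> and f :: "'z::complex_vector \<Rightarrow> 'h"
    by (simp add: XY)
  note com = tsum_commute[of "\<Delta>\<^bsub>Y\<^esub> u" "\<Delta>\<^bsub>X\<^esub> v" for u v] tsum_commute[of "\<rho> u" "\<Delta>\<^bsub>X\<^esub> v" for u v]
    tsum_commute[of "\<rho> u" "\<Delta>\<^bsub>Y\<^esub> v" for u v] tsum_commute[of "\<rho>' u" "\<Delta>\<^bsub>X\<^esub> v" for u v]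
    tsum_commute[of "\<rho>' u" "\<Delta>\<^bsub>Y\<^esub> v" for u v] tsum_commute[of "\<rho>' u" "\<rho> v" for u v]
  note norm = X.coassoc_lin X.coassoc2 X.coassoc3 Y.coassoc_lin Y.coassoc2 com A.mu_tsum pure_tsum A.mult_assoc
  have act_mult': "act x (a \<cdot>\<^bsub>A\<^esub> b) = tsum (\<Delta>\<^bsub>X\<^esub> x) (\<lambda>x1 x2. act x1 a \<cdot>\<^bsub>A\<^esub> act x2 b)" for x a b
    by (simp add: act_mult sweedler2_def XY)
  have "conv2 H H N (ext1 H Rh) Ua x y = tsum (\<Delta>\<^bsub>H\<^esub> x) (\<lambda>x1 x2. tsum (\<rho> x1) (\<lambda>h k.
      tsum (\<Delta>\<^bsub>H\<^esub> h) (\<lambda>h1 h2. tsum (\<rho> y) (\<lambda>p q. tsum (\<Delta>\<^bsub>H\<^esub> p) (\<lambda>p1 p2.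
        (inA (\<chi> h1 p1) \<cdot>\<^bsub>M\<^esub> inH (h2 \<cdot>\<^bsub>H\<^esub> p2)) \<otimes>\<^sub>\<complex> inA (k \<cdot>\<^bsub>A\<^esub> act x2 q))))))"
    by (simp add: HHN.conv2_ext1_left Rh_def Ua_def N_pushes inA_inA inH_inH pure_tsum
      tsum_commute[of "\<rho> y" "\<Delta>\<^bsub>H\<^esub> v" for v])
  also have "\<dots> = tsum (\<Delta>\<^bsub>X\<^esub> x) (\<lambda>x1 x2. tsum (\<Delta>\<^bsub>X\<^esub> x1) (\<lambda>u v. tsum (\<rho> u) (\<lambda>h k. tsum (\<rho> v) (\<lambda>h' k'.
      tsum (\<Delta>\<^bsub>Y\<^esub> y) (\<lambda>y1 y2. tsum (\<rho>' y1) (\<lambda>p q. tsum (\<rho>' y2) (\<lambda>p' q'.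
        (inA (\<chi> h p) \<cdot>\<^bsub>M\<^esub> inH (h' \<cdot>\<^bsub>H\<^esub> p')) \<otimes>\<^sub>\<complex> inA (k \<cdot>\<^bsub>A\<^esub> k' \<cdot>\<^bsub>A\<^esub> act x2 (q \<cdot>\<^bsub>A\<^esub> q')))))))))"
    by (simp add: \<rho>_comult_lift[of id] XY)
  also have "\<dots> = tsum (\<Delta>\<^bsub>X\<^esub> x) (\<lambda>x1 r. tsum (\<Delta>\<^bsub>X\<^esub> r) (\<lambda>w x4. tsum (\<Delta>\<^bsub>Y\<^esub> y) (\<lambda>y1 y2. tsum (\<rho> x1) (\<lambda>h k.
      tsum (\<rho>' y1) (\<lambda>p q. tsum (\<rho>' y2) (\<lambda>p' q'. tsum (\<Delta>\<^bsub>X\<^esub> w) (\<lambda>x2 x3. tsum (\<rho> x2) (\<lambda>h' k'.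
        (inA (\<chi> h p) \<cdot>\<^bsub>M\<^esub> inH (h' \<cdot>\<^bsub>H\<^esub> p')) \<otimes>\<^sub>\<complex> inA (k \<cdot>\<^bsub>A\<^esub> (k' \<cdot>\<^bsub>A\<^esub> act x3 q) \<cdot>\<^bsub>A\<^esub> act x4 q')))))))))"
    by (simp add: act_mult' inA_tsum norm)
  \<comment> \<open>Compatibility of action and coaction is applied inside the sum over
    \<open>w\<close>.\<close>
  also have "\<dots> = tsum (\<Delta>\<^bsub>X\<^esub> x) (\<lambda>x1 r. tsum (\<Delta>\<^bsub>X\<^esub> r) (\<lambda>w x4. tsum (\<Delta>\<^bsub>Y\<^esub> y) (\<lambda>y1 y2. tsum (\<rho> x1) (\<lambda>h k.
      tsum (\<rho>' y1) (\<lambda>p q. tsum (\<rho>' y2) (\<lambda>p' q'. tsum (\<Delta>\<^bsub>X\<^esub> w) (\<lambda>x2 x3. tsum (\<rho> x3) (\<lambda>h' k'.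
        (inA (\<chi> h p) \<cdot>\<^bsub>M\<^esub> inH (h' \<cdot>\<^bsub>H\<^esub> p')) \<otimes>\<^sub>\<complex> inA (k \<cdot>\<^bsub>A\<^esub> (act x2 q \<cdot>\<^bsub>A\<^esub> k') \<cdot>\<^bsub>A\<^esub> act x4 q')))))))))"
  proof -
    have "tsum (\<Delta>\<^bsub>H\<^esub> w) (\<lambda>x2 x3. tsum (\<rho> x3) (\<lambda>h' k'.
        (C \<cdot>\<^bsub>M\<^esub> inH (h' \<cdot>\<^bsub>H\<^esub> p)) \<otimes>\<^sub>\<complex> inA (k \<cdot>\<^bsub>A\<^esub> (act x2 q \<cdot>\<^bsub>A\<^esub> k') \<cdot>\<^bsub>A\<^esub> d)))
      = tsum (\<Delta>\<^bsub>H\<^esub> w) (\<lambda>x2 x3. tsum (\<rho> x2) (\<lambda>h' k'.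
        (C \<cdot>\<^bsub>M\<^esub> inH (h' \<cdot>\<^bsub>H\<^esub> p)) \<otimes>\<^sub>\<complex> inA (k \<cdot>\<^bsub>A\<^esub> (k' \<cdot>\<^bsub>A\<^esub> act x3 q) \<cdot>\<^bsub>A\<^esub> d)))" for w C p k q d
      by (rule act_\<rho>_lift[of "\<lambda>h' z. (C \<cdot>\<^bsub>M\<^esub> inH (h' \<cdot>\<^bsub>H\<^esub> p)) \<otimes>\<^sub>\<complex> inA (k \<cdot>\<^bsub>A\<^esub> z \<cdot>\<^bsub>A\<^esub> d)"]) simp_all
    then show ?thesis by (simp add: XY)
  qed
  also have "\<dots> = conv2 H H N Va Wa x y"
  proof -
    have Va': "Va x y = tsum (\<Delta>\<^bsub>X\<^esub> x) (\<lambda>x1 x2. tsum (\<rho> x1) (\<lambda>h k. tsum (\<rho>' y) (\<lambda>p q.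
      inA (\<chi> h p) \<otimes>\<^sub>\<complex> inA (k \<cdot>\<^bsub>A\<^esub> act x2 q))))" for x y
      by (simp add: Va_def XY)
    have Wa': "Wa x y = tsum (\<Delta>\<^bsub>X\<^esub> x) (\<lambda>x1 x2. tsum (\<rho> x1) (\<lambda>h k. tsum (\<rho>' y) (\<lambda>p q.
      inH (h \<cdot>\<^bsub>H\<^esub> p) \<otimes>\<^sub>\<complex> inA (k \<cdot>\<^bsub>A\<^esub> act x2 q))))" for x y
      by (simp add: Wa_def XY)
    have conv2': "conv2 H H N F G x y = tsum (\<Delta>\<^bsub>X\<^esub> x) (\<lambda>x1 x2. tsum (\<Delta>\<^bsub>Y\<^esub> y) (\<lambda>y1 y2. F x1 y1 \<cdot>\<^bsub>N\<^esub> G x2 y2))" for F G x y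
      by (simp add: conv2_def XY)
    show ?thesis
      by (simp add: conv2' Va' Wa' N_pushes norm inA_inA)
  qed
  finally show "conv2 H H N (ext1 H Rh) Ua x y = conv2 H H N Va Wa x y" .
qed


text \<open>The right side of the axiom \<open>\<chi>_\<psi>\<close> factors into four convolution
  factors, which are the ones that the exchange relations produce.\<close>

lemma Ch_Ps: "conv2 H H N (\<lambda>x y. Dl (\<chi> x y)) (\<lambda>x y. Ps (x \<cdot>\<^bsub>H\<^esub> y))
  = conv2 H H N (ext1 H Ps) (conv2 H H N Qa (conv2 H H N Va Ca))"
proof (intro ext)
  fix x y
  define X Y \<rho>' \<psi>' where XY: "X = H" "Y = H" "\<rho>' = \<rho>" "\<psi>' = \<psi>"
  interpret X: ccoalgebra X by (simp add: XY H.ccoalgebra)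
  interpret Y: ccoalgebra Y by (simp add: XY H.ccoalgebra)
  have lin [simp]: "semilin \<sigma> f \<Longrightarrow> semilin \<sigma> (\<lambda>x. \<rho>' (f x))" "semilin \<sigma> f \<Longrightarrow> semilin \<sigma> (\<lambda>x. \<psi>' (f x))"
    for \<sigma> and f :: "'z::complex_vector \<Rightarrow> 'h"
    by (simp_all add: XY)
  note com = tsum_commute[of "\<Delta>\<^bsub>Y\<^esub> u" "\<Delta>\<^bsub>X\<^esub> v" for u v] tsum_commute[of "\<rho> u" "\<Delta>\<^bsub>X\<^esub> v" for u v]
    tsum_commute[of "\<rho> u" "\<Delta>\<^bsub>Y\<^esub> v" for u v] tsum_commute[of "\<rho>' u" "\<Delta>\<^bsub>X\<^esub> v" for u v]
    tsum_commute[of "\<rho>' u" "\<Delta>\<^bsub>Y\<^esub> v" for u v] tsum_commute[of "\<rho>' u" "\<rho> v" for u v]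
    tsum_commute[of "\<psi> u" "\<Delta>\<^bsub>X\<^esub> v" for u v] tsum_commute[of "\<psi> u" "\<Delta>\<^bsub>Y\<^esub> v" for u v]
    tsum_commute[of "\<psi>' u" "\<Delta>\<^bsub>X\<^esub> v" for u v] tsum_commute[of "\<psi>' u" "\<Delta>\<^bsub>Y\<^esub> v" for u v]
    tsum_commute[of "\<rho> u" "\<psi> v" for u v] tsum_commute[of "\<rho>' u" "\<psi> v" for u v]
    tsum_commute[of "\<rho> u" "\<psi>' v" for u v] tsum_commute[of "\<rho>' u" "\<psi>' v" for u v]
    tsum_commute[of "\<psi>' u" "\<psi> v" for u v]
  note norm = X.coassoc_lin X.coassoc2 X.coassoc3 Y.coassoc_lin Y.coassoc2 com N_pushes inA_inA A.mult_assoc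
  have R: "Ps x = tsum (\<psi> x) (\<lambda>u v. inA u \<otimes>\<^sub>\<complex> inA v)"
    "Qa x y = tsum (\<psi>' y) (\<lambda>u v. tsum (\<Delta>\<^bsub>X\<^esub> x) (\<lambda>x1 x2. Rp u x1 \<cdot>\<^bsub>N\<^esub> Ka v x2))"
    "Va x y = tsum (\<Delta>\<^bsub>X\<^esub> x) (\<lambda>x1 x2. tsum (\<rho> x1) (\<lambda>h k. tsum (\<rho>' y) (\<lambda>p q.
      inA (\<chi> h p) \<otimes>\<^sub>\<complex> inA (k \<cdot>\<^bsub>A\<^esub> act x2 q))))"
    "conv2 H H N F G x y = tsum (\<Delta>\<^bsub>X\<^esub> x) (\<lambda>x1 x2. tsum (\<Delta>\<^bsub>Y\<^esub> y) (\<lambda>y1 y2. F x1 y1 \<cdot>\<^bsub>N\<^esub> G x2 y2))" for F G x y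
    by (simp_all add: Ps_def Qa_def Va_def conv2_def conv_def XY)
  have "conv2 H H N (\<lambda>x y. Dl (\<chi> x y)) (\<lambda>x y. Ps (x \<cdot>\<^bsub>H\<^esub> y)) x y
    = tsum (\<Delta>\<^bsub>H\<^esub> x) (\<lambda>x1 x2. tsum (\<Delta>\<^bsub>H\<^esub> y) (\<lambda>y1 y2. tsum (\<Delta>\<^bsub>A\<^esub> (\<chi> x1 y1)) (\<lambda>c1 c2.
        tsum (\<psi> (x2 \<cdot>\<^bsub>H\<^esub> y2)) (\<lambda>u v. inA (c1 \<cdot>\<^bsub>A\<^esub> u) \<otimes>\<^sub>\<complex> inA (c2 \<cdot>\<^bsub>A\<^esub> v)))))"
    by (simp add: conv2_def Dl_def Ps_def N_pushes inA_inA)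
  also have "\<dots> = tsum (\<Delta>\<^bsub>X\<^esub> x) (\<lambda>x1 r1. tsum (\<Delta>\<^bsub>X\<^esub> r1) (\<lambda>x2 r2. tsum (\<Delta>\<^bsub>X\<^esub> r2) (\<lambda>x3 r3.
         tsum (\<Delta>\<^bsub>X\<^esub> r3) (\<lambda>x4 r4. tsum (\<Delta>\<^bsub>X\<^esub> r4) (\<lambda>x5 x6.
         tsum (\<Delta>\<^bsub>Y\<^esub> y) (\<lambda>y1 s. tsum (\<Delta>\<^bsub>Y\<^esub> s) (\<lambda>y2 y3.
         tsum (\<psi> x1) (\<lambda>u v. tsum (\<rho> x2) (\<lambda>h k. tsum (\<rho> x4) (\<lambda>h' k'.
         tsum (\<psi>' y1) (\<lambda>u' v'. tsum (\<rho>' y2) (\<lambda>p q.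
           inA (u \<cdot>\<^bsub>A\<^esub> act h u' \<cdot>\<^bsub>A\<^esub> \<chi> h' p) \<otimes>\<^sub>\<complex>
           inA (v \<cdot>\<^bsub>A\<^esub> k \<cdot>\<^bsub>A\<^esub> act x3 v' \<cdot>\<^bsub>A\<^esub> k' \<cdot>\<^bsub>A\<^esub> act x5 q \<cdot>\<^bsub>A\<^esub> \<chi> x6 y3)))))))))))))"
    unfolding XY by (rule \<chi>_\<psi>_lift) simp_all
  also have "\<dots> = tsum (\<Delta>\<^bsub>X\<^esub> x) (\<lambda>x1 r. Ps x1 \<cdot>\<^bsub>N\<^esub> conv2 H H N Qa (conv2 H H N Va Ca) r y)"
    by (simp add: R Rp_def Ka_def Ca_def norm)
  finally show "conv2 H H N (\<lambda>x y. Dl (\<chi> x y)) (\<lambda>x y. Ps (x \<cdot>\<^bsub>H\<^esub> y)) x y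
      = conv2 H H N (ext1 H Ps) (conv2 H H N Qa (conv2 H H N Va Ca)) x y"
    by (simp add: HHN.conv2_ext1_left XY)
qed

text \<open>Products are kept nested to the right, so an exchange relation must also be available in
  front of a remaining factor \<open>K\<close>.\<close>

lemma conv2_shift:
  assumes "conv2 H H N F G = conv2 H H N G' F'"
    and "\<And>y. semilin id (\<lambda>x. F x y)" "\<And>x. semilin id (F x)" "\<And>y. semilin id (\<lambda>x. G x y)" "\<And>x. semilin id (G x)"
    and "\<And>y. semilin id (\<lambda>x. F' x y)" "\<And>x. semilin id (F' x)" "\<And>y. semilin id (\<lambda>x. G' x y)" "\<And>x. semilin id (G' x)"
    and "\<And>y. semilin id (\<lambda>x. K x y)" "\<And>x. semilin id (K x)"
  shows "conv2 H H N F (conv2 H H N G K) = conv2 H H N G' (conv2 H H N F' K)"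
  using assms(1) by (simp add: HHN.conv2_assoc[symmetric] assms(2-))

text \<open>Multiplicativity of the coproduct of \<open>H\<close> makes composition with its
  multiplication a homomorphism of convolution algebras.\<close>

lemma conv_mult: "semilin id f \<Longrightarrow> semilin id g \<Longrightarrow>
    (\<lambda>x y. conv H N f g (x \<cdot>\<^bsub>H\<^esub> y)) = conv2 H H N (\<lambda>x y. f (x \<cdot>\<^bsub>H\<^esub> y)) (\<lambda>x y. g (x \<cdot>\<^bsub>H\<^esub> y))"
  by (intro ext)
    (simp add: conv_def conv2_def H.tsum_Delta_mult[of id] semilin_lin_compose[of f] semilin_lin_compose[of g])

lemma Dj_Dj: "Dj x \<cdot>\<^bsub>N\<^esub> Dj y = tsum (\<Delta>\<^bsub>H\<^esub> x) (\<lambda>x1 x2. tsum (\<Delta>\<^bsub>H\<^esub> y) (\<lambda>y1 y2.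
    Dl (\<chi> x1 y1) \<cdot>\<^bsub>N\<^esub> Dj (x2 \<cdot>\<^bsub>H\<^esub> y2)))"
proof -
  note [simp] = HHN.conv2_assoc
  note shift = Jh_Ps Rh_Pa Jh_Rh Rh_Ua Jh_Jh Wa_Ca
  note shift' = shift[THEN conv2_shift]
  \<comment> \<open>The factors \<open>Ps\<close>, \<open>Rh\<close>, \<open>Jh\<close> at
    \<open>x\<close> followed by those at \<open>y\<close> are sorted by the exchange relations,
    which leaves \<open>Rh\<close> and \<open>Jh\<close> at the product of the arguments.\<close>
  have "conv2 H H N (ext1 H Dj) (ext2 H Dj) = conv2 H H N (ext1 H Ps) (conv2 H H N Qa (conv2 H H N Va (conv2 H H N Ca
    (conv2 H H N (\<lambda>x y. Rh (x \<cdot>\<^bsub>H\<^esub> y)) (\<lambda>x y. Jh (x \<cdot>\<^bsub>H\<^esub> y))))))"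
    by (simp add: Dj_def HHN.ext1_conv HHN.ext2_conv shift shift')
  \<comment> \<open>The first four factors are the right side of \<open>Ch_Ps\<close>.\<close>
  also have "\<dots> = conv2 H H N (conv2 H H N (\<lambda>x y. Dl (\<chi> x y)) (\<lambda>x y. Ps (x \<cdot>\<^bsub>H\<^esub> y)))
    (conv2 H H N (\<lambda>x y. Rh (x \<cdot>\<^bsub>H\<^esub> y)) (\<lambda>x y. Jh (x \<cdot>\<^bsub>H\<^esub> y)))"
    unfolding Ch_Ps by simp
  also have "\<dots> = conv2 H H N (\<lambda>x y. Dl (\<chi> x y)) (\<lambda>x y. Dj (x \<cdot>\<^bsub>H\<^esub> y))"
    by (simp add: Dj_def conv_mult)
  finally show ?thesis
    using HHN.conv2_ext1_ext2[of Dj Dj x y] by (simp add: conv2_def)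
qed

lemma Dj_pure: "Dj x = tsum (\<Delta>\<^bsub>H\<^esub> x) (\<lambda>x1 r. tsum (\<Delta>\<^bsub>H\<^esub> r) (\<lambda>x2 x3.
    tsum (\<psi> x1) (\<lambda>u v. tsum (\<rho> x2) (\<lambda>h k. (u \<otimes>\<^sub>\<complex> h) \<otimes>\<^sub>\<complex> ((v \<cdot>\<^bsub>A\<^esub> k) \<otimes>\<^sub>\<complex> x3)))))"
  by (simp only: Dj_def conv_def Ps_def Rh_def Jh_def N.mu_tsum(1) N_pure_tsum N_pure M.mult_one M.one_mult com_H
      inA_M inH_def L_pure A.mult_one)

text \<open>Identifies the coproduct of \<open>M\<close> with the extension of \<open>Dl\<close> and
  \<open>Dj\<close> to which \<open>cross_hom_mult\<close> applies.\<close>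

lemma Delta_M: "\<Delta>\<^bsub>M\<^esub> t = tsum t (\<lambda>a x. Dl a \<cdot>\<^bsub>N\<^esub> Dj x)"
  by (simp only: Dj_pure cocycle_bismash_simps(3) Dl_def N.mu_tsum(1) N_pure_tsum N_pure inA_M L_pure A.mult_assoc)

lemma Delta_M_mult: "\<Delta>\<^bsub>M\<^esub> (s \<cdot>\<^bsub>M\<^esub> t) = \<Delta>\<^bsub>M\<^esub> s \<cdot>\<^bsub>N\<^esub> \<Delta>\<^bsub>M\<^esub> t"
  unfolding Delta_M
  by (rule cross_hom_mult[OF calgebra_N semilin_defs(1)[OF semilin_ident] semilin_defs_eta(4)])
    (rule Dl_mult Dj_Dl Dj_Dj)+

end

section \<open>The cocycle bismash product is a bialgebra\<close>

text \<open>The scalars as an algebra, so that multiplicativity of the counit becomes an instance of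
  \<open>cross_hom_mult\<close>.\<close>

definition complex_alg :: "complex bialg"
  where "complex_alg = \<lparr>mu = (*), unt = 1, Delta = (\<lambda>z. z \<otimes>\<^sub>\<complex> 1), eps = (\<lambda>z. z)\<rparr>"

lemma complex_alg_simps [simp]: "mu complex_alg = (*)" "unt complex_alg = 1"
  by (simp_all add: complex_alg_def)

lemma calgebra_complex: "calgebra complex_alg"
  by unfold_locales simp_all

context cocycle_linked_pair
begin

lemma eps_M: "\<epsilon>\<^bsub>M\<^esub> t = tsum t (\<lambda>a x. \<epsilon>\<^bsub>A\<^esub> a * \<epsilon>\<^bsub>H\<^esub> x)"
  by (rule cocycle_bismash_simps)

lemma semilin_eps_M [simp]: "semilin \<sigma> f \<Longrightarrow> semilin \<sigma> (\<lambda>x. \<epsilon>\<^bsub>M\<^esub> (f x))"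
  by (simp add: eps_M)

lemma semilin_Delta_M [simp]: "semilin \<sigma> f \<Longrightarrow> semilin \<sigma> (\<lambda>x. \<Delta>\<^bsub>M\<^esub> (f x))"
  by (simp add: Delta_M)

lemma eps_M_mult: "\<epsilon>\<^bsub>M\<^esub> (s \<cdot>\<^bsub>M\<^esub> t) = \<epsilon>\<^bsub>M\<^esub> s * \<epsilon>\<^bsub>M\<^esub> t"
proof -
  have *: "tsum (\<Delta>\<^bsub>H\<^esub> y) (\<lambda>y1 y2. \<epsilon>\<^bsub>H\<^esub> x1 * \<epsilon>\<^bsub>H\<^esub> y1 * (\<epsilon>\<^bsub>H\<^esub> x2 * \<epsilon>\<^bsub>H\<^esub> y2)) = \<epsilon>\<^bsub>H\<^esub> x1 * (\<epsilon>\<^bsub>H\<^esub> x2 * \<epsilon>\<^bsub>H\<^esub> y)" for x1 x2 y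
    using H.counit_mult[of "\<lambda>y. \<epsilon>\<^bsub>H\<^esub> x1 * (\<epsilon>\<^bsub>H\<^esub> x2 * \<epsilon>\<^bsub>H\<^esub> y)" y] by (simp add: mult_ac)
  show ?thesis
    using cross_hom_mult[OF calgebra_complex A.eps_lin H.eps_lin, of s t]
    by (simp add: eps_M H.counit_mult * mult.assoc[of _ "\<epsilon>\<^bsub>A\<^esub> _" "\<epsilon>\<^bsub>H\<^esub> _"])
qed

lemma Dj_one [simp]: "Dj \<^bold>1\<^bsub>H\<^esub> = \<^bold>1\<^bsub>N\<^esub>"
  by (simp add: Dj_def conv_def Ps_def Rh_def Jh_def tensor_bialg_simps(1) N_pure)

lemma Dl_one [simp]: "Dl \<^bold>1\<^bsub>A\<^esub> = \<^bold>1\<^bsub>N\<^esub>"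
  by (simp add: Dl_def tensor_bialg_simps(1))

lemma Delta_M_pure: "\<Delta>\<^bsub>M\<^esub> (a \<otimes>\<^sub>\<complex> x) = Dl a \<cdot>\<^bsub>N\<^esub> Dj x"
  by (simp add: Delta_M)

lemma Delta_inA [simp]: "\<Delta>\<^bsub>M\<^esub> (inA a) = Dl a" and Delta_inH [simp]: "\<Delta>\<^bsub>M\<^esub> (inH x) = Dj x"
  by (simp_all add: inA_def inH_def Delta_M_pure)

lemma eps_inA [simp]: "\<epsilon>\<^bsub>M\<^esub> (inA a) = \<epsilon>\<^bsub>A\<^esub> a" and eps_inH [simp]: "\<epsilon>\<^bsub>M\<^esub> (inH x) = \<epsilon>\<^bsub>H\<^esub> x"
  by (simp_all add: inA_def inH_def eps_M)

lemma tsum_inA_inH: "tsum t (\<lambda>a x. inA a \<cdot>\<^bsub>M\<^esub> inH x) = t"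
  by (simp add: inA_inH tsum_eta)

text \<open>Algebra maps out of \<open>N\<close> carry convolution products to convolution products,
  so the counit laws and coassociativity can be tested on the factors of \<open>Dj\<close>.\<close>

lemma hom_conv:
  assumes "\<And>s t. g (s \<cdot>\<^bsub>N\<^esub> t) = g s \<cdot>\<^bsub>B\<^esub> g t" "semilin id g"
  shows "g (conv H N e f x) = conv H B (\<lambda>x. g (e x)) (\<lambda>x. g (f x)) x"
  by (simp add: conv_def semilin_image_tsum[OF assms(2)] assms(1))

text \<open>The map \<open>\<epsilon> \<otimes> id\<close> is multiplicative and sends
  \<open>Ps\<close> and \<open>Rh\<close> to convolution units, so only the factor \<open>Jh\<close>
  of \<open>Dj x\<close> survives.\<close>

lemma M_counit_left: "tsum (\<Delta>\<^bsub>M\<^esub> t) (\<lambda>m n. \<epsilon>\<^bsub>M\<^esub> m *\<^sub>C n) = t"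
proof -
  interpret HM: convolution H M ..
  define g where "g s = tsum s (\<lambda>m n. \<epsilon>\<^bsub>M\<^esub> m *\<^sub>C n)" for s :: "('a \<otimes>\<^sub>\<complex> 'h) \<otimes>\<^sub>\<complex> ('a \<otimes>\<^sub>\<complex> 'h)"
  have lin: "semilin id g" unfolding g_def by simp
  have mult: "g (s \<cdot>\<^bsub>N\<^esub> t) = g s \<cdot>\<^bsub>M\<^esub> g t" for s t
    unfolding g_def by (rule tensor_hom_mult[of _ _ _ id]) (simp_all add: calgebra_M eps_M_mult scaleC_scaleC)
  have "g (Ps x) = \<epsilon>\<^bsub>H\<^esub> x *\<^sub>C \<^bold>1\<^bsub>M\<^esub>" for x
    using arg_cong[OF \<psi>_counit_left[of x], of inA] by (simp add: g_def Ps_def tsum_tsum_lin inA_tsum)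
  moreover have "g (Rh x) = \<epsilon>\<^bsub>H\<^esub> x *\<^sub>C \<^bold>1\<^bsub>M\<^esub>" for x
    using arg_cong[OF \<rho>_counit_left[of x], of inA] by (simp add: g_def Rh_def tsum_tsum_lin inA_tsum)
  moreover have "g (Jh x) = inH x" for x
    using eps_inA[of "\<^bold>1\<^bsub>A\<^esub>"] by (simp add: g_def Jh_def del: eps_inA)
  moreover have "g (Dl a) = inA a" for a
    by (simp add: g_def Dl_def tsum_tsum_lin A.counit_lin)
  ultimately have "g (Dl a \<cdot>\<^bsub>N\<^esub> Dj x) = inA a \<cdot>\<^bsub>M\<^esub> inH x" for a x
    by (simp add: mult Dj_def hom_conv[of g, OF mult lin]) (simp add: conv_def H.counit_lin)
  then have "g (\<Delta>\<^bsub>M\<^esub> t) = t"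
    by (simp add: Delta_M semilin_image_tsum[OF lin] tsum_inA_inH)
  then show ?thesis by (simp add: g_def)
qed

text \<open>Under \<open>id \<otimes> \<epsilon>\<close> the factors \<open>Ps\<close> and
  \<open>Jh\<close> become convolution units and \<open>Rh\<close> gives \<open>inH\<close>.\<close>

lemma M_counit_right: "tsum (\<Delta>\<^bsub>M\<^esub> t) (\<lambda>m n. \<epsilon>\<^bsub>M\<^esub> n *\<^sub>C m) = t"
proof -
  interpret HM: convolution H M ..
  define g where "g s = tsum s (\<lambda>m n. \<epsilon>\<^bsub>M\<^esub> n *\<^sub>C m)" for s :: "('a \<otimes>\<^sub>\<complex> 'h) \<otimes>\<^sub>\<complex> ('a \<otimes>\<^sub>\<complex> 'h)"
  have lin: "semilin id g" unfolding g_def by simp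
  have mult: "g (s \<cdot>\<^bsub>N\<^esub> t) = g s \<cdot>\<^bsub>M\<^esub> g t" for s t
    unfolding g_def by (rule tensor_hom_mult[of _ _ _ id]) (simp_all add: calgebra_M eps_M_mult scaleC_scaleC)
  have "g (Ps x) = \<epsilon>\<^bsub>H\<^esub> x *\<^sub>C \<^bold>1\<^bsub>M\<^esub>" for x
    using arg_cong[OF \<psi>_counit_right[of x], of inA] by (simp add: g_def Ps_def tsum_tsum_lin inA_tsum)
  moreover have "g (Rh x) = inH x" for x
    using arg_cong[OF \<rho>_counit_right[of x], of inH] by (simp add: g_def Rh_def tsum_tsum_lin inH_tsum)
  moreover have "g (Jh x) = \<epsilon>\<^bsub>H\<^esub> x *\<^sub>C \<^bold>1\<^bsub>M\<^esub>" for x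
    by (simp add: g_def Jh_def)
  moreover have "g (Dl a) = inA a" for a
    by (simp add: g_def Dl_def tsum_tsum_lin A.counit_lin)
  ultimately have "g (Dl a \<cdot>\<^bsub>N\<^esub> Dj x) = inA a \<cdot>\<^bsub>M\<^esub> inH x" for a x
    by (simp add: mult Dj_def hom_conv[of g, OF mult lin]) (simp add: conv_def H.counit_lin)
  then have "g (\<Delta>\<^bsub>M\<^esub> t) = t"
    by (simp add: Delta_M semilin_image_tsum[OF lin] tsum_inA_inH)
  then show ?thesis by (simp add: g_def)
qed

lemma M_coassoc:
  "tsum (\<Delta>\<^bsub>M\<^esub> t) (\<lambda>m n. tsum (\<Delta>\<^bsub>M\<^esub> m) (\<lambda>u v. u \<otimes>\<^sub>\<complex> v \<otimes>\<^sub>\<complex> n))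
      = tsum (\<Delta>\<^bsub>M\<^esub> t) (\<lambda>m n. tsum (\<Delta>\<^bsub>M\<^esub> n) (\<lambda>u v. m \<otimes>\<^sub>\<complex> u \<otimes>\<^sub>\<complex> v))"
proof -
  let ?N3 = "tensor_bialg M N"
  have N3: "calgebra ?N3"
    by (rule calgebra_tensor) unfold_locales
  interpret N3: calgebra ?N3 by (rule N3)
  interpret HN3: convolution H ?N3 ..
  have N3_pure: "(a \<otimes>\<^sub>\<complex> b) \<cdot>\<^bsub>?N3\<^esub> (a' \<otimes>\<^sub>\<complex> b') = (a \<cdot>\<^bsub>M\<^esub> a') \<otimes>\<^sub>\<complex> (b \<cdot>\<^bsub>N\<^esub> b')" for a b a' b'
    by (rule mu_tensor_pure) unfold_locales
  have N3_pure_tsum: "(a \<otimes>\<^sub>\<complex> b) \<cdot>\<^bsub>?N3\<^esub> tsum t f = tsum t (\<lambda>u v. (a \<otimes>\<^sub>\<complex> b) \<cdot>\<^bsub>?N3\<^esub> f u v)" for a b f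
    and t :: "'y::complex_vector \<otimes>\<^sub>\<complex> 'z::complex_vector"
    by (rule N3.mu_tsum)
  note N3s = N3.mu_tsum(1) N3_pure_tsum N3_pure N_pure inA_inA
  \<comment> \<open>\<open>g1\<close> and \<open>g2\<close> are \<open>\<Delta> \<otimes> id\<close>
    and \<open>id \<otimes> \<Delta>\<close>, up to the bracketing of triple tensors. Both are
    algebra maps, so they are compared on \<open>Dl\<close> and \<open>Dj\<close>.\<close>
  define g1 where "g1 s = tsum s (\<lambda>m n. tsum (\<Delta>\<^bsub>M\<^esub> m) (\<lambda>u v. u \<otimes>\<^sub>\<complex> v \<otimes>\<^sub>\<complex> n))" for s :: "('a \<otimes>\<^sub>\<complex> 'h) \<otimes>\<^sub>\<complex> ('a \<otimes>\<^sub>\<complex> 'h)"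
  define g2 where "g2 s = tsum s (\<lambda>m n. m \<otimes>\<^sub>\<complex> \<Delta>\<^bsub>M\<^esub> n)" for s :: "('a \<otimes>\<^sub>\<complex> 'h) \<otimes>\<^sub>\<complex> ('a \<otimes>\<^sub>\<complex> 'h)"
  define attach where "attach s k = tsum s (\<lambda>m n. m \<otimes>\<^sub>\<complex> n \<otimes>\<^sub>\<complex> inA k)" for s :: "('a \<otimes>\<^sub>\<complex> 'h) \<otimes>\<^sub>\<complex> ('a \<otimes>\<^sub>\<complex> 'h)" and k
  have lin: "semilin id g1" "semilin id g2" unfolding g1_def g2_def by simp_all
  have lin_attach: "semilin id f \<Longrightarrow> semilin id (\<lambda>x. attach (f x) k)" "semilin id (\<lambda>k. attach s k)"
    for s k and f :: "'z::complex_vector \<Rightarrow> _"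
    unfolding attach_def by simp_all
  have tsum_mult: "tsum (s \<cdot>\<^bsub>N\<^esub> t) (\<lambda>u v. u \<otimes>\<^sub>\<complex> v \<otimes>\<^sub>\<complex> (n \<cdot>\<^bsub>M\<^esub> n'))
    = tsum s (\<lambda>u v. u \<otimes>\<^sub>\<complex> v \<otimes>\<^sub>\<complex> n) \<cdot>\<^bsub>?N3\<^esub> tsum t (\<lambda>u v. u \<otimes>\<^sub>\<complex> v \<otimes>\<^sub>\<complex> n')" for s t n n'
    by (simp add: tensor_bialg_simps(2)[of M M] tsum_tsum_lin N3.mu_tsum(1))
      (simp add: N3s)
  have mult1: "g1 (s \<cdot>\<^bsub>N\<^esub> t) = g1 s \<cdot>\<^bsub>?N3\<^esub> g1 t" for s t
    unfolding g1_def by (rule tensor_hom_mult[of _ _ _ id]) (simp_all add: calgebra_M N3 Delta_M_mult tsum_mult)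
  have mult2: "g2 (s \<cdot>\<^bsub>N\<^esub> t) = g2 s \<cdot>\<^bsub>?N3\<^esub> g2 t" for s t
    unfolding g2_def by (rule tensor_hom_mult[of _ _ _ id]) (simp_all add: calgebra_M N3 Delta_M_mult N3_pure)
  have mult_attach: "attach (s \<cdot>\<^bsub>N\<^esub> t) (k \<cdot>\<^bsub>A\<^esub> k') = attach s k \<cdot>\<^bsub>?N3\<^esub> attach t k'" for s t k k'
    unfolding attach_def by (simp add: tsum_mult inA_inA[symmetric])
  \<comment> \<open>\<open>R E\<close> applies \<open>E\<close> to the first component of the
    coaction and appends the second component as a third leg; comultiplicativity of
    \<open>\<rho>\<close> makes it compatible with convolution.\<close>
  define R where "R E x = tsum (\<rho> x) (\<lambda>h k. attach (E h) k)" for E x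
  have R_lin [simp]: "semilin id E \<Longrightarrow> semilin id (R E)" for E
    unfolding R_def by (simp add: lin_attach semilin_lin_compose)
  have R_conv: "R (conv H N E E') = conv H ?N3 (R E) (R E')" if E: "semilin id E" "semilin id E'" for E E'
  proof
    fix x
    have 1: "attach (conv H N E E' h) k = tsum (\<Delta>\<^bsub>H\<^esub> h) (\<lambda>h1 h2. attach (E h1 \<cdot>\<^bsub>N\<^esub> E' h2) k)" for h k
      unfolding conv_def by (rule semilin_image_tsum[where h = "\<lambda>s. attach s k" and \<sigma> = id])
        (rule lin_attach(1)[OF semilin_ident])
    have "R (conv H N E E') x = tsum (\<rho> x) (\<lambda>h k. tsum (\<Delta>\<^bsub>H\<^esub> h) (\<lambda>h1 h2. attach (E h1 \<cdot>\<^bsub>N\<^esub> E' h2) k))"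
      by (simp add: R_def 1)
    also have "\<dots> = tsum (\<Delta>\<^bsub>H\<^esub> x) (\<lambda>x1 x2. tsum (\<rho> x1) (\<lambda>h k. tsum (\<rho> x2) (\<lambda>h' k'.
        attach (E h \<cdot>\<^bsub>N\<^esub> E' h') (k \<cdot>\<^bsub>A\<^esub> k'))))"
      by (rule \<rho>_comult_lift[of id]) (simp_all add: lin_attach semilin_lin_compose[OF E(1)] semilin_lin_compose[OF E(2)] E)
    also have "\<dots> = conv H ?N3 (R E) (R E') x"
      by (simp add: conv_def R_def mult_attach N3.mu_tsum(1)) (simp add: N3.mu_tsum(2))
    finally show "R (conv H N E E') x = conv H ?N3 (R E) (R E') x" .
  qed
  define e where "e s = \<^bold>1\<^bsub>M\<^esub> \<otimes>\<^sub>\<complex> s" for s :: "('a \<otimes>\<^sub>\<complex> 'h) \<otimes>\<^sub>\<complex> ('a \<otimes>\<^sub>\<complex> 'h)"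
  have e: "semilin id e" "e (s \<cdot>\<^bsub>N\<^esub> t) = e s \<cdot>\<^bsub>?N3\<^esub> e t" for s t
    unfolding e_def by (simp_all add: N3_pure)
  note comps [simp] = semilin_lin_compose[OF lin(1)] semilin_lin_compose[OF lin(2)] semilin_lin_compose[OF e(1)]
  have g1_Rh: "g1 (Rh x) = R Dj x" for x
    by (simp add: g1_def Rh_def tsum_tsum_lin R_def attach_def)
  have g1_Jh: "g1 (Jh x) = e (Jh x)" for x
    using Delta_inA[of "\<^bold>1\<^bsub>A\<^esub>"] by (simp add: g1_def Jh_def e_def tensor_bialg_simps(1) del: Delta_inA)
  have R_Jh: "R Jh x = e (Rh x)" for x
    by (simp add: R_def attach_def Jh_def e_def Rh_def pure_tsum)
  have g2_Jh: "g2 (Jh x) = e (Dj x)" for x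
    by (simp add: g2_def Jh_def e_def)
  \<comment> \<open>This is the cocycle condition on \<open>\<psi>\<close>, read in the convolution
    algebra.\<close>
  have 1: "conv H ?N3 (\<lambda>x. g1 (Ps x)) (R Ps) = conv H ?N3 (\<lambda>x. g2 (Ps x)) (\<lambda>x. e (Ps x))"
  proof
    fix x
    have "tsum (\<Delta>\<^bsub>H\<^esub> x) (\<lambda>x1 x2. tsum (\<psi> x1) (\<lambda>u v. tsum (\<Delta>\<^bsub>A\<^esub> u) (\<lambda>u1 u2.
         tsum (\<rho> x2) (\<lambda>h k. tsum (\<psi> h) (\<lambda>p q. inA (u1 \<cdot>\<^bsub>A\<^esub> p) \<otimes>\<^sub>\<complex> inA (u2 \<cdot>\<^bsub>A\<^esub> q) \<otimes>\<^sub>\<complex> inA (v \<cdot>\<^bsub>A\<^esub> k))))))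
      = tsum (\<Delta>\<^bsub>H\<^esub> x) (\<lambda>x1 x2. tsum (\<psi> x1) (\<lambda>u v. tsum (\<Delta>\<^bsub>A\<^esub> v) (\<lambda>v1 v2.
         tsum (\<psi> x2) (\<lambda>p q. inA u \<otimes>\<^sub>\<complex> inA (v1 \<cdot>\<^bsub>A\<^esub> p) \<otimes>\<^sub>\<complex> inA (v2 \<cdot>\<^bsub>A\<^esub> q)))))"
      by (rule \<psi>_cocycle_lift) simp_all
    then show "conv H ?N3 (\<lambda>x. g1 (Ps x)) (R Ps) x = conv H ?N3 (\<lambda>x. g2 (Ps x)) (\<lambda>x. e (Ps x)) x"
      by (simp add: conv_def g1_def g2_def Ps_def R_def attach_def e_def Dl_def tsum_tsum_lin pure_tsum N3s)
  qed
  \<comment> \<open>This is the twisted coaction axiom \<open>\<rho>_\<rho>\<close>.\<close>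
  have 2: "conv H ?N3 (\<lambda>x. e (Ps x)) (R Rh) = conv H ?N3 (\<lambda>x. g2 (Rh x)) (\<lambda>x. e (Ps x))"
  proof
    fix x
    have "tsum (\<Delta>\<^bsub>H\<^esub> x) (\<lambda>x1 x2. tsum (\<psi> x1) (\<lambda>u v. tsum (\<rho> x2) (\<lambda>h k.
      tsum (\<rho> h) (\<lambda>p q. inH p \<otimes>\<^sub>\<complex> inA (u \<cdot>\<^bsub>A\<^esub> q) \<otimes>\<^sub>\<complex> inA (v \<cdot>\<^bsub>A\<^esub> k)))))
    = tsum (\<Delta>\<^bsub>H\<^esub> x) (\<lambda>x1 x2. tsum (\<rho> x1) (\<lambda>h k. tsum (\<Delta>\<^bsub>A\<^esub> k) (\<lambda>k1 k2.
         tsum (\<psi> x2) (\<lambda>u v. inH h \<otimes>\<^sub>\<complex> inA (k1 \<cdot>\<^bsub>A\<^esub> u) \<otimes>\<^sub>\<complex> inA (k2 \<cdot>\<^bsub>A\<^esub> v)))))"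
      by (rule \<rho>_\<rho>_lift) simp_all
    then show "conv H ?N3 (\<lambda>x. e (Ps x)) (R Rh) x = conv H ?N3 (\<lambda>x. g2 (Rh x)) (\<lambda>x. e (Ps x)) x"
      by (simp add: conv_def g2_def Ps_def Rh_def R_def attach_def e_def Dl_def tsum_tsum_lin pure_tsum N3s)
  qed
  \<comment> \<open>Since \<open>g1\<close> sends \<open>Rh\<close> to \<open>R Dj\<close>, the left
    side has five factors; identities 1 and 2 each replace two neighbours, until the factors of
    \<open>g2 (Dj x)\<close> stand in order.\<close>
  have "(\<lambda>x. g1 (Dj x)) = conv H ?N3 (\<lambda>x. g1 (Ps x)) (conv H ?N3 (conv H ?N3 (R Ps) (conv H ?N3 (R Rh) (\<lambda>x. e (Rh x)))) (\<lambda>x. e (Jh x)))"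
    by (simp add: Dj_def hom_conv[of g1, OF mult1 lin(1)] g1_Rh g1_Jh fun_eq_iff)
      (simp add: Dj_def R_conv R_Jh[abs_def])
  also have "\<dots> = conv H ?N3 (conv H ?N3 (\<lambda>x. g1 (Ps x)) (R Ps)) (conv H ?N3 (R Rh) (conv H ?N3 (\<lambda>x. e (Rh x)) (\<lambda>x. e (Jh x))))"
    by (simp add: HN3.conv_assoc[of id])
  also have "\<dots> = conv H ?N3 (\<lambda>x. g2 (Ps x)) (conv H ?N3 (conv H ?N3 (\<lambda>x. e (Ps x)) (R Rh)) (conv H ?N3 (\<lambda>x. e (Rh x)) (\<lambda>x. e (Jh x))))"
    unfolding 1 by (simp add: HN3.conv_assoc[of id])
  also have "\<dots> = conv H ?N3 (\<lambda>x. g2 (Ps x)) (conv H ?N3 (\<lambda>x. g2 (Rh x))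
      (conv H ?N3 (\<lambda>x. e (Ps x)) (conv H ?N3 (\<lambda>x. e (Rh x)) (\<lambda>x. e (Jh x)))))"
    unfolding 2 by (simp add: HN3.conv_assoc[of id])
  also have "\<dots> = (\<lambda>x. g2 (Dj x))"
    by (simp add: Dj_def hom_conv[of g2, OF mult2 lin(2)] g2_Jh fun_eq_iff)
      (simp add: Dj_def hom_conv[of e, OF e(2,1)] fun_eq_iff)
  finally have "g1 (Dj x) = g2 (Dj x)" for x by meson
  moreover have "g1 (Dl a) = g2 (Dl a)" for a
    by (simp add: g1_def g2_def Dl_def tsum_tsum_lin pure_tsum A.coassoc_lin)
  ultimately have "g1 (\<Delta>\<^bsub>M\<^esub> t) = g2 (\<Delta>\<^bsub>M\<^esub> t)"
    by (simp add: Delta_M semilin_image_tsum[OF lin(1)] semilin_image_tsum[OF lin(2)] mult1 mult2)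
  then show ?thesis
    by (simp add: g1_def g2_def pure_tsum(2)[symmetric] tsum_eta)
qed

lemma bialgebra_M: "bialgebra M"
proof (rule bialgebra.intro)
  show "cbilinear (mu M)"
    by (simp add: cbilinear_iff_semilin M.mu_lin)
  show "clinear \<Delta>\<^bsub>M\<^esub>" "clinear \<epsilon>\<^bsub>M\<^esub>"
    using semilin_Delta_M[OF semilin_ident] semilin_eps_M[OF semilin_ident] by (simp_all add: clinear_iff_semilin)
  show "\<Delta>\<^bsub>M\<^esub> \<^bold>1\<^bsub>M\<^esub> = \<^bold>1\<^bsub>M\<^esub> \<otimes>\<^sub>\<complex> \<^bold>1\<^bsub>M\<^esub>" "\<epsilon>\<^bsub>M\<^esub> \<^bold>1\<^bsub>M\<^esub> = 1"
    using Delta_inA[of "\<^bold>1\<^bsub>A\<^esub>"] eps_inA[of "\<^bold>1\<^bsub>A\<^esub>"] by (simp_all add: tensor_bialg_simps(1) del: Delta_inA eps_inA)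
qed (simp_all add: M.mult_assoc sweedler2_def M_coassoc M_counit_left M_counit_right Delta_M_mult eps_M_mult)

end

section \<open>The antipode of the cocycle bismash product\<close>

context cocycle_linked_pair
begin

sublocale M: bialgebra M
  by (rule bialgebra_M)

lemma \<psi>_eps:
  assumes "semilin id f"
  shows "tsum (\<psi> x) (\<lambda>u v. \<epsilon>\<^bsub>A\<^esub> u *\<^sub>C f v) = \<epsilon>\<^bsub>H\<^esub> x *\<^sub>C f \<^bold>1\<^bsub>A\<^esub>"
    "tsum (\<psi> x) (\<lambda>u v. \<epsilon>\<^bsub>A\<^esub> v *\<^sub>C f u) = \<epsilon>\<^bsub>H\<^esub> x *\<^sub>C f \<^bold>1\<^bsub>A\<^esub>"
  using arg_cong[OF \<psi>_counit_left[of x], of f] arg_cong[OF \<psi>_counit_right[of x], of f]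
  by (simp_all add: semilin_image_tsum[OF assms] semilin_scale[OF assms])

lemma \<rho>_eps:
  shows "semilin id f \<Longrightarrow> tsum (\<rho> x) (\<lambda>h k. \<epsilon>\<^bsub>H\<^esub> h *\<^sub>C f k) = \<epsilon>\<^bsub>H\<^esub> x *\<^sub>C f \<^bold>1\<^bsub>A\<^esub>"
    "semilin id g \<Longrightarrow> tsum (\<rho> x) (\<lambda>h k. \<epsilon>\<^bsub>A\<^esub> k *\<^sub>C g h) = g x"
  using arg_cong[OF \<rho>_counit_left[of x], of f] arg_cong[OF \<rho>_counit_right[of x], of g]
  by (simp_all add: semilin_image_tsum semilin_scale)

lemmas eps_contract = scaleC_scaleC[symmetric] scaleC_tsum[symmetric] \<psi>_eps \<rho>_eps H.counit_lin A.counit_lin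

lemma tsum_Delta_M_pure:
  assumes "\<And>n. semilin id (\<lambda>m. f m n)" "\<And>m. semilin id (f m)"
  shows "tsum (\<Delta>\<^bsub>M\<^esub> (a \<otimes>\<^sub>\<complex> x)) f = tsum (\<Delta>\<^bsub>A\<^esub> a) (\<lambda>a1 a2. tsum (\<Delta>\<^bsub>H\<^esub> x) (\<lambda>x1 r.
     tsum (\<Delta>\<^bsub>H\<^esub> r) (\<lambda>x2 x3. tsum (\<psi> x1) (\<lambda>u v. tsum (\<rho> x2) (\<lambda>h k.
         f ((a1 \<cdot>\<^bsub>A\<^esub> u) \<otimes>\<^sub>\<complex> h) ((a2 \<cdot>\<^bsub>A\<^esub> v \<cdot>\<^bsub>A\<^esub> k) \<otimes>\<^sub>\<complex> x3))))))"
  by (simp add: cocycle_bismash_simps(3) tsum_tsum_lin assms)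

section \<open>The projections onto \<open>H\<close> and \<open>A\<close>\<close>

definition "prH t = tsum t (\<lambda>a x. \<epsilon>\<^bsub>A\<^esub> a *\<^sub>C (x :: 'h))"
definition "prA t = tsum t (\<lambda>a x. \<epsilon>\<^bsub>H\<^esub> x *\<^sub>C (a :: 'a))"

lemma semilin_pr [simp]: "semilin \<sigma> f \<Longrightarrow> semilin \<sigma> (\<lambda>x. prH (f x))" "semilin \<sigma> f \<Longrightarrow> semilin \<sigma> (\<lambda>x. prA (f x))"
  by (simp_all add: prH_def prA_def)

lemma semilin_pr_eta [simp]: "semilin id prH" "semilin id prA"
  using semilin_pr[OF semilin_ident] by simp_all

lemma prH_pure [simp]: "prH (a \<otimes>\<^sub>\<complex> x) = \<epsilon>\<^bsub>A\<^esub> a *\<^sub>C x" and prA_pure [simp]: "prA (a \<otimes>\<^sub>\<complex> x) = \<epsilon>\<^bsub>H\<^esub> x *\<^sub>C a"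
  by (simp_all add: prH_def prA_def)

lemma prH_mult: "prH (s \<cdot>\<^bsub>M\<^esub> t) = prH s \<cdot>\<^bsub>H\<^esub> prH t"
proof -
  let ?F = "\<lambda>a. \<epsilon>\<^bsub>A\<^esub> a *\<^sub>C \<^bold>1\<^bsub>H\<^esub>"
  have "semilin id ?F" by simp
  moreover have "?F (a \<cdot>\<^bsub>A\<^esub> b) = ?F a \<cdot>\<^bsub>H\<^esub> ?F b" for a b
    by (simp add: scaleC_scaleC mult.commute)
  moreover have "x \<cdot>\<^bsub>H\<^esub> ?F a = tsum (\<Delta>\<^bsub>H\<^esub> x) (\<lambda>x1 x2. ?F (act x1 a) \<cdot>\<^bsub>H\<^esub> x2)" for x a
    by (simp add: scaleC_scaleC[symmetric] H.counit_lin)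
  moreover have "x \<cdot>\<^bsub>H\<^esub> y = tsum (\<Delta>\<^bsub>H\<^esub> x) (\<lambda>x1 x2. tsum (\<Delta>\<^bsub>H\<^esub> y) (\<lambda>y1 y2. ?F (\<chi> x1 y1) \<cdot>\<^bsub>H\<^esub> (x2 \<cdot>\<^bsub>H\<^esub> y2)))" for x y
    by (simp add: scaleC_scaleC[symmetric] scaleC_tsum[symmetric] H.counit_lin)
  ultimately have "tsum (s \<cdot>\<^bsub>M\<^esub> t) (\<lambda>a x. ?F a \<cdot>\<^bsub>H\<^esub> x) = tsum s (\<lambda>a x. ?F a \<cdot>\<^bsub>H\<^esub> x) \<cdot>\<^bsub>H\<^esub> tsum t (\<lambda>a x. ?F a \<cdot>\<^bsub>H\<^esub> x)"
    by (intro cross_hom_mult[OF H.calgebra, of id ?F "\<lambda>x. x"] semilin_ident)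
  then show ?thesis
    by (simp add: prH_def)
qed

lemma prH_comult: "\<Delta>\<^bsub>H\<^esub> (prH t) = tsum (\<Delta>\<^bsub>M\<^esub> t) (\<lambda>m n. prH m \<otimes>\<^sub>\<complex> prH n)"
proof (rule tensor_ext[of id "\<lambda>t. \<Delta>\<^bsub>H\<^esub> (prH t)" "\<lambda>t. tsum (\<Delta>\<^bsub>M\<^esub> t) (\<lambda>m n. prH m \<otimes>\<^sub>\<complex> prH n)"])
  show "\<Delta>\<^bsub>H\<^esub> (prH (a \<otimes>\<^sub>\<complex> x)) = tsum (\<Delta>\<^bsub>M\<^esub> (a \<otimes>\<^sub>\<complex> x)) (\<lambda>m n. prH m \<otimes>\<^sub>\<complex> prH n)" for a x
    by (simp add: tsum_Delta_M_pure eps_contract semilin_scale[OF H.Delta_lin] tsum_eta)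
qed simp_all

lemma eps_prH: "\<epsilon>\<^bsub>H\<^esub> (prH t) = \<epsilon>\<^bsub>M\<^esub> t"
  by (simp add: prH_def eps_M H.eps_tsum semilin_scale[OF H.eps_lin] scaleC_complex_def)

lemma prH_one: "prH \<^bold>1\<^bsub>M\<^esub> = \<^bold>1\<^bsub>H\<^esub>"
  by (simp add: cocycle_bismash_simps(2) scaleC_one)

text \<open>The antipode of \<open>M\<close> will be the product, in reverse order, of the
  convolution inverses of these two factors.\<close>

lemma prA_prH: "tsum (\<Delta>\<^bsub>M\<^esub> t) (\<lambda>m n. inA (prA m) \<cdot>\<^bsub>M\<^esub> inH (prH n)) = t"
proof (rule tensor_ext[of id "\<lambda>t. tsum (\<Delta>\<^bsub>M\<^esub> t) (\<lambda>m n. inA (prA m) \<cdot>\<^bsub>M\<^esub> inH (prH n))" "\<lambda>t. t"])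
  show "tsum (\<Delta>\<^bsub>M\<^esub> (a \<otimes>\<^sub>\<complex> x)) (\<lambda>m n. inA (prA m) \<cdot>\<^bsub>M\<^esub> inH (prH n)) = a \<otimes>\<^sub>\<complex> x" for a x
    by (simp add: tsum_Delta_M_pure inA_inH) (simp add: eps_contract)
qed simp_all

lemma inH_inA_assoc: "inH x \<cdot>\<^bsub>M\<^esub> (inA a \<cdot>\<^bsub>M\<^esub> t) = tsum (\<Delta>\<^bsub>H\<^esub> x) (\<lambda>x1 x2. inA (act x1 a) \<cdot>\<^bsub>M\<^esub> (inH x2 \<cdot>\<^bsub>M\<^esub> t))"
  by (simp add: M.mult_assoc[symmetric] inH_inA M.mu_tsum)

lemma inA_inA_assoc: "inA a \<cdot>\<^bsub>M\<^esub> (inA b \<cdot>\<^bsub>M\<^esub> t) = inA (a \<cdot>\<^bsub>A\<^esub> b) \<cdot>\<^bsub>M\<^esub> t"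
  by (simp add: M.mult_assoc[symmetric] inA_inA)

context
  fixes SA SH \<chi>' \<psi>'
  assumes SA: "antipode A SA" and SH: "antipode H SH"
    and \<chi>'_lin: "\<And>y. semilin id (\<lambda>x. \<chi>' x y)" "\<And>x. semilin id (\<chi>' x)"
    and \<chi>'_left: "conv2 H H A \<chi>' \<chi> x y = (\<epsilon>\<^bsub>H\<^esub> x * \<epsilon>\<^bsub>H\<^esub> y) *\<^sub>C \<^bold>1\<^bsub>A\<^esub>"
    and \<psi>'_lin: "semilin id \<psi>'"
    and \<psi>'_right: "conv H (tensor_bialg A A) \<psi> \<psi>' x = \<epsilon>\<^bsub>H\<^esub> x *\<^sub>C \<^bold>1\<^bsub>tensor_bialg A A\<^esub>"
begin

section \<open>Convolution inverses of \<open>inH\<close> and \<open>prA\<close>\<close>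

interpretation HM: convolution H M ..
interpretation MM: convolution M M ..
interpretation MA: convolution M A ..

lemmas SH_simps [simp] = H.antipode_lin[OF SH] H.antipode_lin0[OF SH]
lemmas SA_simps [simp] = A.antipode_lin[OF SA] A.antipode_lin0[OF SA]

lemma semilin_inv [simp]:
  "semilin \<sigma> f \<Longrightarrow> semilin \<sigma> (\<lambda>x. \<chi>' (f x) y)" "semilin \<sigma> f \<Longrightarrow> semilin \<sigma> (\<lambda>x. \<chi>' y (f x))"
  "semilin \<sigma> f \<Longrightarrow> semilin \<sigma> (\<lambda>x. \<psi>' (f x))"
  by (erule semilin_lin_compose[OF \<chi>'_lin(1)] semilin_lin_compose[OF \<chi>'_lin(2)] semilin_lin_compose[OF \<psi>'_lin])+

text \<open>The standard formula for the convolution inverse of the section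
  \<open>x \<mapsto> 1 # x\<close> of a crossed product, with \<open>\<chi>'\<close> as the inverse
  cocycle.\<close>

definition "inHi x = tsum (\<Delta>\<^bsub>H\<^esub> x) (\<lambda>x1 r. tsum (\<Delta>\<^bsub>H\<^esub> r) (\<lambda>x2 x3.
    inA (\<chi>' (SH x2) x3) \<cdot>\<^bsub>M\<^esub> inH (SH x1)))"

lemma semilin_inHi [simp]: "semilin \<sigma> f \<Longrightarrow> semilin \<sigma> (\<lambda>x. inHi (f x))"
  by (simp add: inHi_def)

lemma semilin_inHi_eta [simp]: "semilin id inHi" "semilin id inH" "semilin id inA"
  using semilin_inHi[OF semilin_ident] semilin_inH[OF semilin_ident] semilin_inA[OF semilin_ident] by simp_all

text \<open>The antipode reverses the coproduct, so \<open>\<chi>'\<close> and \<open>\<chi>\<close>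
  meet on the same pair of arguments and cancel; the antipode axiom of \<open>H\<close> contracts
  the rest.\<close>

lemma inHi_left: "conv H M inHi inH = conv_unit H M"
proof
  fix x
  note Ds = H.tsum_Delta_antipode[OF SH, of id]
  have "conv H M inHi inH x = tsum (\<Delta>\<^bsub>H\<^esub> x) (\<lambda>a r. tsum (\<Delta>\<^bsub>H\<^esub> r) (\<lambda>z r'. tsum (\<Delta>\<^bsub>H\<^esub> r') (\<lambda>t v.
    inA (conv2 H H A \<chi>' \<chi> (SH z) t) \<cdot>\<^bsub>M\<^esub> inH (SH a \<cdot>\<^bsub>H\<^esub> v))))"
    by (simp add: conv_def inHi_def M.mu_tsum M.mult_assoc inH_inH Ds conv2_def inA_tsum
      H.coassoc_lin H.coassoc2 H.coassoc3 inA_inA[symmetric])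
  also have "\<dots> = tsum (\<Delta>\<^bsub>H\<^esub> x) (\<lambda>a r. inH (SH a \<cdot>\<^bsub>H\<^esub> r))"
    by (simp add: \<chi>'_left H.eps_antipode[OF SH] eps_contract)
  also have "\<dots> = conv_unit H M x"
    using H.antipode_left[OF SH, of x] by (simp add: inH_tsum[symmetric] conv_unit_def)
  finally show "conv H M inHi inH x = conv_unit H M x" .
qed

lemma inHi_right: "conv H M inH inHi = conv_unit H M"
proof -
  \<comment> \<open>\<open>e x\<close> is the coefficient in \<open>A\<close> that remains once the
    antipode has contracted the factors in \<open>H\<close>.\<close>
  define e where "e x = tsum (\<Delta>\<^bsub>H\<^esub> x) (\<lambda>a r. tsum (\<Delta>\<^bsub>H\<^esub> r) (\<lambda>p r'. tsum (\<Delta>\<^bsub>H\<^esub> r') (\<lambda>n s. tsum (\<Delta>\<^bsub>H\<^esub> s) (\<lambda>x2 x3.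
    act a (\<chi>' (SH x2) x3) \<cdot>\<^bsub>A\<^esub> \<chi> p (SH n)))))" for x
  have [simp]: "semilin id e" unfolding e_def by simp
  have E: "conv H M inH inHi x = inA (e x)" for x
  proof -
    note Ds = H.tsum_Delta_antipode[OF SH, of id]
    have "conv H M inH inHi x = tsum (\<Delta>\<^bsub>H\<^esub> x) (\<lambda>a r. tsum (\<Delta>\<^bsub>H\<^esub> r) (\<lambda>p r'. tsum (\<Delta>\<^bsub>H\<^esub> r') (\<lambda>t s'.
      tsum (\<Delta>\<^bsub>H\<^esub> s') (\<lambda>n s. tsum (\<Delta>\<^bsub>H\<^esub> s) (\<lambda>x2 x3. tsum (\<Delta>\<^bsub>H\<^esub> t) (\<lambda>q m.
        inA (act a (\<chi>' (SH x2) x3) \<cdot>\<^bsub>A\<^esub> \<chi> p (SH n)) \<cdot>\<^bsub>M\<^esub> inH (q \<cdot>\<^bsub>H\<^esub> SH m)))))))"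
      by (simp add: conv_def inHi_def M.mu_tsum inH_inA_assoc inH_inH Ds inA_inA_assoc
        H.coassoc_lin H.coassoc2 H.coassoc3)
    also have "\<dots> = inA (e x)"
      by (simp add: M.mu_tsum(2)[symmetric] inH_tsum[symmetric] H.antipode_right[OF SH] eps_contract e_def inA_tsum)
    finally show ?thesis .
  qed
  \<comment> \<open>Associativity and \<open>inHi_left\<close> show that multiplication by
    \<open>e\<close> fixes \<open>inH\<close>; projecting to \<open>A\<close> then forces
    \<open>e\<close> to be the convolution unit.\<close>
  have "conv H M (\<lambda>x. inA (e x)) inH = inH"
  proof -
    have "conv H M (\<lambda>x. inA (e x)) inH = conv H M (conv H M inH inHi) inH"
      by (simp add: E[abs_def, symmetric])
    also have "\<dots> = inH"
      by (simp add: HM.conv_assoc[of id] inHi_left)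
    finally show ?thesis .
  qed
  then have "prA (tsum (\<Delta>\<^bsub>H\<^esub> x) (\<lambda>u v. inA (e u) \<cdot>\<^bsub>M\<^esub> inH v)) = prA (inH x)" for x
    by (simp add: conv_def fun_eq_iff)
  then have "e x = \<epsilon>\<^bsub>H\<^esub> x *\<^sub>C \<^bold>1\<^bsub>A\<^esub>" for x
    by (simp add: semilin_image_tsum[of id prA] inA_inH H.counit_lin) (simp add: inH_def)
  then show ?thesis
    by (simp add: E conv_unit_def fun_eq_iff)
qed

text \<open>The image of \<open>\<psi>'\<close> under \<open>u \<otimes> v \<mapsto> u S(v)\<close>;
  it will be the value at \<open>1 # x\<close> of the inverse of \<open>prA\<close>.\<close>

definition "prAi_H x = tsum (\<psi>' x) (\<lambda>u v. u \<cdot>\<^bsub>A\<^esub> SA v)"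
definition "prAi t = tsum t (\<lambda>a x. prAi_H x \<cdot>\<^bsub>A\<^esub> SA a)"

lemma semilin_prAi_H [simp]: "semilin \<sigma> f \<Longrightarrow> semilin \<sigma> (\<lambda>x. prAi_H (f x))"
  by (simp add: prAi_H_def)

lemma semilin_prAi [simp]: "semilin \<sigma> f \<Longrightarrow> semilin \<sigma> (\<lambda>x. prAi (f x))"
  by (simp add: prAi_def)

lemma prAi_pure [simp]: "prAi (a \<otimes>\<^sub>\<complex> x) = prAi_H x \<cdot>\<^bsub>A\<^esub> SA a"
  using semilin_prAi_H[OF semilin_ident] by (simp add: prAi_def)

lemma semilin_prAi_eta [simp]: "semilin id prAi" "semilin id prAi_H"
  using semilin_prAi[OF semilin_ident] semilin_prAi_H[OF semilin_ident] by simp_all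

lemma SA_one [simp]: "SA \<^bold>1\<^bsub>A\<^esub> = \<^bold>1\<^bsub>A\<^esub>"
  using A.antipode_left[OF SA, of "\<^bold>1\<^bsub>A\<^esub>"] by (simp add: scaleC_one)

lemma \<psi>_prAi_H: "tsum (\<Delta>\<^bsub>H\<^esub> x) (\<lambda>x1 x2. tsum (\<psi> x1) (\<lambda>u v. u \<cdot>\<^bsub>A\<^esub> (prAi_H x2 \<cdot>\<^bsub>A\<^esub> SA v))) = \<epsilon>\<^bsub>H\<^esub> x *\<^sub>C \<^bold>1\<^bsub>A\<^esub>"
proof -
  \<comment> \<open>The map \<open>u \<otimes> v \<mapsto> u S(v)\<close> is applied to the inverse
    relation; antimultiplicativity of \<open>SA\<close> nests the contribution of
    \<open>\<psi>'\<close> between the two legs of \<open>\<psi>\<close>.\<close>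
  have "tsum (conv H (tensor_bialg A A) \<psi> \<psi>' x) (\<lambda>u v. u \<cdot>\<^bsub>A\<^esub> SA v) = \<epsilon>\<^bsub>H\<^esub> x *\<^sub>C \<^bold>1\<^bsub>A\<^esub>"
    by (simp add: \<psi>'_right tensor_bialg_simps(1) scaleC_pure del: scaleC_pure[symmetric])
  then show ?thesis
    by (simp add: conv_def tensor_bialg_simps(2) tsum_tsum_lin prAi_H_def A.antipode_mult[OF SA] A.mu_tsum A.mult_assoc)
qed

text \<open>Once the counits are contracted, \<open>\<psi>_prAi_H\<close> removes the inner factors
  and the antipode axiom of \<open>A\<close> the outer ones.\<close>

lemma prAi_right: "conv M A prA prAi = conv_unit M A"
proof
  fix t
  show "conv M A prA prAi t = conv_unit M A t"
  proof (rule tensor_ext[of id "conv M A prA prAi" "conv_unit M A"])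
    fix a x
    have "conv M A prA prAi (a \<otimes>\<^sub>\<complex> x) = tsum (\<Delta>\<^bsub>A\<^esub> a) (\<lambda>a1 a2. tsum (\<Delta>\<^bsub>H\<^esub> x) (\<lambda>x1 x2. tsum (\<psi> x1) (\<lambda>u v.
      a1 \<cdot>\<^bsub>A\<^esub> (u \<cdot>\<^bsub>A\<^esub> (prAi_H x2 \<cdot>\<^bsub>A\<^esub> SA v)) \<cdot>\<^bsub>A\<^esub> SA a2)))"
      by (simp add: conv_def tsum_Delta_M_pure A.antipode_mult[OF SA] A.mult_assoc)
        (simp add: eps_contract tsum_commute[of "\<psi> u" "\<Delta>\<^bsub>H\<^esub> v" for u v])
    also have "\<dots> = conv_unit M A (a \<otimes>\<^sub>\<complex> x)"
      by (simp add: A.mu_tsum[symmetric] \<psi>_prAi_H) (simp add: eps_contract A.antipode_right[OF SA] conv_unit_def eps_M,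
          simp add: scaleC_scaleC mult.commute)
    finally show "conv M A prA prAi (a \<otimes>\<^sub>\<complex> x) = conv_unit M A (a \<otimes>\<^sub>\<complex> x)" .
  qed (simp_all add: conv_unit_def[abs_def])
qed

lemma prAi_left: "conv M A prAi prA = conv_unit M A"
proof -
  \<comment> \<open>Contracting \<open>SA a1\<close> with \<open>a2\<close> will show that the
    product depends on \<open>a\<close> only through its counit; \<open>Q x\<close> is the value at
    \<open>1 # x\<close>.\<close>
  define Q where "Q x = conv M A prAi prA (\<^bold>1\<^bsub>A\<^esub> \<otimes>\<^sub>\<complex> x)" for x
  have Q_lin: "semilin id Q" unfolding Q_def by (simp add: conv_def)
  have Q: "conv M A prAi prA (a \<otimes>\<^sub>\<complex> x) = \<epsilon>\<^bsub>A\<^esub> a *\<^sub>C Q x" for a x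
  proof -
    have "conv M A prAi prA (a \<otimes>\<^sub>\<complex> x) = tsum (\<Delta>\<^bsub>H\<^esub> x) (\<lambda>x1 r. tsum (\<Delta>\<^bsub>H\<^esub> r) (\<lambda>x2 x3. tsum (\<psi> x1) (\<lambda>u v. tsum (\<rho> x2) (\<lambda>h l.
      tsum (\<Delta>\<^bsub>A\<^esub> a) (\<lambda>a1 a2. \<epsilon>\<^bsub>H\<^esub> x3 *\<^sub>C (prAi_H h \<cdot>\<^bsub>A\<^esub> SA u \<cdot>\<^bsub>A\<^esub> (SA a1 \<cdot>\<^bsub>A\<^esub> a2) \<cdot>\<^bsub>A\<^esub> (v \<cdot>\<^bsub>A\<^esub> l)))))))" for a
      by (simp add: conv_def tsum_Delta_M_pure A.antipode_mult[OF SA] A.mult_assoc tsum_commute[of "\<Delta>\<^bsub>A\<^esub> a"])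
    then have "conv M A prAi prA (a \<otimes>\<^sub>\<complex> x) = tsum (\<Delta>\<^bsub>H\<^esub> x) (\<lambda>x1 r. tsum (\<Delta>\<^bsub>H\<^esub> r) (\<lambda>x2 x3. tsum (\<psi> x1) (\<lambda>u v. tsum (\<rho> x2) (\<lambda>h l.
      \<epsilon>\<^bsub>H\<^esub> x3 *\<^sub>C \<epsilon>\<^bsub>A\<^esub> a *\<^sub>C (prAi_H h \<cdot>\<^bsub>A\<^esub> SA u \<cdot>\<^bsub>A\<^esub> (v \<cdot>\<^bsub>A\<^esub> l))))))" for a
      by (simp add: scaleC_tsum[symmetric] A.mu_tsum[symmetric] A.antipode_left[OF SA])
    from this[of a] this[of "\<^bold>1\<^bsub>A\<^esub>"] show ?thesis
      by (simp only: Q_def A.eps_one scaleC_one scaleC_tsum scaleC_scaleC mult.commute[of "\<epsilon>\<^bsub>A\<^esub> a"])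
  qed
  \<comment> \<open>Multiplying by \<open>prA\<close> on the left gives \<open>prA\<close> back, by
    the right inverse; evaluation at \<open>1 # x\<close> then determines \<open>Q\<close>.\<close>
  have "conv M A prA (conv M A prAi prA) = prA"
    using MA.conv_assoc[of id prA prAi prA] by (simp add: prAi_right)
  from fun_cong[OF this, of "\<^bold>1\<^bsub>A\<^esub> \<otimes>\<^sub>\<complex> x" for x] have "Q x = \<epsilon>\<^bsub>H\<^esub> x *\<^sub>C \<^bold>1\<^bsub>A\<^esub>" for x
    using Q_lin by (simp add: conv_def[of _ _ prA] tsum_Delta_M_pure Q) (simp add: eps_contract)
  then have 1: "conv M A prAi prA (a \<otimes>\<^sub>\<complex> x) = conv_unit M A (a \<otimes>\<^sub>\<complex> x)" for a x
    by (simp add: Q conv_unit_def eps_M scaleC_scaleC)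
  have 2: "semilin id (conv_unit M A)"
    unfolding conv_unit_def[abs_def] by simp
  show ?thesis
    by (rule ext, rule tensor_ext[of id "conv M A prAi prA" "conv_unit M A"]) (simp_all add: 1 2)
qed

lemma antipode_M: "antipode M (conv M M (\<lambda>m. inHi (prH m)) (\<lambda>m. inA (prAi m)))"
proof -
  have ident: "conv M M (\<lambda>m. inA (prA m)) (\<lambda>m. inH (prH m)) = (\<lambda>m. m)"
    by (rule ext) (simp add: conv_def prA_prH)
  \<comment> \<open>Composition with the coalgebra map \<open>prH\<close>, and likewise with the
    algebra map \<open>inA\<close>, preserves convolution, so the inverses found above carry over to
    \<open>M\<close>.\<close>
  have prH_conv: "conv M M (\<lambda>m. f (prH m)) (\<lambda>m. g (prH m)) t = conv H M f g (prH t)"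
    if "semilin id f" "semilin id g" for f g t
    using semilin_lin_compose[OF that(1)] semilin_lin_compose[OF that(2)] that
    by (simp add: conv_def prH_comult tsum_tsum_lin)
  have inA_conv: "conv M M (\<lambda>m. inA (f m)) (\<lambda>m. inA (g m)) t = inA (conv M A f g t)" for f g t
    by (simp add: conv_def inA_inA inA_tsum)
  have 1: "conv M M (\<lambda>m. inHi (prH m)) (\<lambda>m. inH (prH m)) = conv_unit M M"
      "conv M M (\<lambda>m. inH (prH m)) (\<lambda>m. inHi (prH m)) = conv_unit M M"
    by (simp_all add: fun_eq_iff prH_conv inHi_left inHi_right conv_unit_def eps_prH)
  have 2: "conv M M (\<lambda>m. inA (prAi m)) (\<lambda>m. inA (prA m)) = conv_unit M M"
      "conv M M (\<lambda>m. inA (prA m)) (\<lambda>m. inA (prAi m)) = conv_unit M M"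
    by (simp_all add: fun_eq_iff inA_conv prAi_left prAi_right conv_unit_def)
  let ?S = "conv M M (\<lambda>m. inHi (prH m)) (\<lambda>m. inA (prAi m))"
  have "conv M M ?S (\<lambda>m. m) = conv M M (\<lambda>m. inHi (prH m)) (conv M M (conv M M (\<lambda>m. inA (prAi m)) (\<lambda>m. inA (prA m))) (\<lambda>m. inH (prH m)))"
    unfolding ident[symmetric] by (simp add: MM.conv_assoc[of id])
  then have left: "conv M M ?S (\<lambda>m. m) = conv_unit M M"
    by (simp add: 1 2)
  have "conv M M (\<lambda>m. m) ?S = conv M M (\<lambda>m. inA (prA m)) (conv M M (conv M M (\<lambda>m. inH (prH m)) (\<lambda>m. inHi (prH m))) (\<lambda>m. inA (prAi m)))"
    unfolding ident[symmetric] by (simp add: MM.conv_assoc[of id])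
  then have right: "conv M M (\<lambda>m. m) ?S = conv_unit M M"
    by (simp add: 1 2)
  show ?thesis
    unfolding antipode_def clinear_iff_semilin
    using fun_cong[OF left] fun_cong[OF right] by (simp add: conv_def[of M M _ "\<lambda>m. m"] conv_def[of M M "\<lambda>m. m"] sweedler2_def conv_unit_def)
qed

end

lemma hopf_algebra_M:
  assumes "hopf_algebra A" "hopf_algebra H"
    and "conv_invertible (tensor_bialg H H) A (\<lambda>t. tsum t \<chi>)" "conv_invertible H (tensor_bialg A A) \<psi>"
  shows "hopf_algebra M"
proof -
  obtain SA SH where S: "antipode A SA" "antipode H SH"
    using assms(1,2) by (auto simp: hopf_algebra_def hopf_algebra_axioms_def)
  obtain g where g: "semilin id g" "\<And>c. tsum (\<Delta>\<^bsub>tensor_bialg H H\<^esub> c) (\<lambda>c1 c2. g c1 \<cdot>\<^bsub>A\<^esub> tsum c2 \<chi>) = \<epsilon>\<^bsub>tensor_bialg H H\<^esub> c *\<^sub>C \<^bold>1\<^bsub>A\<^esub>"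
    using assms(3) by (auto simp: conv_invertible_def clinear_iff_semilin sweedler2_def)
  obtain \<psi>' where \<psi>': "semilin id \<psi>'" "\<And>c. tsum (\<Delta>\<^bsub>H\<^esub> c) (\<lambda>c1 c2. \<psi> c1 \<cdot>\<^bsub>tensor_bialg A A\<^esub> \<psi>' c2) = \<epsilon>\<^bsub>H\<^esub> c *\<^sub>C \<^bold>1\<^bsub>tensor_bialg A A\<^esub>"
    using assms(4) by (auto simp: conv_invertible_def clinear_iff_semilin sweedler2_def)
  \<comment> \<open>The inverse of \<open>\<chi>\<close> is given on the tensor product; on pure
    tensors it becomes a bilinear map that can serve as \<open>\<chi>'\<close>.\<close>
  have "conv2 H H A (\<lambda>x y. g (x \<otimes>\<^sub>\<complex> y)) \<chi> x y = (\<epsilon>\<^bsub>H\<^esub> x * \<epsilon>\<^bsub>H\<^esub> y) *\<^sub>C \<^bold>1\<^bsub>A\<^esub>" for x y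
    using g(2)[of "x \<otimes>\<^sub>\<complex> y"] g(1) semilin_lin_compose[OF g(1)] semilin_\<chi>(2)[OF semilin_ident]
    by (simp add: tensor_bialg_simps conv2_def tsum_tsum_lin)
  then have "antipode M (conv M M (\<lambda>m. inHi SH (\<lambda>x y. g (x \<otimes>\<^sub>\<complex> y)) (prH m)) (\<lambda>m. inA (prAi SA \<psi>' m)))"
    by (intro antipode_M S \<psi>' semilin_lin_compose[OF g(1)]) (simp_all add: conv_def \<psi>')
  then show ?thesis
    by (auto simp: hopf_algebra_def hopf_algebra_axioms_def bialgebra_M)
qed

end

section \<open>Involutions\<close>

context star_hopf_algebra
begin

lemma star_antilin: "semilin cnj star"
  using star_antilinear by (simp add: antilinear_iff_semilin)

lemma semilin_star [simp]:
  "semilin id f \<Longrightarrow> semilin cnj (\<lambda>x. star (f x))" "semilin cnj f \<Longrightarrow> semilin id (\<lambda>x. star (f x))"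
  by (rule semilin_anti_compose[OF star_antilin], assumption) (rule semilin_anti_anti[OF star_antilin])

lemma star_tsum: "star (tsum t f) = tsum t (\<lambda>a b. star (f a b))"
  by (rule semilin_image_tsum[OF star_antilin])

lemma star_scaleC: "star (c *\<^sub>C a) = cnj c *\<^sub>C star a"
  by (rule semilin_scale[OF star_antilin])

lemma star_one: "star \<^bold>1 = \<^bold>1"
  using star_mult[of "star \<^bold>1" "\<^bold>1"] by (simp add: star_star)

lemma tsum_Delta_star:
  assumes "\<And>b. semilin \<sigma> (\<lambda>a. f a b)" "\<And>a. semilin \<sigma> (f a)"
  shows "tsum (\<Delta> (star a)) f = tsum (\<Delta> a) (\<lambda>u v. f (star u) (star v))"
  by (simp add: star_comult sweedler2_def tsum_tsum[OF assms] tsum_pure_semilin[OF assms])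

text \<open>The conjugate of \<open>\<epsilon> \<circ> star\<close> satisfies the left counit law,
  and comparison with the right counit law of \<open>\<epsilon>\<close> shows that the two
  agree.\<close>

lemma eps_star: "\<epsilon> (star a) = cnj (\<epsilon> a)"
proof -
  have "tsum (\<Delta> (star a)) (\<lambda>u v. \<epsilon> u *\<^sub>C v) = star a"
    by (simp add: counit_lin)
  then have "star (tsum (\<Delta> a) (\<lambda>u v. \<epsilon> (star u) *\<^sub>C star v)) = a"
    by (simp add: tsum_Delta_star[of id] star_star)
  then have "tsum (\<Delta> a) (\<lambda>u v. cnj (\<epsilon> (star u)) *\<^sub>C v) = a"
    by (simp add: star_tsum star_scaleC star_star)
  from arg_cong[OF this, of \<epsilon>] have "tsum (\<Delta> a) (\<lambda>u v. cnj (\<epsilon> (star u)) * \<epsilon> v) = \<epsilon> a"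
    by (simp add: eps_tsum semilin_scale[OF eps_lin] scaleC_complex_def)
  moreover have "semilin id (\<lambda>u. cnj (\<epsilon> (star u)))"
    using eps_lin star_antilin by (simp add: semilin_def scaleC_complex_def)
  then have "tsum (\<Delta> a) (\<lambda>u v. \<epsilon> v *\<^sub>C cnj (\<epsilon> (star u))) = cnj (\<epsilon> (star a))"
    by (rule counit_lin)
  ultimately have "cnj (\<epsilon> (star a)) = \<epsilon> a"
    by (simp add: scaleC_complex_def mult.commute)
  then show ?thesis by (metis complex_cnj_cnj)
qed

end

section \<open>The involution of the cocycle bismash product\<close>

locale cocycle_linked_pair_star =
  cocycle_linked_pair A H act \<rho> \<chi> \<psi> + SA: star_hopf_algebra A starA + SH: star_hopf_algebra H starH
  for A :: "'a::complex_vector bialg" and H :: "'h::complex_vector bialg"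
    and act \<rho> \<chi> \<psi> and starA :: "'a \<Rightarrow> 'a" and starH :: "'h \<Rightarrow> 'h" +
  fixes \<gamma> :: "'h \<Rightarrow> 'a"
  assumes \<gamma>_lin: "semilin id \<gamma>"
    and \<gamma>_one [simp]: "\<gamma> \<^bold>1\<^bsub>H\<^esub> = \<^bold>1\<^bsub>A\<^esub>"
    and eps_\<gamma> [simp]: "\<epsilon>\<^bsub>A\<^esub> (\<gamma> x) = \<epsilon>\<^bsub>H\<^esub> x"
begin

declare SA.star_star [simp] SH.star_star [simp] SA.star_one [simp] SH.star_one [simp]
  SA.eps_star [simp] SH.eps_star [simp] SA.star_scaleC [simp] SH.star_scaleC [simp]

lemma semilin_\<gamma> [simp]: "semilin \<sigma> f \<Longrightarrow> semilin \<sigma> (\<lambda>x. \<gamma> (f x))"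
  by (rule semilin_lin_compose[OF \<gamma>_lin])

abbreviation "starM \<equiv> bismash_star A H act starA starH \<gamma>"

text \<open>The index \<open>s\<close> marks the map conjugated by the involutions; it is linear again.\<close>

definition "\<gamma>\<^sub>s y = starA (\<gamma> (starH y))"
definition "act\<^sub>s y b = starA (act (starH y) (starA b))"
definition "\<chi>\<^sub>s x y = starA (\<chi> (starH x) (starH y))"
definition "\<rho>\<^sub>s y = tsum (\<rho> (starH y)) (\<lambda>h k. starH h \<otimes>\<^sub>\<complex> starA k)"
definition "\<psi>\<^sub>s y = tsum (\<psi> (starH y)) (\<lambda>u v. starA u \<otimes>\<^sub>\<complex> starA v)"

lemma semilin_duals [simp]:
  "semilin id f \<Longrightarrow> semilin id (\<lambda>x. \<gamma>\<^sub>s (f x))"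
  "semilin id f \<Longrightarrow> semilin id (\<lambda>x. act\<^sub>s (f x) b)" "semilin id g \<Longrightarrow> semilin id (\<lambda>x. act\<^sub>s y (g x))"
  "semilin id f \<Longrightarrow> semilin id (\<lambda>x. \<chi>\<^sub>s (f x) y)" "semilin id f \<Longrightarrow> semilin id (\<lambda>x. \<chi>\<^sub>s y (f x))"
  "semilin id f \<Longrightarrow> semilin id (\<lambda>x. \<rho>\<^sub>s (f x))" "semilin id f \<Longrightarrow> semilin id (\<lambda>x. \<psi>\<^sub>s (f x))"
  by (simp_all add: \<gamma>\<^sub>s_def act\<^sub>s_def \<chi>\<^sub>s_def \<rho>\<^sub>s_def \<psi>\<^sub>s_def)

text \<open>The involution of \<open>1 # starH y\<close>; the substitution makes it linear in
  \<open>y\<close>.\<close>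

definition "st y = tsum (\<Delta>\<^bsub>H\<^esub> y) (\<lambda>y1 y2. inA (\<gamma> y1) \<cdot>\<^bsub>M\<^esub> inH y2)"

lemma semilin_st [simp]: "semilin \<sigma> f \<Longrightarrow> semilin \<sigma> (\<lambda>x. st (f x))"
  by (simp add: st_def)

lemma st_inA: "st y \<cdot>\<^bsub>M\<^esub> inA b = tsum (\<Delta>\<^bsub>H\<^esub> y) (\<lambda>y1 r. tsum (\<Delta>\<^bsub>H\<^esub> r) (\<lambda>y2 y3.
    inA (\<gamma> y1 \<cdot>\<^bsub>A\<^esub> act y2 b) \<cdot>\<^bsub>M\<^esub> inH y3))"
  by (simp add: st_def M.mu_tsum M.mult_assoc inH_inA inA_inA_assoc)

text \<open>The defining formula is the product of the images of the two factors of
  \<open>a # x\<close> in reverse order, as antimultiplicativity requires.\<close>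

lemma starM_pure: "starM (a \<otimes>\<^sub>\<complex> x) = st (starH x) \<cdot>\<^bsub>M\<^esub> inA (starA a)"
  by (simp add: bismash_star_def sweedler_defs tsum_pure_semilin[of cnj] st_inA SH.tsum_Delta_star[of id] inA_inH)

lemma starM_antilin: "semilin cnj starM"
  unfolding bismash_star_def [abs_def] sweedler_defs by simp

lemma semilin_starM [simp]:
  "semilin id f \<Longrightarrow> semilin cnj (\<lambda>x. starM (f x))" "semilin cnj f \<Longrightarrow> semilin id (\<lambda>x. starM (f x))"
  by (rule semilin_anti_compose[OF starM_antilin], assumption) (rule semilin_anti_anti[OF starM_antilin])

lemma starM_tsum: "starM (tsum t f) = tsum t (\<lambda>u v. starM (f u v))"
  by (rule semilin_image_tsum[OF starM_antilin])

lemma st_one [simp]: "st \<^bold>1\<^bsub>H\<^esub> = \<^bold>1\<^bsub>M\<^esub>"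
  by (simp add: st_def)

lemma starM_inA: "starM (inA a) = inA (starA a)" and starM_inH: "starM (inH x) = st (starH x)"
  by (simp_all add: inA_def[of a] inH_def starM_pure)

lemma starM_eq: "starM t = tsum t (\<lambda>a x. st (starH x) \<cdot>\<^bsub>M\<^esub> inA (starA a))"
  using starM_tsum[of t "\<lambda>a x. a \<otimes>\<^sub>\<complex> x"] by (simp add: tsum_eta starM_pure)

section \<open>Conditions (i) to (iii) as coefficients in \<open>A\<close>\<close>

lemma prA_inA_inH [simp]: "prA (inA a \<cdot>\<^bsub>M\<^esub> inH x) = \<epsilon>\<^bsub>H\<^esub> x *\<^sub>C a"
  by (simp add: inA_inH)

lemma prA_tsum: "prA (tsum t f) = tsum t (\<lambda>u v. prA (f u v))"
  by (rule semilin_image_tsum[of id]) simp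

text \<open>\<open>prA\<close> removes the factor in \<open>H\<close> by its counit and thereby
  recovers the coefficient.\<close>

lemma coefficient:
  assumes "semilin id F" "semilin id G"
  shows "(\<forall>y. tsum (\<Delta>\<^bsub>H\<^esub> y) (\<lambda>w z. inA (F w) \<cdot>\<^bsub>M\<^esub> inH z) = tsum (\<Delta>\<^bsub>H\<^esub> y) (\<lambda>w z. inA (G w) \<cdot>\<^bsub>M\<^esub> inH z))
    \<longleftrightarrow> (\<forall>y. F y = G y)" (is "?L \<longleftrightarrow> ?R")
proof
  assume ?L
  show ?R
  proof
    fix y
    from \<open>?L\<close> have "prA (tsum (\<Delta>\<^bsub>H\<^esub> y) (\<lambda>w z. inA (F w) \<cdot>\<^bsub>M\<^esub> inH z)) = prA (tsum (\<Delta>\<^bsub>H\<^esub> y) (\<lambda>w z. inA (G w) \<cdot>\<^bsub>M\<^esub> inH z))"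
      by simp
    then show "F y = G y"
      by (simp add: prA_tsum H.counit_lin assms)
  qed
qed simp

lemma coefficient2:
  assumes "\<And>y. semilin id (\<lambda>x. F x y)" "\<And>x. semilin id (F x)" "\<And>y. semilin id (\<lambda>x. G x y)" "\<And>x. semilin id (G x)"
  shows "(\<forall>x y. tsum (\<Delta>\<^bsub>H\<^esub> x) (\<lambda>x1 x2. tsum (\<Delta>\<^bsub>H\<^esub> y) (\<lambda>y1 y2. inA (F x1 y1) \<cdot>\<^bsub>M\<^esub> inH (y2 \<cdot>\<^bsub>H\<^esub> x2)))
     = tsum (\<Delta>\<^bsub>H\<^esub> x) (\<lambda>x1 x2. tsum (\<Delta>\<^bsub>H\<^esub> y) (\<lambda>y1 y2. inA (G x1 y1) \<cdot>\<^bsub>M\<^esub> inH (y2 \<cdot>\<^bsub>H\<^esub> x2))))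
    \<longleftrightarrow> (\<forall>x y. F x y = G x y)" (is "?L \<longleftrightarrow> ?R")
proof
  assume L: ?L
  have *: "prA (tsum (\<Delta>\<^bsub>H\<^esub> x) (\<lambda>x1 x2. tsum (\<Delta>\<^bsub>H\<^esub> y) (\<lambda>y1 y2. inA (K x1 y1) \<cdot>\<^bsub>M\<^esub> inH (y2 \<cdot>\<^bsub>H\<^esub> x2)))) = K x y"
    if "\<And>y. semilin id (\<lambda>x. K x y)" "\<And>x. semilin id (K x)" for K x y
  proof -
    have "prA (tsum (\<Delta>\<^bsub>H\<^esub> x) (\<lambda>x1 x2. tsum (\<Delta>\<^bsub>H\<^esub> y) (\<lambda>y1 y2. inA (K x1 y1) \<cdot>\<^bsub>M\<^esub> inH (y2 \<cdot>\<^bsub>H\<^esub> x2))))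
      = tsum (\<Delta>\<^bsub>H\<^esub> x) (\<lambda>x1 x2. tsum (\<Delta>\<^bsub>H\<^esub> y) (\<lambda>y1 y2. \<epsilon>\<^bsub>H\<^esub> y2 *\<^sub>C \<epsilon>\<^bsub>H\<^esub> x2 *\<^sub>C K x1 y1))"
      by (simp add: prA_tsum scaleC_scaleC)
    then show ?thesis
      by (simp add: H.counit_lin that)
  qed
  show ?R
    using L *[of F] *[of G] assms by metis
qed simp

text \<open>Writing the factors in \<open>A\<close> to the left of those in \<open>H\<close> makes
  the left side of (i), with \<open>starH y\<close> for \<open>x\<close>, the coefficient of an
  identity in \<open>M\<close>.\<close>

lemma star_cond1:
  "(\<forall>y. tsum (\<Delta>\<^bsub>H\<^esub> y) (\<lambda>y1 y2. st y2 \<cdot>\<^bsub>M\<^esub> inA (\<gamma>\<^sub>s y1)) = inH y) \<longleftrightarrow>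
   (\<forall>y. tsum (\<Delta>\<^bsub>H\<^esub> y) (\<lambda>y1 r. tsum (\<Delta>\<^bsub>H\<^esub> r) (\<lambda>y2 y3. \<gamma> y2 \<cdot>\<^bsub>A\<^esub> act y3 (\<gamma>\<^sub>s y1))) = \<epsilon>\<^bsub>H\<^esub> y *\<^sub>C \<^bold>1\<^bsub>A\<^esub>)"
proof -
  let ?F = "\<lambda>y. tsum (\<Delta>\<^bsub>H\<^esub> y) (\<lambda>y1 r. tsum (\<Delta>\<^bsub>H\<^esub> r) (\<lambda>y2 y3. \<gamma> y2 \<cdot>\<^bsub>A\<^esub> act y3 (\<gamma>\<^sub>s y1)))"
  have 1: "tsum (\<Delta>\<^bsub>H\<^esub> y) (\<lambda>y1 y2. st y2 \<cdot>\<^bsub>M\<^esub> inA (\<gamma>\<^sub>s y1)) = tsum (\<Delta>\<^bsub>H\<^esub> y) (\<lambda>w z. inA (?F w) \<cdot>\<^bsub>M\<^esub> inH z)" for y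
    by (simp add: st_inA inA_tsum M.mu_tsum H.coassoc_lin)
  have 2: "inH y = tsum (\<Delta>\<^bsub>H\<^esub> y) (\<lambda>w z. inA (\<epsilon>\<^bsub>H\<^esub> w *\<^sub>C \<^bold>1\<^bsub>A\<^esub>) \<cdot>\<^bsub>M\<^esub> inH z)" for y
    by (simp add: H.counit_lin)
  show ?thesis
    unfolding 1 by (subst 2, rule coefficient) simp_all
qed

text \<open>The same comparison for (ii), with \<open>b\<close> standing for the star of
  \<open>a\<close>.\<close>

lemma star_cond2:
  "(\<forall>y b. tsum (\<Delta>\<^bsub>H\<^esub> y) (\<lambda>y1 y2. st y2 \<cdot>\<^bsub>M\<^esub> inA (act\<^sub>s y1 b)) = inA b \<cdot>\<^bsub>M\<^esub> st y) \<longleftrightarrow>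
   (\<forall>y b. tsum (\<Delta>\<^bsub>H\<^esub> y) (\<lambda>y1 r. tsum (\<Delta>\<^bsub>H\<^esub> r) (\<lambda>y2 y3. \<gamma> y2 \<cdot>\<^bsub>A\<^esub> act y3 (act\<^sub>s y1 b))) = b \<cdot>\<^bsub>A\<^esub> \<gamma> y)"
proof -
  let ?F = "\<lambda>b y. tsum (\<Delta>\<^bsub>H\<^esub> y) (\<lambda>y1 r. tsum (\<Delta>\<^bsub>H\<^esub> r) (\<lambda>y2 y3. \<gamma> y2 \<cdot>\<^bsub>A\<^esub> act y3 (act\<^sub>s y1 b)))"
  have 1: "tsum (\<Delta>\<^bsub>H\<^esub> y) (\<lambda>y1 y2. st y2 \<cdot>\<^bsub>M\<^esub> inA (act\<^sub>s y1 b)) = tsum (\<Delta>\<^bsub>H\<^esub> y) (\<lambda>w z. inA (?F b w) \<cdot>\<^bsub>M\<^esub> inH z)" for y b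
    by (simp add: st_inA inA_tsum M.mu_tsum H.coassoc_lin)
  have 2: "inA b \<cdot>\<^bsub>M\<^esub> st y = tsum (\<Delta>\<^bsub>H\<^esub> y) (\<lambda>w z. inA (b \<cdot>\<^bsub>A\<^esub> \<gamma> w) \<cdot>\<^bsub>M\<^esub> inH z)" for y b
    by (simp add: st_def M.mu_tsum inA_inA_assoc)
  have 3: "semilin id (?F b)" "semilin id (\<lambda>w. b \<cdot>\<^bsub>A\<^esub> \<gamma> w)" for b
    by simp_all
  show ?thesis
    unfolding 1 2 using coefficient[OF 3] by (metis (no_types, lifting))
qed

text \<open>The same comparison for (iii) in two variables; the factors in \<open>H\<close> appear
  as \<open>y2\<close> times \<open>x2\<close> because the involution reverses products.\<close>

lemma star_cond3:
  "(\<forall>x y. tsum (\<Delta>\<^bsub>H\<^esub> x) (\<lambda>x1 x2. tsum (\<Delta>\<^bsub>H\<^esub> y) (\<lambda>y1 y2. st (y2 \<cdot>\<^bsub>H\<^esub> x2) \<cdot>\<^bsub>M\<^esub> inA (\<chi>\<^sub>s x1 y1))) = st y \<cdot>\<^bsub>M\<^esub> st x) \<longleftrightarrow>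
   (\<forall>x y. tsum (\<Delta>\<^bsub>H\<^esub> x) (\<lambda>x1 x2. tsum (\<Delta>\<^bsub>H\<^esub> y) (\<lambda>y1 r. tsum (\<Delta>\<^bsub>H\<^esub> r) (\<lambda>y2 y3.
      \<gamma> y1 \<cdot>\<^bsub>A\<^esub> act y2 (\<gamma> x1) \<cdot>\<^bsub>A\<^esub> \<chi> y3 x2)))
    = tsum (\<Delta>\<^bsub>H\<^esub> x) (\<lambda>x1 s. tsum (\<Delta>\<^bsub>H\<^esub> s) (\<lambda>x2 x3. tsum (\<Delta>\<^bsub>H\<^esub> y) (\<lambda>y1 r. tsum (\<Delta>\<^bsub>H\<^esub> r) (\<lambda>y2 y3.
      \<gamma> (y2 \<cdot>\<^bsub>H\<^esub> x2) \<cdot>\<^bsub>A\<^esub> act (y3 \<cdot>\<^bsub>H\<^esub> x3) (\<chi>\<^sub>s x1 y1))))))"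
proof -
  define X Y where XY: "X = H" "Y = H"
  interpret X: ccoalgebra X by (simp add: XY H.ccoalgebra)
  interpret Y: ccoalgebra Y by (simp add: XY H.ccoalgebra)
  note com = tsum_commute[of "\<Delta>\<^bsub>Y\<^esub> u" "\<Delta>\<^bsub>X\<^esub> v" for u v]
  note norm = X.coassoc_lin X.coassoc2 Y.coassoc_lin Y.coassoc2 com M.mu_tsum M.mult_assoc A.mult_assoc inA_tsum
  let ?F = "\<lambda>x y. tsum (\<Delta>\<^bsub>X\<^esub> x) (\<lambda>x1 x2. tsum (\<Delta>\<^bsub>Y\<^esub> y) (\<lambda>y1 r. tsum (\<Delta>\<^bsub>Y\<^esub> r) (\<lambda>y2 y3.
      \<gamma> y1 \<cdot>\<^bsub>A\<^esub> act y2 (\<gamma> x1) \<cdot>\<^bsub>A\<^esub> \<chi> y3 x2)))"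
  let ?G = "\<lambda>x y. tsum (\<Delta>\<^bsub>X\<^esub> x) (\<lambda>x1 s. tsum (\<Delta>\<^bsub>X\<^esub> s) (\<lambda>x2 x3. tsum (\<Delta>\<^bsub>Y\<^esub> y) (\<lambda>y1 r. tsum (\<Delta>\<^bsub>Y\<^esub> r) (\<lambda>y2 y3.
      \<gamma> (y2 \<cdot>\<^bsub>H\<^esub> x2) \<cdot>\<^bsub>A\<^esub> act (y3 \<cdot>\<^bsub>H\<^esub> x3) (\<chi>\<^sub>s x1 y1)))))"
  have 1: "st y \<cdot>\<^bsub>M\<^esub> st x = tsum (\<Delta>\<^bsub>X\<^esub> x) (\<lambda>x1 x2. tsum (\<Delta>\<^bsub>Y\<^esub> y) (\<lambda>y1 y2. inA (?F x1 y1) \<cdot>\<^bsub>M\<^esub> inH (y2 \<cdot>\<^bsub>H\<^esub> x2)))" for x y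
  proof -
    have "st y = tsum (\<Delta>\<^bsub>Y\<^esub> y) (\<lambda>y1 y2. inA (\<gamma> y1) \<cdot>\<^bsub>M\<^esub> inH y2)" "st x = tsum (\<Delta>\<^bsub>X\<^esub> x) (\<lambda>x1 x2. inA (\<gamma> x1) \<cdot>\<^bsub>M\<^esub> inH x2)"
      by (simp_all add: st_def XY)
    moreover have "inH y \<cdot>\<^bsub>M\<^esub> (inA a \<cdot>\<^bsub>M\<^esub> t) = tsum (\<Delta>\<^bsub>Y\<^esub> y) (\<lambda>x1 x2. inA (act x1 a) \<cdot>\<^bsub>M\<^esub> (inH x2 \<cdot>\<^bsub>M\<^esub> t))" for y a t
      by (simp add: inH_inA_assoc XY)
    moreover have "inH y \<cdot>\<^bsub>M\<^esub> inH x = tsum (\<Delta>\<^bsub>X\<^esub> x) (\<lambda>x1 x2. tsum (\<Delta>\<^bsub>Y\<^esub> y) (\<lambda>y1 y2. inA (\<chi> y1 x1) \<cdot>\<^bsub>M\<^esub> inH (y2 \<cdot>\<^bsub>H\<^esub> x2)))" for y x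
      by (simp add: inH_inH XY tsum_commute[of "\<Delta>\<^bsub>H\<^esub> x"])
    ultimately show ?thesis
      by (simp add: norm inA_inA_assoc)
  qed
  have 2: "tsum (\<Delta>\<^bsub>X\<^esub> x) (\<lambda>x1 x2. tsum (\<Delta>\<^bsub>Y\<^esub> y) (\<lambda>y1 y2. st (y2 \<cdot>\<^bsub>H\<^esub> x2) \<cdot>\<^bsub>M\<^esub> inA (\<chi>\<^sub>s x1 y1)))
    = tsum (\<Delta>\<^bsub>X\<^esub> x) (\<lambda>x1 x2. tsum (\<Delta>\<^bsub>Y\<^esub> y) (\<lambda>y1 y2. inA (?G x1 y1) \<cdot>\<^bsub>M\<^esub> inH (y2 \<cdot>\<^bsub>H\<^esub> x2)))" for x y
  proof -
    have "st (y \<cdot>\<^bsub>H\<^esub> x) \<cdot>\<^bsub>M\<^esub> inA b = tsum (\<Delta>\<^bsub>Y\<^esub> y) (\<lambda>y1 s. tsum (\<Delta>\<^bsub>X\<^esub> x) (\<lambda>x1 r. tsum (\<Delta>\<^bsub>Y\<^esub> s) (\<lambda>y2 y3. tsum (\<Delta>\<^bsub>X\<^esub> r) (\<lambda>x2 x3.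
      inA (\<gamma> (y1 \<cdot>\<^bsub>H\<^esub> x1) \<cdot>\<^bsub>A\<^esub> act (y2 \<cdot>\<^bsub>H\<^esub> x2) b) \<cdot>\<^bsub>M\<^esub> inH (y3 \<cdot>\<^bsub>H\<^esub> x3)))))" for x y b
      by (simp add: st_inA H.tsum_Delta_mult[of id] XY)
    then show ?thesis
      by (simp add: norm)
  qed
  show ?thesis
    using coefficient2[of ?F ?G] unfolding 1[unfolded XY] 2[unfolded XY] unfolding XY by (simp, metis)
qed

section \<open>The involution on products of generators\<close>

lemma starM_starM_iff: "(\<forall>x. starM (starM (inH x)) = inH x) \<longleftrightarrow>
   (\<forall>y. tsum (\<Delta>\<^bsub>H\<^esub> y) (\<lambda>y1 y2. st y2 \<cdot>\<^bsub>M\<^esub> inA (\<gamma>\<^sub>s y1)) = inH y)"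
proof -
  have "starM (starM (inH x)) = tsum (\<Delta>\<^bsub>H\<^esub> x) (\<lambda>y1 y2. st y2 \<cdot>\<^bsub>M\<^esub> inA (\<gamma>\<^sub>s y1))" for x
    by (simp add: starM_inH st_def[of "starH x"] inA_inH starM_tsum starM_pure)
      (simp add: SH.tsum_Delta_star[of cnj] \<gamma>\<^sub>s_def)
  then show ?thesis by simp
qed

lemma starM_inH_inA: "starM (inH (starH y) \<cdot>\<^bsub>M\<^esub> inA (starA b)) = tsum (\<Delta>\<^bsub>H\<^esub> y) (\<lambda>y1 y2. st y2 \<cdot>\<^bsub>M\<^esub> inA (act\<^sub>s y1 b))"
  by (simp add: inH_inA inA_inH starM_tsum starM_pure) (simp add: SH.tsum_Delta_star[of cnj] act\<^sub>s_def)

lemma starM_inH_inH: "starM (inH (starH x) \<cdot>\<^bsub>M\<^esub> inH (starH y))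
    = tsum (\<Delta>\<^bsub>H\<^esub> x) (\<lambda>x1 x2. tsum (\<Delta>\<^bsub>H\<^esub> y) (\<lambda>y1 y2. st (y2 \<cdot>\<^bsub>H\<^esub> x2) \<cdot>\<^bsub>M\<^esub> inA (\<chi>\<^sub>s x1 y1)))"
  by (simp add: inH_inH inA_inH starM_tsum starM_pure SH.star_mult) (simp add: SH.tsum_Delta_star[of cnj] \<chi>\<^sub>s_def)

text \<open>Viewed as a map into the opposite algebra, the involution falls under
  \<open>cross_hom_mult\<close>; the assumptions supply its two exchange hypotheses.\<close>

lemma starM_mult:
  assumes 2: "\<And>y b. tsum (\<Delta>\<^bsub>H\<^esub> y) (\<lambda>y1 y2. st y2 \<cdot>\<^bsub>M\<^esub> inA (act\<^sub>s y1 b)) = inA b \<cdot>\<^bsub>M\<^esub> st y"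
    and 3: "\<And>x y. tsum (\<Delta>\<^bsub>H\<^esub> x) (\<lambda>x1 x2. tsum (\<Delta>\<^bsub>H\<^esub> y) (\<lambda>y1 y2. st (y2 \<cdot>\<^bsub>H\<^esub> x2) \<cdot>\<^bsub>M\<^esub> inA (\<chi>\<^sub>s x1 y1))) = st y \<cdot>\<^bsub>M\<^esub> st x"
  shows "starM (s \<cdot>\<^bsub>M\<^esub> t) = starM t \<cdot>\<^bsub>M\<^esub> starM s"
proof -
  have "tsum (s \<cdot>\<^bsub>M\<^esub> t) (\<lambda>a x. inA (starA a) \<cdot>\<^bsub>op_bialg M\<^esub> st (starH x))
    = tsum s (\<lambda>a x. inA (starA a) \<cdot>\<^bsub>op_bialg M\<^esub> st (starH x)) \<cdot>\<^bsub>op_bialg M\<^esub> tsum t (\<lambda>a x. inA (starA a) \<cdot>\<^bsub>op_bialg M\<^esub> st (starH x))"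
  proof (rule cross_hom_mult[OF calgebra_op[OF calgebra_M], of cnj])
    show "st (starH x) \<cdot>\<^bsub>op_bialg M\<^esub> inA (starA a) = tsum (\<Delta>\<^bsub>H\<^esub> x) (\<lambda>x1 x2. inA (starA (act x1 a)) \<cdot>\<^bsub>op_bialg M\<^esub> st (starH x2))" for x a
    proof -
      have "tsum (\<Delta>\<^bsub>H\<^esub> x) (\<lambda>x1 x2. st (starH x2) \<cdot>\<^bsub>M\<^esub> inA (starA (act x1 a))) = inA (starA a) \<cdot>\<^bsub>M\<^esub> st (starH x)"
        using 2[of "starH x" "starA a"] by (simp add: SH.tsum_Delta_star[of id] act\<^sub>s_def)
      then show ?thesis by simp
    qed
    show "st (starH x) \<cdot>\<^bsub>op_bialg M\<^esub> st (starH y) = tsum (\<Delta>\<^bsub>H\<^esub> x) (\<lambda>x1 x2. tsum (\<Delta>\<^bsub>H\<^esub> y) (\<lambda>y1 y2.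
        inA (starA (\<chi> x1 y1)) \<cdot>\<^bsub>op_bialg M\<^esub> st (starH (x2 \<cdot>\<^bsub>H\<^esub> y2))))" for x y
      using 3[of "starH x" "starH y"] by (simp add: SH.tsum_Delta_star[of id] \<chi>\<^sub>s_def SH.star_mult)
  qed (simp_all add: SA.star_mult inA_inA)
  then show ?thesis
    by (simp add: starM_eq)
qed

end

context cocycle_linked_pair_star
begin

definition "Js y = \<^bold>1\<^bsub>M\<^esub> \<otimes>\<^sub>\<complex> st y"
definition "starN s = tsum s (\<lambda>m n. starM m \<otimes>\<^sub>\<complex> starM n)"
definition "inAA t = tsum t (\<lambda>u v. inA u \<otimes>\<^sub>\<complex> inA v)"

abbreviation "RJ \<equiv> conv H N Rh Jh"

text \<open>\<open>Vl\<close> and \<open>Vr\<close> are the two sides of (v), and \<open>cond4\<close> is (iv), after the substitution of \<open>starH y\<close> for \<open>x\<close>.\<close>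

definition "Vl y = tsum (\<Delta>\<^bsub>H\<^esub> y) (\<lambda>y1 y2. tsum (\<Delta>\<^bsub>A\<^esub> (\<gamma> y1)) (\<lambda>g1 g2. tsum (\<psi> y2) (\<lambda>u v.
   (g1 \<cdot>\<^bsub>A\<^esub> u) \<otimes>\<^sub>\<complex> (g2 \<cdot>\<^bsub>A\<^esub> v))))"

definition "Vr y = tsum (\<Delta>\<^bsub>H\<^esub> y) (\<lambda>y1 r1. tsum (\<Delta>\<^bsub>H\<^esub> r1) (\<lambda>y2 r2. tsum (\<Delta>\<^bsub>H\<^esub> r2) (\<lambda>y3 r3. tsum (\<Delta>\<^bsub>H\<^esub> r3) (\<lambda>y4 y5.
    tsum (\<psi>\<^sub>s y1) (\<lambda>u v. tsum (\<rho>\<^sub>s y2) (\<lambda>h k. tsum (\<rho>\<^sub>s y3) (\<lambda>h' k'.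
      (\<gamma> h \<cdot>\<^bsub>A\<^esub> act h' u) \<otimes>\<^sub>\<complex> (\<gamma> y4 \<cdot>\<^bsub>A\<^esub> act y5 (k' \<cdot>\<^bsub>A\<^esub> (k \<cdot>\<^bsub>A\<^esub> v))))))))))"

definition "cond4 \<longleftrightarrow> (\<forall>y. tsum (\<Delta>\<^bsub>H\<^esub> y) (\<lambda>y1 y2. tsum (\<rho> y2) (\<lambda>h k. h \<otimes>\<^sub>\<complex> (\<gamma> y1 \<cdot>\<^bsub>A\<^esub> k)))
  = tsum (\<Delta>\<^bsub>H\<^esub> y) (\<lambda>y1 r. tsum (\<Delta>\<^bsub>H\<^esub> r) (\<lambda>y2 y3. tsum (\<rho>\<^sub>s y1) (\<lambda>h k. h \<otimes>\<^sub>\<complex> (\<gamma> y2 \<cdot>\<^bsub>A\<^esub> act y3 k)))))"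

lemma semilin_star_defs [simp]:
  "semilin \<sigma> f \<Longrightarrow> semilin \<sigma> (\<lambda>x. Js (f x))" "semilin \<sigma> g \<Longrightarrow> semilin \<sigma> (\<lambda>x. inAA (g x))"
  "semilin id f \<Longrightarrow> semilin id (\<lambda>x. Vl (f x))" "semilin id f \<Longrightarrow> semilin id (\<lambda>x. Vr (f x))"
  "semilin id h \<Longrightarrow> semilin cnj (\<lambda>x. starN (h x))" "semilin cnj h \<Longrightarrow> semilin id (\<lambda>x. starN (h x))"
  "semilin \<sigma> f \<Longrightarrow> semilin \<sigma> (\<lambda>x. RJ (f x))"
  by (simp_all add: Js_def starN_def inAA_def Vl_def Vr_def conv_def)

section \<open>The involution on the tensor square and conditions (iv) and (v)\<close>

lemma starN_tsum: "starN (tsum t f) = tsum t (\<lambda>u v. starN (f u v))"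
  by (rule semilin_image_tsum[OF semilin_star_defs(5)[OF semilin_ident]])

lemma starN_pure: "starN (m \<otimes>\<^sub>\<complex> n) = starM m \<otimes>\<^sub>\<complex> starM n"
  by (simp add: starN_def tsum_pure_semilin[of cnj] starM_antilin)

lemma inAA_tsum: "inAA (tsum t f) = tsum t (\<lambda>u v. inAA (f u v))"
  by (rule semilin_image_tsum[OF semilin_star_defs(2)[OF semilin_ident]])

lemma inAA_pure [simp]: "inAA (u \<otimes>\<^sub>\<complex> v) = inA u \<otimes>\<^sub>\<complex> inA v"
  by (simp add: inAA_def)

lemma tsum_\<rho>\<^sub>s: "(\<And>b. semilin id (\<lambda>a. f a b)) \<Longrightarrow> (\<And>a. semilin id (f a)) \<Longrightarrow>
    tsum (\<rho>\<^sub>s y) f = tsum (\<rho> (starH y)) (\<lambda>h k. f (starH h) (starA k))"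
  and tsum_\<psi>\<^sub>s: "(\<And>b. semilin id (\<lambda>a. g a b)) \<Longrightarrow> (\<And>a. semilin id (g a)) \<Longrightarrow>
    tsum (\<psi>\<^sub>s y) g = tsum (\<psi> (starH y)) (\<lambda>h k. g (starA h) (starA k))"
  by (simp_all add: \<rho>\<^sub>s_def \<psi>\<^sub>s_def tsum_tsum_lin)

text \<open>Conjugating the comultiplicativity of \<open>\<rho>\<close> reverses the factors in
  \<open>A\<close>, since \<open>starA\<close> is antimultiplicative.\<close>

lemma \<rho>\<^sub>s_comult:
  assumes "\<And>b c. semilin id (\<lambda>a. f a b c)" "\<And>a c. semilin id (\<lambda>b. f a b c)" "\<And>a b. semilin id (\<lambda>c. f a b c)"
  shows "tsum (\<rho>\<^sub>s y) (\<lambda>h k. tsum (\<Delta>\<^bsub>H\<^esub> h) (\<lambda>h1 h2. f h1 h2 k))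
    = tsum (\<Delta>\<^bsub>H\<^esub> y) (\<lambda>y1 y2. tsum (\<rho>\<^sub>s y1) (\<lambda>h k. tsum (\<rho>\<^sub>s y2) (\<lambda>h' k'. f h h' (k' \<cdot>\<^bsub>A\<^esub> k))))"
proof -
  note anti = semilin_lin_compose[OF assms(1)] semilin_lin_compose[OF assms(2)] semilin_lin_compose[OF assms(3)]
  have "tsum (\<rho> (starH y)) (\<lambda>h k. tsum (\<Delta>\<^bsub>H\<^esub> h) (\<lambda>h1 h2. f (starH h1) (starH h2) (starA k)))
    = tsum (\<Delta>\<^bsub>H\<^esub> (starH y)) (\<lambda>y1 y2. tsum (\<rho> y1) (\<lambda>h k. tsum (\<rho> y2) (\<lambda>h' k'.
        f (starH h) (starH h') (starA (k \<cdot>\<^bsub>A\<^esub> k')))))"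
    by (rule \<rho>_comult_lift[of cnj]) (simp_all add: anti)
  then show ?thesis
    by (simp add: tsum_\<rho>\<^sub>s SH.tsum_Delta_star[of id] SH.tsum_Delta_star[of cnj] SA.star_mult anti)
qed

lemma \<psi>\<^sub>s_eps: "semilin id f \<Longrightarrow> tsum (\<psi>\<^sub>s y) (\<lambda>u v. \<epsilon>\<^bsub>A\<^esub> u *\<^sub>C f v) = \<epsilon>\<^bsub>H\<^esub> y *\<^sub>C f \<^bold>1\<^bsub>A\<^esub>"
  using arg_cong[OF \<psi>_counit_left[of "starH y"], of "\<lambda>a. f (starA a)"]
  by (simp add: tsum_\<psi>\<^sub>s SA.star_tsum semilin_image_tsum semilin_scale)

lemma starN_Dj: "starN (Dj (starH y)) = tsum (\<Delta>\<^bsub>H\<^esub> y) (\<lambda>y1 r. tsum (\<Delta>\<^bsub>H\<^esub> r) (\<lambda>y2 y3.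
    tsum (\<psi>\<^sub>s y1) (\<lambda>u v. tsum (\<rho>\<^sub>s y2) (\<lambda>h k. (st h \<cdot>\<^bsub>M\<^esub> inA u) \<otimes>\<^sub>\<complex> (st y3 \<cdot>\<^bsub>M\<^esub> inA (k \<cdot>\<^bsub>A\<^esub> v))))))"
  by (simp add: Dj_pure starN_tsum starN_pure starM_pure SA.star_mult SH.tsum_Delta_star[of cnj] tsum_\<psi>\<^sub>s tsum_\<rho>\<^sub>s)

text \<open>The coproduct of \<open>\<gamma>\<close> and the factor \<open>Ps\<close> combine into
  the coefficient \<open>Vl\<close>, leaving \<open>RJ\<close> on the right.\<close>

lemma Delta_st: "\<Delta>\<^bsub>M\<^esub> (st y) = tsum (\<Delta>\<^bsub>H\<^esub> y) (\<lambda>w z. inAA (Vl w) \<cdot>\<^bsub>N\<^esub> RJ z)"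
proof -
  have "\<Delta>\<^bsub>M\<^esub> (st y) = tsum (\<Delta>\<^bsub>H\<^esub> y) (\<lambda>y1 y2. Dl (\<gamma> y1) \<cdot>\<^bsub>N\<^esub> conv H N Ps RJ y2)"
    by (simp add: st_def semilin_image_tsum[OF M.Delta_lin] Delta_M_mult Dj_def)
  also have "\<dots> = conv H N (conv H N (\<lambda>y. Dl (\<gamma> y)) Ps) RJ y"
    by (simp add: HN.conv_assoc[of id]) (simp add: conv_def)
  also have "conv H N (\<lambda>y. Dl (\<gamma> y)) Ps = (\<lambda>y. inAA (Vl y))"
    by (rule ext) (simp add: conv_def Dl_def Ps_def Vl_def inAA_tsum N_pushes inA_inA)
  finally show ?thesis by (simp add: conv_def[of _ _ _ RJ])
qed

definition "prAA s = tsum s (\<lambda>m n. prA m \<otimes>\<^sub>\<complex> prA n)"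

lemma prAA_inAA_RJ: "prAA (inAA t \<cdot>\<^bsub>N\<^esub> RJ z) = \<epsilon>\<^bsub>H\<^esub> z *\<^sub>C t"
proof (rule tensor_ext[of id "\<lambda>t. prAA (inAA t \<cdot>\<^bsub>N\<^esub> RJ z)" "\<lambda>t. \<epsilon>\<^bsub>H\<^esub> z *\<^sub>C t"])
  show "prAA (inAA (u \<otimes>\<^sub>\<complex> v) \<cdot>\<^bsub>N\<^esub> RJ z) = \<epsilon>\<^bsub>H\<^esub> z *\<^sub>C (u \<otimes>\<^sub>\<complex> v)" for u v
    by (simp add: prAA_def conv_def Rh_def Jh_def N_pushes tsum_tsum_lin inA_inA_assoc)
      (simp add: eps_contract)
qed (simp_all add: prAA_def)

text \<open>The analogue of \<open>coefficient\<close> for the tensor square: \<open>prAA\<close>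
  reduces \<open>RJ z\<close> to its counit.\<close>

lemma coefficient_N:
  assumes "semilin id F" "semilin id G"
  shows "(\<forall>y. tsum (\<Delta>\<^bsub>H\<^esub> y) (\<lambda>w z. inAA (F w) \<cdot>\<^bsub>N\<^esub> RJ z) = tsum (\<Delta>\<^bsub>H\<^esub> y) (\<lambda>w z. inAA (G w) \<cdot>\<^bsub>N\<^esub> RJ z))
    \<longleftrightarrow> (\<forall>y. F y = G y)" (is "?L \<longleftrightarrow> ?R")
proof
  assume ?L
  show ?R
  proof
    fix y
    from \<open>?L\<close> have "prAA (tsum (\<Delta>\<^bsub>H\<^esub> y) (\<lambda>w z. inAA (F w) \<cdot>\<^bsub>N\<^esub> RJ z)) = prAA (tsum (\<Delta>\<^bsub>H\<^esub> y) (\<lambda>w z. inAA (G w) \<cdot>\<^bsub>N\<^esub> RJ z))"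
      by simp
    moreover have "semilin id prAA" unfolding prAA_def[abs_def] by simp
    ultimately show "F y = G y"
      by (simp add: semilin_image_tsum[of id prAA] prAA_inAA_RJ H.counit_lin assms)
  qed
qed simp

lemma prH_st [simp]: "prH (st y) = y"
  by (simp add: st_def inA_inH semilin_image_tsum[of id prH] H.counit_lin)

lemma cond4_of_comult:
  assumes "\<And>y. \<Delta>\<^bsub>M\<^esub> (st y) = starN (Dj (starH y))"
  shows cond4
  unfolding cond4_def
proof
  fix y
  define p where "p s = tsum s (\<lambda>m n. prH m \<otimes>\<^sub>\<complex> prA n)" for s :: "('a \<otimes>\<^sub>\<complex> 'h) \<otimes>\<^sub>\<complex> ('a \<otimes>\<^sub>\<complex> 'h)"
  have lin: "semilin id p" unfolding p_def by simp
  have "p (\<Delta>\<^bsub>M\<^esub> (a \<otimes>\<^sub>\<complex> x)) = tsum (\<rho> x) (\<lambda>h k. h \<otimes>\<^sub>\<complex> (a \<cdot>\<^bsub>A\<^esub> k))" for a x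
    unfolding p_def by (simp add: tsum_Delta_M_pure) (simp add: eps_contract A.mult_assoc)
  then have 1: "p (\<Delta>\<^bsub>M\<^esub> (st y)) = tsum (\<Delta>\<^bsub>H\<^esub> y) (\<lambda>y1 y2. tsum (\<rho> y2) (\<lambda>h k. h \<otimes>\<^sub>\<complex> (\<gamma> y1 \<cdot>\<^bsub>A\<^esub> k)))"
    by (simp add: st_def inA_inH semilin_image_tsum[OF M.Delta_lin] semilin_image_tsum[OF lin])
  have "prH (st h \<cdot>\<^bsub>M\<^esub> inA u) = \<epsilon>\<^bsub>A\<^esub> u *\<^sub>C h" for h u
    by (simp add: prH_mult) (simp add: inA_def)
  moreover have "prA (st y \<cdot>\<^bsub>M\<^esub> inA c) = tsum (\<Delta>\<^bsub>H\<^esub> y) (\<lambda>y1 y2. \<gamma> y1 \<cdot>\<^bsub>A\<^esub> act y2 c)" for y c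
    by (simp add: st_inA prA_tsum H.counit_lin)
  \<comment> \<open>Projecting the first leg to \<open>H\<close> leaves only the counit of
    \<open>u\<close>, so \<open>\<psi>\<^sub>s_eps\<close> removes \<open>\<psi>\<^sub>s\<close> in
    the next step.\<close>
  ultimately have "p (starN (Dj (starH y))) = tsum (\<Delta>\<^bsub>H\<^esub> y) (\<lambda>y1 r. tsum (\<Delta>\<^bsub>H\<^esub> r) (\<lambda>y2 y3. tsum (\<psi>\<^sub>s y1) (\<lambda>u v.
      \<epsilon>\<^bsub>A\<^esub> u *\<^sub>C tsum (\<rho>\<^sub>s y2) (\<lambda>h k. h \<otimes>\<^sub>\<complex> tsum (\<Delta>\<^bsub>H\<^esub> y3) (\<lambda>y1 y2. \<gamma> y1 \<cdot>\<^bsub>A\<^esub> act y2 (k \<cdot>\<^bsub>A\<^esub> v))))))"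
    by (simp add: starN_Dj semilin_image_tsum[OF lin]) (simp add: p_def scaleC_tsum)
  also have "\<dots> = tsum (\<Delta>\<^bsub>H\<^esub> y) (\<lambda>y1 r. tsum (\<Delta>\<^bsub>H\<^esub> r) (\<lambda>y2 y3. tsum (\<rho>\<^sub>s y1) (\<lambda>h k. h \<otimes>\<^sub>\<complex> (\<gamma> y2 \<cdot>\<^bsub>A\<^esub> act y3 k))))"
    by (simp add: \<psi>\<^sub>s_eps scaleC_tsum[symmetric] H.counit_lin pure_tsum tsum_commute[of "\<rho>\<^sub>s u" "\<Delta>\<^bsub>H\<^esub> v" for u v])
  finally show "tsum (\<Delta>\<^bsub>H\<^esub> y) (\<lambda>y1 y2. tsum (\<rho> y2) (\<lambda>h k. h \<otimes>\<^sub>\<complex> (\<gamma> y1 \<cdot>\<^bsub>A\<^esub> k)))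
    = tsum (\<Delta>\<^bsub>H\<^esub> y) (\<lambda>y1 r. tsum (\<Delta>\<^bsub>H\<^esub> r) (\<lambda>y2 y3. tsum (\<rho>\<^sub>s y1) (\<lambda>h k. h \<otimes>\<^sub>\<complex> (\<gamma> y2 \<cdot>\<^bsub>A\<^esub> act y3 k))))"
    using 1 assms[of y] by simp
qed

lemma cond4_lift:
  assumes cond4 "\<And>b. semilin id (\<lambda>a. f a b)" "\<And>a. semilin id (f a)"
  shows "tsum (\<Delta>\<^bsub>H\<^esub> y) (\<lambda>y1 y2. tsum (\<rho> y2) (\<lambda>h k. f h (\<gamma> y1 \<cdot>\<^bsub>A\<^esub> k)))
    = tsum (\<Delta>\<^bsub>H\<^esub> y) (\<lambda>y1 r. tsum (\<Delta>\<^bsub>H\<^esub> r) (\<lambda>y2 y3. tsum (\<rho>\<^sub>s y1) (\<lambda>h k. f h (\<gamma> y2 \<cdot>\<^bsub>A\<^esub> act y3 k))))"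
  using arg_cong[OF spec[OF assms(1)[unfolded cond4_def], of y], of "\<lambda>t. tsum t f"] assms(2,3)
  by (simp add: tsum_tsum_lin)

lemma N_pure_assoc: "(a \<otimes>\<^sub>\<complex> b) \<cdot>\<^bsub>N\<^esub> ((a' \<otimes>\<^sub>\<complex> b') \<cdot>\<^bsub>N\<^esub> t) = ((a \<cdot>\<^bsub>M\<^esub> a') \<otimes>\<^sub>\<complex> (b \<cdot>\<^bsub>M\<^esub> b')) \<cdot>\<^bsub>N\<^esub> t"
  by (simp add: N.mult_assoc[symmetric] N_pure)

lemmas com_s = tsum_commute[of "\<psi>\<^sub>s u" "\<Delta>\<^bsub>H\<^esub> v" for u v] tsum_commute[of "\<rho>\<^sub>s u" "\<Delta>\<^bsub>H\<^esub> v" for u v]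
  tsum_commute[of "\<rho>\<^sub>s u" "\<psi>\<^sub>s v" for u v] tsum_commute[of "\<rho> u" "\<Delta>\<^bsub>H\<^esub> v" for u v]

lemma starN_Dj_eq:
  assumes cond4
  shows "starN (Dj (starH y)) = tsum (\<Delta>\<^bsub>H\<^esub> y) (\<lambda>w z. inAA (Vr w) \<cdot>\<^bsub>N\<^esub> RJ z)"
proof -
  \<comment> \<open>\<open>B\<close> collects one conjugated coaction together with
    \<open>st\<close>; condition (iv) rewrites it as \<open>\<gamma>\<close> in the second leg times
    \<open>RJ\<close>.\<close>
  define B where "B w = tsum (\<Delta>\<^bsub>H\<^esub> w) (\<lambda>y3 y4. tsum (\<rho>\<^sub>s y3) (\<lambda>h k. inH h \<otimes>\<^sub>\<complex> (st y4 \<cdot>\<^bsub>M\<^esub> inA k)))" for w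
  have B: "B w = tsum (\<Delta>\<^bsub>H\<^esub> w) (\<lambda>y1 y2. (\<^bold>1\<^bsub>M\<^esub> \<otimes>\<^sub>\<complex> inA (\<gamma> y1)) \<cdot>\<^bsub>N\<^esub> RJ y2)" for w
  proof -
    have "B w = tsum (\<Delta>\<^bsub>H\<^esub> w) (\<lambda>v z. tsum (\<Delta>\<^bsub>H\<^esub> v) (\<lambda>y1 r. tsum (\<Delta>\<^bsub>H\<^esub> r) (\<lambda>y2 y3. tsum (\<rho>\<^sub>s y1) (\<lambda>h k.
        inH h \<otimes>\<^sub>\<complex> (inA (\<gamma> y2 \<cdot>\<^bsub>A\<^esub> act y3 k) \<cdot>\<^bsub>M\<^esub> inH z)))))"
      by (simp add: B_def st_inA pure_tsum com_s H.coassoc_lin)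
    also have "\<dots> = tsum (\<Delta>\<^bsub>H\<^esub> w) (\<lambda>v z. tsum (\<Delta>\<^bsub>H\<^esub> v) (\<lambda>y1 y2. tsum (\<rho> y2) (\<lambda>h k.
        inH h \<otimes>\<^sub>\<complex> (inA (\<gamma> y1 \<cdot>\<^bsub>A\<^esub> k) \<cdot>\<^bsub>M\<^esub> inH z))))"
      by (simp add: cond4_lift[OF assms, of "\<lambda>h c. inH h \<otimes>\<^sub>\<complex> (inA c \<cdot>\<^bsub>M\<^esub> inH z)" for z])
    also have "\<dots> = tsum (\<Delta>\<^bsub>H\<^esub> w) (\<lambda>y1 y2. (\<^bold>1\<^bsub>M\<^esub> \<otimes>\<^sub>\<complex> inA (\<gamma> y1)) \<cdot>\<^bsub>N\<^esub> RJ y2)"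
      by (simp add: H.coassoc_lin conv_def Rh_def Jh_def N_pushes inA_inA_assoc com_s)
    finally show ?thesis .
  qed
  \<comment> \<open>\<open>D\<close> arises when \<open>inA u\<close> is moved past
    \<open>RJ\<close>; here (iv) is used in the opposite direction, to return from
    \<open>\<rho>\<close> to \<open>\<rho>\<^sub>s\<close>.\<close>
  define D where "D u w = tsum (\<Delta>\<^bsub>H\<^esub> w) (\<lambda>y3 y4. (\<^bold>1\<^bsub>M\<^esub> \<otimes>\<^sub>\<complex> inA (\<gamma> y3)) \<cdot>\<^bsub>N\<^esub> Rp u y4)" for u w
  have D: "D u w = tsum (\<Delta>\<^bsub>H\<^esub> w) (\<lambda>y1 r. tsum (\<Delta>\<^bsub>H\<^esub> r) (\<lambda>y2 y3. tsum (\<rho>\<^sub>s y1) (\<lambda>h k.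
      inA (act h u) \<otimes>\<^sub>\<complex> inA (\<gamma> y2 \<cdot>\<^bsub>A\<^esub> act y3 k))))" for u w
    unfolding D_def Rp_def using cond4_lift[OF assms, of "\<lambda>h c. inA (act h u) \<otimes>\<^sub>\<complex> inA c" w]
    by (simp add: N_pushes inA_inA)
  have "starN (Dj (starH y)) = tsum (\<Delta>\<^bsub>H\<^esub> y) (\<lambda>y1 r. tsum (\<Delta>\<^bsub>H\<^esub> r) (\<lambda>y2 y3. tsum (\<psi>\<^sub>s y1) (\<lambda>u v.
    tsum (\<rho>\<^sub>s y2) (\<lambda>h k. tsum (\<Delta>\<^bsub>H\<^esub> h) (\<lambda>h1 h2.
      (inA (\<gamma> h1) \<cdot>\<^bsub>M\<^esub> (inH h2 \<cdot>\<^bsub>M\<^esub> inA u)) \<otimes>\<^sub>\<complex> (st y3 \<cdot>\<^bsub>M\<^esub> inA (k \<cdot>\<^bsub>A\<^esub> v)))))))"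
    by (simp add: starN_Dj st_def[of h for h] M.mu_tsum pure_tsum(1) M.mult_assoc)
  \<comment> \<open>The coproduct of the coaction component \<open>h\<close> becomes a pair of
    coactions, the second of which belongs to \<open>B\<close>.\<close>
  also have "\<dots> = tsum (\<Delta>\<^bsub>H\<^esub> y) (\<lambda>y1 r. tsum (\<Delta>\<^bsub>H\<^esub> r) (\<lambda>y2 w. tsum (\<psi>\<^sub>s y1) (\<lambda>u v. tsum (\<rho>\<^sub>s y2) (\<lambda>h k.
      (inA (\<gamma> h) \<otimes>\<^sub>\<complex> \<^bold>1\<^bsub>M\<^esub>) \<cdot>\<^bsub>N\<^esub> (B w \<cdot>\<^bsub>N\<^esub> (inA u \<otimes>\<^sub>\<complex> inA (k \<cdot>\<^bsub>A\<^esub> v)))))))"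
    by (simp add: \<rho>\<^sub>s_comult B_def N_pushes M.mult_assoc inA_inA A.mult_assoc com_s H.coassoc_lin)
  \<comment> \<open>Moving \<open>inA u\<close> and the factor containing \<open>k\<close> and
    \<open>v\<close> to the left of \<open>RJ\<close> creates \<open>Rp\<close> and
    \<open>Ka\<close>.\<close>
  also have "\<dots> = tsum (\<Delta>\<^bsub>H\<^esub> y) (\<lambda>y1 r. tsum (\<Delta>\<^bsub>H\<^esub> r) (\<lambda>y2 s. tsum (\<Delta>\<^bsub>H\<^esub> s) (\<lambda>w t. tsum (\<Delta>\<^bsub>H\<^esub> t) (\<lambda>y6 z.
      tsum (\<psi>\<^sub>s y1) (\<lambda>u v. tsum (\<rho>\<^sub>s y2) (\<lambda>h k.
      (inA (\<gamma> h) \<otimes>\<^sub>\<complex> \<^bold>1\<^bsub>M\<^esub>) \<cdot>\<^bsub>N\<^esub> (D u w \<cdot>\<^bsub>N\<^esub> (Ka (k \<cdot>\<^bsub>A\<^esub> v) y6 \<cdot>\<^bsub>N\<^esub> RJ z))))))))"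
    by (simp add: B D_def N.mu_tsum N.mult_assoc Rh_Jh_inA conv_def[of H N "Rp u" for u] conv_def[of H N "Ka a" for a]
      com_s H.coassoc_lin H.coassoc2)
  \<comment> \<open>\<open>act_mult\<close> identifies the two successive actions in the second leg
    with the single action on a product in \<open>Vr\<close>.\<close>
  also have "\<dots> = tsum (\<Delta>\<^bsub>H\<^esub> y) (\<lambda>w z. inAA (Vr w) \<cdot>\<^bsub>N\<^esub> RJ z)"
    by (simp add: D Vr_def inAA_tsum N.mu_tsum N_pure_assoc Ka_def inA_inA act_mult sweedler2_def
      inA_tsum pure_tsum A.mu_tsum A.mult_assoc com_s H.coassoc_lin H.coassoc2 H.coassoc3)
  finally show ?thesis .
qed

lemma comult_iff:
  "(\<forall>y. \<Delta>\<^bsub>M\<^esub> (st y) = starN (Dj (starH y))) \<longleftrightarrow> cond4 \<and> (\<forall>y. Vl y = Vr y)"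
proof -
  have "cond4 \<Longrightarrow> (\<forall>y. \<Delta>\<^bsub>M\<^esub> (st y) = starN (Dj (starH y))) \<longleftrightarrow> (\<forall>y. Vl y = Vr y)"
    unfolding Delta_st using coefficient_N[of Vl Vr] semilin_star_defs(3,4)[OF semilin_ident]
    by (simp add: starN_Dj_eq)
  then show ?thesis
    using cond4_of_comult by blast
qed

lemma starN_mult:
  assumes "\<And>s t. starM (s \<cdot>\<^bsub>M\<^esub> t) = starM t \<cdot>\<^bsub>M\<^esub> starM s"
  shows "starN (s \<cdot>\<^bsub>N\<^esub> t) = starN t \<cdot>\<^bsub>N\<^esub> starN s"
  using tensor_hom_mult[OF calgebra_M calgebra_M calgebra_op[OF calgebra_N], of cnj "\<lambda>m n. starM m \<otimes>\<^sub>\<complex> starM n" s t]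
  by (simp add: starN_def assms N_pure starM_antilin)

lemma star_hopf_algebra_M_iff:
  assumes "hopf_algebra M"
  shows "star_hopf_algebra M starM \<longleftrightarrow>
    (\<forall>y. tsum (\<Delta>\<^bsub>H\<^esub> y) (\<lambda>y1 y2. st y2 \<cdot>\<^bsub>M\<^esub> inA (\<gamma>\<^sub>s y1)) = inH y) \<and>
    (\<forall>y b. tsum (\<Delta>\<^bsub>H\<^esub> y) (\<lambda>y1 y2. st y2 \<cdot>\<^bsub>M\<^esub> inA (act\<^sub>s y1 b)) = inA b \<cdot>\<^bsub>M\<^esub> st y) \<and>
    (\<forall>x y. tsum (\<Delta>\<^bsub>H\<^esub> x) (\<lambda>x1 x2. tsum (\<Delta>\<^bsub>H\<^esub> y) (\<lambda>y1 y2. st (y2 \<cdot>\<^bsub>H\<^esub> x2) \<cdot>\<^bsub>M\<^esub> inA (\<chi>\<^sub>s x1 y1))) = st y \<cdot>\<^bsub>M\<^esub> st x) \<and>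
    (\<forall>y. \<Delta>\<^bsub>M\<^esub> (st y) = starN (Dj (starH y)))" (is "?L \<longleftrightarrow> ?R")
proof
  assume ?L
  then interpret SM: star_hopf_algebra M starM .
  have "\<forall>y. tsum (\<Delta>\<^bsub>H\<^esub> y) (\<lambda>y1 y2. st y2 \<cdot>\<^bsub>M\<^esub> inA (\<gamma>\<^sub>s y1)) = inH y"
    using SM.star_star starM_starM_iff by blast
  moreover have "tsum (\<Delta>\<^bsub>H\<^esub> y) (\<lambda>y1 y2. st y2 \<cdot>\<^bsub>M\<^esub> inA (act\<^sub>s y1 b)) = inA b \<cdot>\<^bsub>M\<^esub> st y" for y b
    using starM_inH_inA[of y b] by (simp add: SM.star_mult starM_inA starM_inH)
  moreover have "tsum (\<Delta>\<^bsub>H\<^esub> x) (\<lambda>x1 x2. tsum (\<Delta>\<^bsub>H\<^esub> y) (\<lambda>y1 y2. st (y2 \<cdot>\<^bsub>H\<^esub> x2) \<cdot>\<^bsub>M\<^esub> inA (\<chi>\<^sub>s x1 y1))) = st y \<cdot>\<^bsub>M\<^esub> st x" for x y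
    using starM_inH_inH[of x y] by (simp add: SM.star_mult starM_inH)
  moreover have "\<Delta>\<^bsub>M\<^esub> (st y) = starN (Dj (starH y))" for y
    using SM.star_comult[of "inH (starH y)"] by (simp add: starM_inH sweedler2_def starN_def)
  ultimately show ?R by blast
next
  assume R: ?R
  have mult: "starM (s \<cdot>\<^bsub>M\<^esub> t) = starM t \<cdot>\<^bsub>M\<^esub> starM s" for s t
    using starM_mult R by blast
  have inH: "starM (starM (inH x)) = inH x" for x
    using R starM_starM_iff by blast
  \<comment> \<open>Antimultiplicativity reduces the claim to the factors \<open>inA a\<close> and
    \<open>inH x\<close> of \<open>a # x\<close>.\<close>
  have star_star: "starM (starM t) = t" for t
  proof -
    have *: "starM (starM (a \<otimes>\<^sub>\<complex> x)) = a \<otimes>\<^sub>\<complex> x" for a x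
      by (simp add: inA_inH[symmetric] mult inH starM_inA)
    show ?thesis
      by (rule tensor_ext[of id "\<lambda>t. starM (starM t)" "\<lambda>t. t"]) (simp_all add: *)
  qed
  \<comment> \<open>Both sides reverse products, so agreement on the two kinds of generators
    suffices.\<close>
  have comult: "\<Delta>\<^bsub>M\<^esub> (starM t) = starN (\<Delta>\<^bsub>M\<^esub> t)" for t
  proof -
    have "starN (Dl a) = Dl (starA a)" for a
      by (simp add: Dl_def starN_tsum starN_pure starM_inA SA.tsum_Delta_star[of id])
    moreover have "\<Delta>\<^bsub>M\<^esub> (st (starH x)) = starN (Dj x)" for x
      using R SH.star_star by metis
    ultimately have *: "\<Delta>\<^bsub>M\<^esub> (starM (a \<otimes>\<^sub>\<complex> x)) = starN (\<Delta>\<^bsub>M\<^esub> (a \<otimes>\<^sub>\<complex> x))" for a x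
      by (simp add: starM_pure Delta_M_mult Delta_M_pure starN_mult[OF mult])
    show ?thesis
      by (rule tensor_ext[of cnj "\<lambda>t. \<Delta>\<^bsub>M\<^esub> (starM t)" "\<lambda>t. starN (\<Delta>\<^bsub>M\<^esub> t)"]) (simp_all add: *)
  qed
  interpret hM: hopf_algebra M by fact
  show ?L
    by unfold_locales
      (simp_all add: antilinear_iff_semilin starM_antilin star_star mult comult starN_def sweedler2_def)
qed

end

section \<open>The extension\<close>

lemma tsum_in_span:
  assumes "\<And>a b. f a b \<in> complex_vector.span S"
  shows "tsum t f \<in> complex_vector.span S"
proof -
  have "(\<Sum>(a, b)\<in>#M. f a b) \<in> complex_vector.span S" for M
    by (induction M) (auto simp: complex_vector.span_zero intro: complex_vector.span_add assms)
  then show ?thesis by (simp add: tsum_def)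
qed

context cocycle_linked_pair_star
begin

text \<open>Applying \<open>m \<otimes> y \<mapsto> inA (prA m) \<cdot> inH y\<close> to the
  coinvariance equation turns its left side into \<open>m\<close>, by \<open>prA_prH\<close>, and
  its right side into an element of the image of \<open>A\<close>.\<close>

lemma range_inA: "range inA = {m. sweedler2 M m (\<lambda>m1 m2. m1 \<otimes>\<^sub>\<complex> prH m2) = m \<otimes>\<^sub>\<complex> \<^bold>1\<^bsub>H\<^esub>}"
proof -
  define g where "g s = tsum s (\<lambda>m y. inA (prA m) \<cdot>\<^bsub>M\<^esub> inH y)" for s :: "('a \<otimes>\<^sub>\<complex> 'h) \<otimes>\<^sub>\<complex> 'h"
  have "tsum (\<Delta>\<^bsub>M\<^esub> (inA a)) (\<lambda>m n. m \<otimes>\<^sub>\<complex> prH n) = inA a \<otimes>\<^sub>\<complex> \<^bold>1\<^bsub>H\<^esub>" for a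
    by (simp add: Dl_def tsum_tsum_lin) (simp add: inA_def A.counit_lin)
  moreover have "m = inA (prA m)" if "tsum (\<Delta>\<^bsub>M\<^esub> m) (\<lambda>m n. m \<otimes>\<^sub>\<complex> prH n) = m \<otimes>\<^sub>\<complex> \<^bold>1\<^bsub>H\<^esub>" for m
    using arg_cong[OF that, of g] semilin_pure_eta by (simp add: g_def tsum_tsum_lin prA_prH)
  ultimately show ?thesis
    by (auto simp: sweedler2_def)
qed

lemma prH_starM: "prH (starM t) = starH (prH t)"
  by (simp add: starM_eq semilin_image_tsum[of id prH] prH_mult prH_def[of t] SH.star_tsum)
    (simp add: inA_def)

lemma kernel_prH:
  assumes "star_hopf_algebra M starM"
  shows "{m. prH m = 0} = complex_vector.span {m \<cdot>\<^bsub>M\<^esub> inA a |m a. \<epsilon>\<^bsub>A\<^esub> a = 0}"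
proof (intro equalityI subsetI CollectI)
  interpret SM: star_hopf_algebra M starM by fact
  fix m assume "m \<in> {m. prH m = 0}"
  then have m: "prH m = 0" by simp
  \<comment> \<open>Subtracting the counit from each coefficient in \<open>A\<close> exhibits
    \<open>s - inH (prH s)\<close> as a sum of products with left factor in the augmentation
    ideal.\<close>
  have "tsum s (\<lambda>a x. inA (a - \<epsilon>\<^bsub>A\<^esub> a *\<^sub>C \<^bold>1\<^bsub>A\<^esub>) \<cdot>\<^bsub>M\<^esub> inH x) = s - inH (prH s)" for s
  proof (rule tensor_ext[of id "\<lambda>s. tsum s (\<lambda>a x. inA (a - \<epsilon>\<^bsub>A\<^esub> a *\<^sub>C \<^bold>1\<^bsub>A\<^esub>) \<cdot>\<^bsub>M\<^esub> inH x)" "\<lambda>s. s - inH (prH s)"])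
    show "tsum (a \<otimes>\<^sub>\<complex> x) (\<lambda>a x. inA (a - \<epsilon>\<^bsub>A\<^esub> a *\<^sub>C \<^bold>1\<^bsub>A\<^esub>) \<cdot>\<^bsub>M\<^esub> inH x) = (a \<otimes>\<^sub>\<complex> x) - inH (prH (a \<otimes>\<^sub>\<complex> x))" for a x
      by (simp add: semilin_minus[of id inA] M.mu_lin semilin_minus[OF M.mu_lin(1)] inA_inH)
  qed simp_all
  from this[of "starM m"] have "starM m = tsum (starM m) (\<lambda>a x. inA (a - \<epsilon>\<^bsub>A\<^esub> a *\<^sub>C \<^bold>1\<^bsub>A\<^esub>) \<cdot>\<^bsub>M\<^esub> inH x)"
    using m semilin_zero[OF SH.star_antilin] by (simp add: prH_starM inH_def semilin_zero[OF semilin_pure_eta])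
  \<comment> \<open>The formula was applied to \<open>starM m\<close>, whose projection also
    vanishes; a second star moves the factors from the augmentation ideal to the right.\<close>
  then have "m = starM (tsum (starM m) (\<lambda>a x. inA (a - \<epsilon>\<^bsub>A\<^esub> a *\<^sub>C \<^bold>1\<^bsub>A\<^esub>) \<cdot>\<^bsub>M\<^esub> inH x))"
    by (metis SM.star_star)
  also have "\<dots> = tsum (starM m) (\<lambda>a x. st (starH x) \<cdot>\<^bsub>M\<^esub> inA (starA (a - \<epsilon>\<^bsub>A\<^esub> a *\<^sub>C \<^bold>1\<^bsub>A\<^esub>)))"
    by (simp add: starM_tsum SM.star_mult starM_inA starM_inH)
  finally show "m \<in> complex_vector.span {m \<cdot>\<^bsub>M\<^esub> inA a |m a. \<epsilon>\<^bsub>A\<^esub> a = 0}"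
  proof (rule ssubst, intro tsum_in_span complex_vector.span_base CollectI exI conjI)
    show "\<epsilon>\<^bsub>A\<^esub> (starA (a - \<epsilon>\<^bsub>A\<^esub> a *\<^sub>C \<^bold>1\<^bsub>A\<^esub>)) = 0" for a
      by (simp add: semilin_minus[OF A.eps_lin] semilin_scale[OF A.eps_lin] scaleC_complex_def)
  qed (rule refl)
next
  fix m assume "m \<in> complex_vector.span {m \<cdot>\<^bsub>M\<^esub> inA a |m a. \<epsilon>\<^bsub>A\<^esub> a = 0}"
  then show "prH m = 0"
  proof (induction rule: complex_vector.span_induct_alt)
    case base
    show ?case by (simp add: semilin_zero[of id])
  next
    case (step c x y)
    then have "prH x = 0" by (auto simp: prH_mult) (simp add: inA_def semilin_zero[OF H.mu_lin(2)])
    with step show ?case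
      by (simp add: semilin_add[of id prH] semilin_scale[of id prH])
  qed
qed

lemma star_hopf_extension_M:
  assumes "star_hopf_algebra M starM"
  shows "star_hopf_extension A starA M starM H starH inA prH"
proof -
  interpret SM: star_hopf_algebra M starM by fact
  have inA: "inA (S a) = S' (inA a)" if "antipode A S" "antipode M S'" for S S' a
    by (rule A.antipode_unique_hom[OF bialgebra_M, of inA S S']) (simp_all add: that inA_inA Dl_def semilin_inA[OF semilin_ident])
  have prH: "prH (S m) = S' (prH m)" if "antipode M S" "antipode H S'" for S S' m
    by (rule M.antipode_unique_hom[OF H.bialgebra_axioms, of prH S S'])
      (simp_all add: that prH_mult prH_one prH_comult eps_prH)
  have "hopf_hom A M inA"
    by (simp add: hopf_hom_def clinear_iff_semilin semilin_inA[OF semilin_ident] inA_inA Dl_def sweedler2_def inA)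
  moreover have "hopf_hom M H prH"
    by (simp add: hopf_hom_def clinear_iff_semilin prH_mult prH_one prH_comult eps_prH sweedler2_def prH)
  moreover have "inj inA"
    by (rule inj_on_inverseI[of _ prA]) (simp add: inA_def)
  moreover have "surj prH"
    by (rule surjI[of _ inH]) (simp add: inH_def)
  ultimately have "hopf_extension A M H inA prH"
    by (simp add: hopf_extension_def range_inA kernel_prH[OF assms] SA.hopf_algebra_axioms
        SH.hopf_algebra_axioms SM.hopf_algebra_axioms)
  then show ?thesis
    by (simp add: star_hopf_extension_def prH_starM starM_inA assms SA.star_hopf_algebra_axioms SH.star_hopf_algebra_axioms)
qed

text \<open>An involution is surjective, so a universally quantified condition may be rewritten
  under the substitution \<open>x = starH y\<close>.\<close>

lemma all_starH: "(\<And>y. P (starH y) \<longleftrightarrow> Q y) \<Longrightarrow> (\<forall>x. P x) \<longleftrightarrow> (\<forall>y. Q y)"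
  by (metis SH.star_star)

lemma all_starA: "(\<And>y. P (starA y) \<longleftrightarrow> Q y) \<Longrightarrow> (\<forall>x. P x) \<longleftrightarrow> (\<forall>y. Q y)"
  by (metis SA.star_star)

end

theorem theorem5p7:
  fixes A :: "'a::complex_vector bialg" and H :: "'h::complex_vector bialg"
    and act :: "'h \<Rightarrow> 'a \<Rightarrow> 'a" and \<rho> :: "'h \<Rightarrow> 'h \<otimes>\<^sub>\<complex> 'a"
    and \<chi> :: "'h \<Rightarrow> 'h \<Rightarrow> 'a" and \<psi> :: "'h \<Rightarrow> 'a \<otimes>\<^sub>\<complex> 'a"
    and starA :: "'a \<Rightarrow> 'a" and starH :: "'h \<Rightarrow> 'h" and \<gamma> :: "'h \<Rightarrow> 'a"
  assumes "cocycle_linked_pair A H act \<rho> \<chi> \<psi>"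
    and "conv_invertible (tensor_bialg H H) A (\<lambda>t. tsum t \<chi>)"
    and "conv_invertible H (tensor_bialg A A) \<psi>"
    and "star_hopf_algebra A starA"
    and "star_hopf_algebra H starH"
    and "clinear \<gamma>"
    and "\<gamma> \<^bold>1\<^bsub>H\<^esub> = \<^bold>1\<^bsub>A\<^esub>"
    and "\<forall>x. \<epsilon>\<^bsub>A\<^esub> (\<gamma> x) = \<epsilon>\<^bsub>H\<^esub> x"
  shows "(star_hopf_algebra (cocycle_bismash A H act \<rho> \<chi> \<psi>) (bismash_star A H act starA starH \<gamma>) \<longleftrightarrow>
      (\<forall>x. sweedler3 H x (\<lambda>x1 x2 x3. \<gamma> (starH x2) \<cdot>\<^bsub>A\<^esub> act (starH x3) (starA (\<gamma> x1)))
         = \<epsilon>\<^bsub>H\<^esub> (starH x) *\<^sub>C \<^bold>1\<^bsub>A\<^esub>) \<and>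
      (\<forall>x a. sweedler3 H x (\<lambda>x1 x2 x3. \<gamma> (starH x2) \<cdot>\<^bsub>A\<^esub> act (starH x3) (starA (act x1 a)))
         = starA a \<cdot>\<^bsub>A\<^esub> \<gamma> (starH x)) \<and>
      (\<forall>x y.
         sweedler2 H x (\<lambda>x1 x2. sweedler3 H y (\<lambda>y1 y2 y3.
           \<gamma> (starH y1) \<cdot>\<^bsub>A\<^esub> act (starH y2) (\<gamma> (starH x1)) \<cdot>\<^bsub>A\<^esub> \<chi> (starH y3) (starH x2)))
         = sweedler3 H x (\<lambda>x1 x2 x3. sweedler3 H y (\<lambda>y1 y2 y3.
           \<gamma> (starH y2 \<cdot>\<^bsub>H\<^esub> starH x2) \<cdot>\<^bsub>A\<^esub> act (starH y3 \<cdot>\<^bsub>H\<^esub> starH x3) (starA (\<chi> x1 y1))))) \<and>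
      (\<forall>x.
         sweedler2 H x (\<lambda>x1 x2. tsum (\<rho> (starH x2)) (\<lambda>zH zA. zH \<otimes>\<^sub>\<complex> (\<gamma> (starH x1) \<cdot>\<^bsub>A\<^esub> zA)))
         = sweedler3 H x (\<lambda>x1 x2 x3. tsum (\<rho> x1) (\<lambda>x1H x1A.
           starH x1H \<otimes>\<^sub>\<complex> (\<gamma> (starH x2) \<cdot>\<^bsub>A\<^esub> act (starH x3) (starA x1A))))) \<and>
      (\<forall>x.
         sweedler2 H x (\<lambda>x1 x2. sweedler2 A (\<gamma> (starH x1)) (\<lambda>g1 g2.
           tsum (\<psi> (starH x2)) (\<lambda>zI zII. (g1 \<cdot>\<^bsub>A\<^esub> zI) \<otimes>\<^sub>\<complex> (g2 \<cdot>\<^bsub>A\<^esub> zII))))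
         = sweedler5 H x (\<lambda>x1 x2 x3 x4 x5.
           tsum (\<psi> x1) (\<lambda>x1I x1II. tsum (\<rho> x2) (\<lambda>x2H x2A. tsum (\<rho> x3) (\<lambda>x3H x3A.
             (\<gamma> (starH x2H) \<cdot>\<^bsub>A\<^esub> act (starH x3H) (starA x1I)) \<otimes>\<^sub>\<complex>
             (\<gamma> (starH x4) \<cdot>\<^bsub>A\<^esub> act (starH x5) (starA (x1II \<cdot>\<^bsub>A\<^esub> x2A \<cdot>\<^bsub>A\<^esub> x3A)))))))))
    \<and> (star_hopf_algebra (cocycle_bismash A H act \<rho> \<chi> \<psi>) (bismash_star A H act starA starH \<gamma>) \<longrightarrow>
      star_hopf_extension A starA
        (cocycle_bismash A H act \<rho> \<chi> \<psi>) (bismash_star A H act starA starH \<gamma>)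
        H starH (\<lambda>a. a \<otimes>\<^sub>\<complex> \<^bold>1\<^bsub>H\<^esub>) (\<lambda>t. tsum t (\<lambda>a x. \<epsilon>\<^bsub>A\<^esub> a *\<^sub>C x)))"
proof -
  interpret cocycle_linked_pair_star A H act \<rho> \<chi> \<psi> starA starH \<gamma>
    using assms
    by (intro cocycle_linked_pair_star.intro cocycle_linked_pair_star_axioms.intro) (simp_all add: clinear_iff_semilin)
  have hopf: "hopf_algebra M"
    by (rule hopf_algebra_M[OF SA.hopf_algebra_axioms SH.hopf_algebra_axioms assms(2,3)])
  \<comment> \<open>Facts 1 to 5 translate the conditions of the statement, by the substitution of
    stars, into the identities between linear maps treated above.\<close>
  have 1: "(\<forall>x. sweedler3 H x (\<lambda>x1 x2 x3. \<gamma> (starH x2) \<cdot>\<^bsub>A\<^esub> act (starH x3) (starA (\<gamma> x1)))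
         = \<epsilon>\<^bsub>H\<^esub> (starH x) *\<^sub>C \<^bold>1\<^bsub>A\<^esub>) \<longleftrightarrow>
      (\<forall>y. tsum (\<Delta>\<^bsub>H\<^esub> y) (\<lambda>y1 y2. st y2 \<cdot>\<^bsub>M\<^esub> inA (\<gamma>\<^sub>s y1)) = inH y)"
    unfolding star_cond1
    by (rule all_starH) (simp add: sweedler_defs SH.tsum_Delta_star[of cnj] \<gamma>\<^sub>s_def)
  have 2: "(\<forall>x a. sweedler3 H x (\<lambda>x1 x2 x3. \<gamma> (starH x2) \<cdot>\<^bsub>A\<^esub> act (starH x3) (starA (act x1 a)))
         = starA a \<cdot>\<^bsub>A\<^esub> \<gamma> (starH x)) \<longleftrightarrow>
      (\<forall>y b. tsum (\<Delta>\<^bsub>H\<^esub> y) (\<lambda>y1 y2. st y2 \<cdot>\<^bsub>M\<^esub> inA (act\<^sub>s y1 b)) = inA b \<cdot>\<^bsub>M\<^esub> st y)"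
    unfolding star_cond2
    by (rule all_starH, rule all_starA) (simp add: sweedler_defs SH.tsum_Delta_star[of cnj] act\<^sub>s_def)
  have 3: "(\<forall>x y.
         sweedler2 H x (\<lambda>x1 x2. sweedler3 H y (\<lambda>y1 y2 y3.
           \<gamma> (starH y1) \<cdot>\<^bsub>A\<^esub> act (starH y2) (\<gamma> (starH x1)) \<cdot>\<^bsub>A\<^esub> \<chi> (starH y3) (starH x2)))
         = sweedler3 H x (\<lambda>x1 x2 x3. sweedler3 H y (\<lambda>y1 y2 y3.
           \<gamma> (starH y2 \<cdot>\<^bsub>H\<^esub> starH x2) \<cdot>\<^bsub>A\<^esub> act (starH y3 \<cdot>\<^bsub>H\<^esub> starH x3) (starA (\<chi> x1 y1))))) \<longleftrightarrow>
      (\<forall>x y. tsum (\<Delta>\<^bsub>H\<^esub> x) (\<lambda>x1 x2. tsum (\<Delta>\<^bsub>H\<^esub> y) (\<lambda>y1 y2. st (y2 \<cdot>\<^bsub>H\<^esub> x2) \<cdot>\<^bsub>M\<^esub> inA (\<chi>\<^sub>s x1 y1))) = st y \<cdot>\<^bsub>M\<^esub> st x)"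
    unfolding star_cond3
    by (rule all_starH, rule all_starH) (simp add: sweedler_defs SH.tsum_Delta_star[of cnj] \<chi>\<^sub>s_def)
  have 4: "(\<forall>x.
         sweedler2 H x (\<lambda>x1 x2. tsum (\<rho> (starH x2)) (\<lambda>zH zA. zH \<otimes>\<^sub>\<complex> (\<gamma> (starH x1) \<cdot>\<^bsub>A\<^esub> zA)))
         = sweedler3 H x (\<lambda>x1 x2 x3. tsum (\<rho> x1) (\<lambda>x1H x1A.
           starH x1H \<otimes>\<^sub>\<complex> (\<gamma> (starH x2) \<cdot>\<^bsub>A\<^esub> act (starH x3) (starA x1A))))) \<longleftrightarrow> cond4"
    unfolding cond4_def
    by (rule all_starH) (simp add: sweedler_defs SH.tsum_Delta_star[of cnj] tsum_\<rho>\<^sub>s)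
  have 5: "(\<forall>x.
         sweedler2 H x (\<lambda>x1 x2. sweedler2 A (\<gamma> (starH x1)) (\<lambda>g1 g2.
           tsum (\<psi> (starH x2)) (\<lambda>zI zII. (g1 \<cdot>\<^bsub>A\<^esub> zI) \<otimes>\<^sub>\<complex> (g2 \<cdot>\<^bsub>A\<^esub> zII))))
         = sweedler5 H x (\<lambda>x1 x2 x3 x4 x5.
           tsum (\<psi> x1) (\<lambda>x1I x1II. tsum (\<rho> x2) (\<lambda>x2H x2A. tsum (\<rho> x3) (\<lambda>x3H x3A.
             (\<gamma> (starH x2H) \<cdot>\<^bsub>A\<^esub> act (starH x3H) (starA x1I)) \<otimes>\<^sub>\<complex>
             (\<gamma> (starH x4) \<cdot>\<^bsub>A\<^esub> act (starH x5) (starA (x1II \<cdot>\<^bsub>A\<^esub> x2A \<cdot>\<^bsub>A\<^esub> x3A)))))))) \<longleftrightarrow>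
      (\<forall>y. Vl y = Vr y)"
    by (rule all_starH)
      (simp add: sweedler_defs Vl_def Vr_def SH.tsum_Delta_star[of cnj] tsum_\<rho>\<^sub>s tsum_\<psi>\<^sub>s SA.star_mult)
  have maps: "(\<lambda>a. a \<otimes>\<^sub>\<complex> \<^bold>1\<^bsub>H\<^esub>) = inA" "(\<lambda>t. tsum t (\<lambda>a x. \<epsilon>\<^bsub>A\<^esub> a *\<^sub>C x)) = prH"
    by (simp_all add: fun_eq_iff inA_def prH_def)
  show ?thesis
    unfolding 1 2 3 4 5 maps
    using star_hopf_algebra_M_iff[OF hopf] comult_iff star_hopf_extension_M by blast
qed

end
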